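(* Let $\alpha>-1$ and let $\{a_k\}_{k=0}^\infty$ be a sequence of real numbers. Let $p(y)=\sum_{k=0}^{\infty}\binom{k+\alpha}{k}a_k y^k$ be the associated formal power series, and define $\lambda_n:=\sum_{k=0}^{n}a_k\binom{n}{k}$ for $n\in\mathbb{N}$. Suppose the sequence $\{\lambda_n\}_{n=0}^\infty$ is non-trivial. Then $\{\lambda_n\}_{n=0}^\infty$ is an $\mathscr{L}_\alpha$-multiplier sequence if and only if $p(y)$ is a real-rooted polynomial all of whose zeros lie in the interval $[-1,0]$.
   Context: For $\alpha>-1$, the generalized Laguerre polynomials are $L_n^{(\alpha)}(x)=\sum_{k=0}^{n}\binom{n+\alpha}{n-k}\frac{(-x)^k}{k!}$, $n\in\mathbb{N}=\{0,1,2,\dots\}$, and $\mathscr{L}_\alpha=\{L_n^{(\alpha)}\}_{n=0}^\infty$ (a basis of $\mathbb{R}[x]$). Here $\binom{m+\alpha}{j}=\frac{(m+\alpha)(m+\alpha-1)\cdots(m+\alpha-j+1)}{j!}$. A real sequence $\{\lambda_n\}$ is an $\mathscr{L}_\alpha$-multiplier sequence if the linear operator $T:\mathbb{R}[x]\to\mathbb{R}[x]$ defined by $T(L_n^{(\alpha)})=\lambda_nL_n^{(\alpha)}$ for all $n$ maps real-rooted polynomials to real-rooted polynomials (constant polynomials, including $0$, count as real-rooted). A sequence $\{\lambda_n\}$ is trivial if there is $k\in\mathbb{N}$ such that $\lambda_n=0$ for all $n\notin\{k,k+1\}$; otherwise it is non-trivial. *)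

theory Defs
  imports "HOL-Analysis.Analysis" "HOL-Computational_Algebra.Polynomial"
begin

definition laguerre :: "real \<Rightarrow> nat \<Rightarrow> real poly" where
  "laguerre \<alpha> n =
     (\<Sum>k\<le>n. smult (((real n + \<alpha>) gchoose (n - k)) * (-1) ^ k / fact k) (monom 1 k))"

text \<open>Real-rooted: constants (including 0) count as real-rooted; otherwise
  every complex zero is real.\<close>
definition real_rooted :: "real poly \<Rightarrow> bool" where
  "real_rooted p \<longleftrightarrow> degree p = 0 \<or>
     (\<forall>z::complex. poly (map_poly complex_of_real p) z = 0 \<longrightarrow> z \<in> \<real>)"

definition laguerre_multiplier_seq :: "real \<Rightarrow> (nat \<Rightarrow> real) \<Rightarrow> bool" where
  "laguerre_multiplier_seq \<alpha> lam \<longleftrightarrow>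
     (\<exists>T :: real poly \<Rightarrow> real poly.
        (\<forall>p q. T (p + q) = T p + T q) \<and>
        (\<forall>c p. T (smult c p) = smult c (T p)) \<and>
        (\<forall>n. T (laguerre \<alpha> n) = smult (lam n) (laguerre \<alpha> n)) \<and>
        (\<forall>p. real_rooted p \<longrightarrow> real_rooted (T p)))"

definition trivial_seq :: "(nat \<Rightarrow> real) \<Rightarrow> bool" where
  "trivial_seq lam \<longleftrightarrow> (\<exists>k. \<forall>n. n \<notin> {k, Suc k} \<longrightarrow> lam n = 0)"

end

theory Submission
  imports Defs "HOL-Complex_Analysis.Complex_Analysis" "HOL-Computational_Algebra.Fundamental_Theorem_Algebra"
begin

text \<open>
  The multiplier \<open>T\<close> is a differential operator with \<open>T e^(-xy) = e^(-xy) S(x,y)\<close>, where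
  \<open>S(x,y) = \<Sum>k. a_k y^k L_k(x(1+y)) = \<Sum>j. (-x y (1+y))^j p^(j)(y) / (j! (\<alpha>+1)_j)\<close>.

  Sufficiency. Let \<open>F(s) = \<Sum>j. (-s)^j / (j! (\<alpha>+1)_j)\<close>, a limit of rescaled Laguerre polynomials. Then
  \<open>S(x,y) = p(y + x y (1+y) d/ds) F\<close> at \<open>s = 0\<close>, and each linear factor \<open>u + d/ds\<close> preserves the absence of
  zeros in a suitable half-plane, since \<open>(y+c)/(y(1+y)) = c/y + (1-c)/(1+y)\<close> with \<open>0 \<le> c \<le> 1\<close>. So \<open>S(x,\<cdot>)\<close> has
  no zeros in the upper half-plane when \<open>Im x > 0\<close>; factoring \<open>S(x,-D)\<close> into linear factors and applying
  the same principle to \<open>f\<close> shows that \<open>T f\<close> is real-rooted.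

  Necessity. If all members of a pencil are real-rooted, so are their images, and hence the Wronskian of the
  images of two members has constant sign. Applied to \<open>(x+z)^n\<close> this gives two facts about
  \<open>J(z) = T((x+z)^n)(0)\<close>: it is real-rooted, and \<open>r + n + \<alpha> \<ge> 2m + \<Sum>s. 2r/(r-s)\<close> for every
  nonzero root \<open>r\<close>, where \<open>m\<close> is the multiplicity of the root \<open>0\<close> and \<open>s\<close> runs over the other nonzero
  roots. Summing over the small roots with weight \<open>r\<^sup>2\<close> forces all nonzero roots to be at least
  \<open>(1 - o(1)) n\<close> in modulus. As the sum of their squares is \<open>O(n\<^sup>2)\<close>, their number is bounded, which makes
  \<open>p\<close> a polynomial. The inequality at the smallest root then excludes negative roots, and since the roots
  \<open>y\<close> of \<open>p\<close> are limits of \<open>-n/r\<close>, they lie in \<open>[-1, 0]\<close>.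
\<close>

section \<open>Real-rooted polynomials\<close>

text \<open>The Wronskian of the images of (x+z)^(n+1) and (x+z)^n has the sign of
  \<open>lam (Suc n) * lam n\<close>, so necessity depends on this product being positive for all
  large n. Three separate arguments give that: a zero of \<open>lam\<close> at a large index would
  make a pencil with degree gap at least two real-rooted; the sign of the product cannot change, by
  the quadratics x^2 + r x - s; and a negative sign would make \<open>a\<close> too large for
  Newton's inequality. The Wronskian becomes usable because the linear coefficient of T((x+z)^n) is
  a differential expression in the constant coefficient J(z), which leaves an inequality between J
  and its own derivatives. The link to p is that J has the coefficients of p up to binomial and sign
  factors, so that z = -n/y turns J into p in the limit. In the sufficiency part, a root 0 of the
  symbol S(x,.) would give a factor D, which annihilates constants; hence p(0) is taken nonzero and
  general p is reached by a limit. Hurwitz's theorem, with bounded degrees and convergent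
  coefficients, carries these limits.\<close>

abbreviation cpoly :: "real poly \<Rightarrow> complex poly" where
  "cpoly \<equiv> map_poly complex_of_real"

lemma cpoly_add: "cpoly (p + q) = cpoly p + cpoly q"
  by (intro poly_eqI) (simp add: coeff_map_poly)

lemma cpoly_diff: "cpoly (p - q) = cpoly p - cpoly q"
  by (intro poly_eqI) (simp add: coeff_map_poly)

lemma cpoly_smult: "cpoly (smult c p) = smult (of_real c) (cpoly p)"
  by (intro poly_eqI) (simp add: coeff_map_poly)

lemma cpoly_mult: "cpoly (p * q) = cpoly p * cpoly q"
  by (intro poly_eqI) (simp add: coeff_map_poly coeff_mult)

lemma cpoly_1: "cpoly 1 = 1"
  by (intro poly_eqI) (simp add: coeff_map_poly coeff_1)

lemma cpoly_sum: "cpoly (sum f A) = (\<Sum>i\<in>A. cpoly (f i))"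
  by (induction A rule: infinite_finite_induct) (simp_all add: cpoly_add)

lemma cpoly_pderiv: "cpoly (pderiv p) = pderiv (cpoly p)"
  by (intro poly_eqI) (simp add: coeff_map_poly coeff_pderiv)

lemma cpoly_eq_0_iff: "cpoly p = 0 \<longleftrightarrow> p = 0"
  by (simp add: poly_eq_iff coeff_map_poly)

lemma cpoly_pCons: "cpoly (pCons a p) = pCons (of_real a) (cpoly p)"
  by (simp add: map_poly_pCons)

lemma cpoly_monom: "cpoly (monom c n) = monom (of_real c) n"
  by (simp add: map_poly_monom)

lemma cpoly_pcompose: "cpoly (pcompose p q) = pcompose (cpoly p) (cpoly q)"
  by (induction p) (simp_all add: pcompose_pCons cpoly_add cpoly_mult cpoly_pCons)

lemma smult_sum_right: "smult c (sum f A) = (\<Sum>i\<in>A. smult c (f i))"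
  by (induction A rule: infinite_finite_induct) (simp_all add: smult_add_right)

lemma poly_cpoly_of_real: "poly (cpoly p) (of_real x) = of_real (poly p x)"
  by (induction p) (simp_all add: map_poly_pCons)

lemma poly_cpoly_cnj: "poly (cpoly p) (cnj z) = cnj (poly (cpoly p) z)"
  by (induction p) (simp_all add: map_poly_pCons)

lemma degree_cpoly: "degree (cpoly p) = degree p"
  by (simp add: degree_map_poly)

text \<open>Zeros of a real polynomial come in conjugate pairs, so one open half-plane decides.
  Nonzero constants fit without a case of their own, and the criterion has the shape that Hurwitz's
  theorem preserves.\<close>

lemma real_rooted_iff:
  "real_rooted p \<longleftrightarrow> p = 0 \<or> (\<forall>z. Im z > 0 \<longrightarrow> poly (cpoly p) z \<noteq> 0)"
proof
  assume r: "real_rooted p"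
  show "p = 0 \<or> (\<forall>z. Im z > 0 \<longrightarrow> poly (cpoly p) z \<noteq> 0)"
  proof (cases "degree p = 0")
    case True
    then obtain c where "p = [:c:]" by (metis degree_eq_zeroE)
    then show ?thesis by (auto simp: map_poly_pCons)
  next
    case False
    then show ?thesis using r by (auto simp: real_rooted_def complex_is_Real_iff)
  qed
next
  assume r: "p = 0 \<or> (\<forall>z. Im z > 0 \<longrightarrow> poly (cpoly p) z \<noteq> 0)"
  show "real_rooted p"
  proof (cases "p = 0")
    case False
    have "z \<in> \<real>" if "poly (cpoly p) z = 0" for z
    proof -
      have "poly (cpoly p) (cnj z) = 0" using that by (simp add: poly_cpoly_cnj)
      then have "\<not> Im z > 0" "\<not> Im (cnj z) > 0" using r False that by blast+
      then show ?thesis by (simp add: complex_is_Real_iff)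
    qed
    then show ?thesis by (auto simp: real_rooted_def)
  qed (simp add: real_rooted_def)
qed

lemma real_rooted_no_zero:
  assumes "real_rooted p" "p \<noteq> 0" "Im z \<noteq> 0"
  shows "poly (cpoly p) z \<noteq> 0"
proof (cases "Im z > 0")
  case True
  then show ?thesis using assms real_rooted_iff by blast
next
  case False
  then have "poly (cpoly p) (cnj z) \<noteq> 0" using assms real_rooted_iff[of p] by auto
  then show ?thesis by (simp add: poly_cpoly_cnj)
qed

lemma real_rooted_linear [simp]: "real_rooted [:c, d:]"
proof (cases "d = 0")
  case False
  have "poly (cpoly [:c, d:]) z \<noteq> 0" if "Im z > 0" for z
  proof -
    have "Im (poly (cpoly [:c, d:]) z) = Im z * d" by (simp add: map_poly_pCons)
    then show ?thesis using that False by (metis mult_eq_0_iff order_less_irrefl zero_complex.sel(2))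
  qed
  then show ?thesis by (simp add: real_rooted_iff)
qed (simp add: real_rooted_def)

lemma real_rooted_mult: "real_rooted p \<Longrightarrow> real_rooted q \<Longrightarrow> real_rooted (p * q)"
  by (auto simp: real_rooted_iff cpoly_mult)

lemma real_rooted_power: "real_rooted p \<Longrightarrow> real_rooted (p ^ n)"
proof (induction n)
  case 0
  show ?case by (simp add: real_rooted_def)
qed (simp add: real_rooted_mult)

lemma real_rooted_smult: "real_rooted p \<Longrightarrow> real_rooted (smult c p)"
  by (auto simp: real_rooted_iff cpoly_smult)

lemma real_rooted_factor:
  assumes "real_rooted (p * q)" "p * q \<noteq> 0"
  shows "real_rooted p"
  using assms by (auto simp: real_rooted_iff cpoly_mult)

lemma poly_as_sum_upto:
  fixes p :: "'a::comm_semiring_1 poly"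
  assumes "degree p \<le> d"
  shows "poly p x = (\<Sum>i\<le>d. coeff p i * x ^ i)"
proof -
  have "poly p x = (\<Sum>i\<le>degree p. coeff p i * x ^ i)" by (rule poly_altdef)
  also have "\<dots> = (\<Sum>i\<le>d. coeff p i * x ^ i)"
    by (rule sum.mono_neutral_left) (use assms in \<open>auto simp: coeff_eq_0\<close>)
  finally show ?thesis .
qed

text \<open>The degree bound turns coefficientwise convergence into uniform convergence on compact
  sets, which is what Hurwitz's theorem asks for.\<close>

lemma Hurwitz_poly:
  fixes F :: "nat \<Rightarrow> complex poly"
  assumes S: "open S" "connected S"
    and deg: "\<And>n. degree (F n) \<le> d"
    and lim: "\<And>i. (\<lambda>n. coeff (F n) i) \<longlonglongrightarrow> coeff g i"
    and nz: "\<And>n z. z \<in> S \<Longrightarrow> poly (F n) z \<noteq> 0"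
    and g: "g \<noteq> 0" and z0: "z0 \<in> S"
  shows "poly g z0 \<noteq> 0"
proof
  assume g0: "poly g z0 = 0"
  have dg: "degree g \<le> d"
  proof (rule degree_le, intro allI impI)
    fix i assume "d < i"
    then have "(\<lambda>n. coeff (F n) i) = (\<lambda>n. 0)" using deg by (auto intro!: coeff_eq_0 simp: fun_eq_iff dest:
        le_less_trans)
    then show "coeff g i = 0" using lim[of i] LIMSEQ_unique tendsto_const by metis
  qed
  have nc: "\<not> poly g constant_on S"
  proof
    assume "poly g constant_on S"
    then have "S \<subseteq> {z. poly g z = 0}" using g0 z0 by (auto simp: constant_on_def)
    then have "finite S" using poly_roots_finite[OF g] finite_subset by blast
    then show False using S(1) z0 finite_imp_not_open by blast
  qed
  have ul: "uniform_limit K (\<lambda>n. poly (F n)) (poly g) sequentially" if K: "compact K" "K \<subseteq> S" for K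
  proof -
    have tm: "uniform_limit K (\<lambda>n z. coeff (F n) i * z ^ i) (\<lambda>z. coeff g i * z ^ i) sequentially" for i
    proof -
      have "uniform_limit K (\<lambda>n z. coeff (F n) i) (\<lambda>z. coeff g i) sequentially"
        using lim[of i] by (auto simp: uniform_limit_iff tendsto_iff)
      moreover have "bounded ((\<lambda>z. z ^ i) ` K)"
        by (intro compact_imp_bounded compact_continuous_image K continuous_intros)
      ultimately show ?thesis
        by (intro uniform_lim_mult[OF _ uniform_limit_const]) (simp_all add: image_constant_conv)
    qed
    have "uniform_limit K (\<lambda>n z. \<Sum>i\<in>I. coeff (F n) i * z ^ i) (\<lambda>z. \<Sum>i\<in>I. coeff g i * z ^ i) sequentially"
      if "finite I" for I
      using that
    proof (induction I)
      case empty
      show ?case by (simp add: uniform_limit_const)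
    next
      case (insert i I)
      show ?case using uniform_limit_add[OF tm[of i] insert.IH] insert.hyps by simp
    qed
    from this[of "{..d}"] show ?thesis
      unfolding poly_as_sum_upto[OF deg, abs_def] poly_as_sum_upto[OF dg, abs_def] by simp
  qed
  have "poly g z0 \<noteq> 0"
    by (rule Hurwitz_no_zeros[of S "\<lambda>n. poly (F n)", OF S _ _ ul nc nz z0])
      (simp_all add: poly_holomorphic_on)
  then show False using g0 by simp
qed

lemma real_rooted_limit:
  fixes F :: "nat \<Rightarrow> real poly"
  assumes deg: "\<And>n. degree (F n) \<le> d"
    and lim: "\<And>i. (\<lambda>n. coeff (F n) i) \<longlonglongrightarrow> coeff g i"
    and rr: "\<And>n. real_rooted (F n)"
  shows "real_rooted g"
proof (cases "g = 0")
  case False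
  obtain i where i: "coeff g i \<noteq> 0" using False by (meson leading_coeff_0_iff)
  \<comment> \<open>\<open>F n = 0\<close> counts as real-rooted but vanishes everywhere; a nonzero
    coefficient of the limit excludes it for large \<open>n\<close>.\<close>
  have "eventually (\<lambda>n. coeff (F n) i \<noteq> 0) sequentially"
    using lim[of i] i tendsto_imp_eventually_ne by blast
  then obtain N where N: "\<And>n. n \<ge> N \<Longrightarrow> F n \<noteq> 0" by (force simp: eventually_sequentially)
  have "poly (cpoly g) z \<noteq> 0" if "Im z > 0" for z
  proof (rule Hurwitz_poly[of "{z. Im z > 0}" "\<lambda>n. cpoly (F (n + N))" d])
    show "open {z. 0 < Im z}" by (rule open_halfspace_Im_gt)
    show "connected {z. 0 < Im z}" by (intro convex_connected convex_halfspace_Im_gt)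
    show "(\<lambda>n. coeff (cpoly (F (n + N))) i) \<longlonglongrightarrow> coeff (cpoly g) i" for i
      using LIMSEQ_ignore_initial_segment[OF lim[of i], of N] by (simp add: coeff_map_poly tendsto_of_real)
    show "poly (cpoly (F (n + N))) w \<noteq> 0" if "w \<in> {z. 0 < Im z}" for n w
      using rr[of "n + N"] N[of "n + N"] that by (auto simp: real_rooted_iff)
  qed (use that False deg in \<open>auto simp: degree_cpoly cpoly_eq_0_iff\<close>)
  then show ?thesis by (simp add: real_rooted_iff)
qed (simp add: real_rooted_def)

lemma real_rooted_decompose:
  assumes "real_rooted p" "p \<noteq> 0"
  obtains A where "p = smult (lead_coeff p) (\<Prod>x\<in>#A. [:-x, 1:])" "size A = degree p"
proof -
  have "\<exists>A. p = smult (lead_coeff p) (\<Prod>x\<in>#A. [:-x, 1:]) \<and> size A = degree p"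
    using assms
  proof (induction "degree p" arbitrary: p)
    case 0
    then obtain c where "p = [:c:]" by (metis degree_eq_zeroE)
    then show ?case by (intro exI[of _ "{#}"]) simp
  next
    case (Suc n)
    have "\<not> constant (poly (cpoly p))"
      using Suc(2) by (simp add: constant_degree degree_cpoly)
    then obtain z where z: "poly (cpoly p) z = 0" using fundamental_theorem_of_algebra by blast
    then have "Im z = 0" using real_rooted_no_zero Suc by blast
    then have "z = of_real (Re z)" by (simp add: complex_eq_iff)
    then have "poly p (Re z) = 0" using z poly_cpoly_of_real[of p "Re z"] by simp
    then obtain q where q: "p = [:-Re z, 1:] * q" by (meson dvdE poly_eq_0_iff_dvd)
    then have q0: "q \<noteq> 0" using Suc by auto
    have dq: "degree p = Suc (degree q)" using q q0 by (simp add: degree_mult_eq del: mult_pCons_left)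
    have q': "p = q * [:-Re z, 1:]" by (subst q) (rule mult.commute)
    have "real_rooted q" by (rule real_rooted_factor[OF Suc(3,4)[unfolded q']])
    then obtain A where A: "q = smult (lead_coeff q) (\<Prod>x\<in>#A. [:-x, 1:])" "size A = degree q"
      using Suc(1)[of q] Suc(2) dq q0 by auto
    have lc: "lead_coeff p = lead_coeff q" using q by (simp only: lead_coeff_mult) simp
    obtain c P where cP: "q = smult c P" "c = lead_coeff q" "P = (\<Prod>x\<in>#A. [:-x, 1:])"
      using A(1) by blast
    have "p = smult c ([:-Re z, 1:] * P)" by (simp only: q cP(1) mult_smult_right)
    then have "p = smult (lead_coeff p) (\<Prod>x\<in>#add_mset (Re z) A. [:-x, 1:])"
      unfolding lc image_mset_add_mset prod_mset.add_mset cP(2,3) .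
    moreover have "size (add_mset (Re z) A) = degree p" using A(2) dq by simp
    ultimately show ?case by blast
  qed
  then show ?thesis using that by blast
qed

section \<open>Differential operators and half-planes\<close>

text \<open>\<open>dop q f\<close> is \<open>q(D) f\<close>, written in Horner form.\<close>

definition dop :: "'a::idom poly \<Rightarrow> 'a poly \<Rightarrow> 'a poly" where
  "dop q f = fold_coeffs (\<lambda>c g. smult c f + pderiv g) q 0"

lemma dop_0 [simp]: "dop 0 f = 0"
  by (simp add: dop_def)

lemma dop_pCons [simp]: "dop (pCons c q) f = smult c f + pderiv (dop q f)"
  by (cases "c = 0 \<and> q = 0") (auto simp: dop_def)

lemma dop_add: "dop (p + q) f = dop p f + dop q f"
  by (induction p q rule: poly_induct2) (simp_all add: smult_add_left pderiv_add algebra_simps)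

lemma dop_smult: "dop (smult c p) f = smult c (dop p f)"
  by (induction p) (simp_all add: smult_add_right pderiv_smult)

lemma dop_pderiv: "dop q (pderiv f) = pderiv (dop q f)"
  by (induction q) (simp_all add: pderiv_add pderiv_smult)

lemma dop_add_right: "dop q (f + g) = dop q f + dop q g"
  by (induction q) (simp_all add: smult_add_right pderiv_add algebra_simps)

lemma dop_smult_right: "dop q (smult c f) = smult c (dop q f)"
  by (induction q) (simp_all add: smult_add_right pderiv_smult mult.commute)

lemma dop_diff_right: "dop q (f - g) = dop q f - dop q g"
  using dop_add_right[of q f "-g"] dop_smult_right[of q "-1" g] by simp

lemma dop_mult: "dop (p * q) f = dop p (dop q f)"
  by (induction p) (simp_all add: dop_add dop_smult)

lemma dop_1 [simp]: "dop 1 f = f"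
  by (simp add: one_pCons)

lemma dop_sum: "dop (sum g A) f = (\<Sum>i\<in>A. dop (g i) f)"
  by (induction A rule: infinite_finite_induct) (simp_all add: dop_add)

lemma poly_dop_0: "poly (dop q f) 0 = (\<Sum>i\<le>degree q. coeff q i * (fact i * coeff f i))"
proof -
  have "poly (dop q f) 0 = (\<Sum>i\<le>degree q. coeff q i * poly ((pderiv ^^ i) f) 0)"
  proof (induction q arbitrary: f)
    case (pCons c q)
    have "poly (dop (pCons c q) f) 0 = c * poly f 0 + poly (dop q (pderiv f)) 0"
      by (simp add: dop_pderiv)
    also have "\<dots> = c * poly f 0 + (\<Sum>i\<le>degree q. coeff q i * poly ((pderiv ^^ Suc i) f) 0)"
      by (simp add: pCons.IH funpow_swap1)
    also have "\<dots> = (\<Sum>i\<le>Suc (degree q). coeff (pCons c q) i * poly ((pderiv ^^ i) f) 0)"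
      by (subst sum.atMost_Suc_shift) simp
    also have "\<dots> = (\<Sum>i\<le>degree (pCons c q). coeff (pCons c q) i * poly ((pderiv ^^ i) f) 0)"
      by (cases "q = 0") auto
    finally show ?case .
  qed simp
  moreover have "poly ((pderiv ^^ i) f) 0 = fact i * coeff f i" for i
    by (simp add: poly_0_coeff_0 coeff_higher_pderiv pochhammer_fact)
  ultimately show ?thesis by simp
qed

text \<open>Zeros of \<open>f\<close> in an open half-plane: the logarithmic derivative is a sum of terms
  \<open>1/(s - r)\<close>, and \<open>cnj \<omega> / (s - r)\<close> has the sign of \<open>Re (\<omega> (s - r))\<close>.\<close>

lemma Re_logderiv_halfplane:
  fixes A :: "complex multiset"
  assumes "\<And>r. r \<in># A \<Longrightarrow> Re (\<omega> * (s - r)) < 0"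
    and f_def: "f = (\<Prod>r\<in>#A. [:-r, 1:])"
  shows "poly f s \<noteq> 0" and "Re (cnj \<omega> * (poly (pderiv f) s / poly f s)) \<le> 0"
    and "A \<noteq> {#} \<Longrightarrow> Re (cnj \<omega> * (poly (pderiv f) s / poly f s)) < 0"
proof -
  have "poly f s \<noteq> 0 \<and> Re (cnj \<omega> * (poly (pderiv f) s / poly f s)) \<le> 0 \<and>
     (A \<noteq> {#} \<longrightarrow> Re (cnj \<omega> * (poly (pderiv f) s / poly f s)) < 0)"
    using assms
  proof (induction A arbitrary: f)
    case (add r A)
    define g where "g = (\<Prod>r\<in>#A. [:-r, 1:])"
    have f: "f = [:-r, 1:] * g" by (simp add: add.prems(2) g_def)
    have IH: "poly g s \<noteq> 0" "Re (cnj \<omega> * (poly (pderiv g) s / poly g s)) \<le> 0"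
      using add.IH[of g] add.prems(1) by (auto simp: g_def)
    have neg: "Re (\<omega> * (s - r)) < 0" using add.prems(1) by simp
    then have sr: "s - r \<noteq> 0" by auto
    have eq: "poly (pderiv f) s / poly f s = 1 / (s - r) + poly (pderiv g) s / poly g s"
    proof -
      have "poly (pderiv f) s = poly g s + (s - r) * poly (pderiv g) s"
        by (simp only: f pderiv_mult poly_add poly_mult) (simp add: pderiv_pCons algebra_simps)
      moreover have "poly f s = (s - r) * poly g s" by (simp add: f algebra_simps)
      ultimately show ?thesis using sr IH(1) by (simp add: add_divide_distrib)
    qed
    have "Re (cnj \<omega> * (1 / (s - r))) = Re (\<omega> * (s - r)) / (cmod (s - r))\<^sup>2"
      by (simp add: Re_divide cmod_power2 algebra_simps)
    also have "\<dots> < 0" using neg sr by (simp add: divide_neg_pos)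
    finally have "Re (cnj \<omega> * (poly (pderiv f) s / poly f s)) < 0"
      unfolding eq distrib_left using IH(2) by simp
    moreover have "poly f s \<noteq> 0" using f IH(1) sr by simp
    ultimately show ?case by simp
  qed simp
  then show "poly f s \<noteq> 0" and "Re (cnj \<omega> * (poly (pderiv f) s / poly f s)) \<le> 0"
    and "A \<noteq> {#} \<Longrightarrow> Re (cnj \<omega> * (poly (pderiv f) s / poly f s)) < 0" by auto
qed

text \<open>At such an \<open>s\<close>, \<open>cnj \<omega>\<close> times the logarithmic
  derivative of a nonconstant \<open>f\<close> has negative real part, and
  \<open>cnj \<omega> * u\<close> adds nothing positive, so the two cannot cancel. For constant
  \<open>f\<close> the derivative vanishes and \<open>u \<noteq> 0\<close> takes over.\<close>

lemma halfplane_step: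
  fixes f :: "complex poly"
  assumes f: "\<And>s. Re (\<omega> * (s - x)) \<le> 0 \<Longrightarrow> poly f s \<noteq> 0"
    and u: "Re (cnj \<omega> * u) \<le> 0" "u \<noteq> 0"
    and s: "Re (\<omega> * (s - x)) \<le> 0"
  shows "poly (smult u f + pderiv f) s \<noteq> 0"
proof -
  have f0: "f \<noteq> 0" using f[OF s] by auto
  obtain A where A: "smult (lead_coeff f) (\<Prod>r\<in>#A. [:-r, 1:]) = f"
    using complex_poly_decompose_multiset[of f] by blast
  define g where "g = (\<Prod>r\<in>#A. [:-r, 1:])"
  define c where "c = lead_coeff f"
  have fg: "f = smult c g" using A by (simp add: g_def c_def)
  have c0: "c \<noteq> 0" using f0 by (simp add: c_def)
  have neg: "Re (\<omega> * (s - r)) < 0" if "r \<in># A" for r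
  proof -
    have "poly f r = 0" using that by (auto simp: fg g_def poly_prod_mset prod_mset_zero_iff)
    then have "Re (\<omega> * (r - x)) > 0" using f[of r] by force
    then show ?thesis using s by (simp add: algebra_simps)
  qed
  note L = Re_logderiv_halfplane[OF neg g_def]
  have "u + poly (pderiv g) s / poly g s \<noteq> 0"
  proof (cases "A = {#}")
    case True
    then show ?thesis using u(2) by (simp add: g_def)
  next
    case False
    then have "Re (cnj \<omega> * (u + poly (pderiv g) s / poly g s)) < 0"
      using L(3) u(1) unfolding distrib_left by simp
    then show ?thesis by (metis mult_zero_right order_less_irrefl zero_complex.sel(1))
  qed
  moreover have "poly (smult u f + pderiv f) s = c * poly g s * (u + poly (pderiv g) s / poly g s)"
    using L(1) by (simp add: fg pderiv_smult field_simps)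
  ultimately show ?thesis using c0 L(1) by simp
qed

text \<open>Each root \<rho> of \<open>R\<close> contributes a factor D - \<rho>, that is
  \<open>halfplane_step\<close> with u = -\<rho>, and the zero-free half-plane survives from factor
  to factor.\<close>

lemma halfplane_dop:
  fixes f R :: "complex poly"
  assumes f: "\<And>s. Re (\<omega> * (s - x)) \<le> 0 \<Longrightarrow> poly f s \<noteq> 0"
    and R: "R \<noteq> 0" "\<And>\<rho>. poly R \<rho> = 0 \<Longrightarrow> \<rho> \<noteq> 0 \<and> Re (cnj \<omega> * \<rho>) \<ge> 0"
    and s: "Re (\<omega> * (s - x)) \<le> 0"
  shows "poly (dop R f) s \<noteq> 0"
proof -
  obtain A where A: "smult (lead_coeff R) (\<Prod>r\<in>#A. [:-r, 1:]) = R"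
    using complex_poly_decompose_multiset[of R] by blast
  define c where "c = lead_coeff R"
  have RA: "R = smult c (\<Prod>r\<in>#A. [:-r, 1:])" using A by (simp add: c_def)
  have c0: "c \<noteq> 0" using R by (simp add: c_def)
  have A': "r \<noteq> 0 \<and> Re (cnj \<omega> * r) \<ge> 0" if "r \<in># A" for r
  proof -
    have "poly R r = 0" using that by (auto simp: RA poly_prod_mset prod_mset_zero_iff)
    then show ?thesis using R(2) by blast
  qed
  have "\<forall>s. Re (\<omega> * (s - x)) \<le> 0 \<longrightarrow> poly (dop (\<Prod>r\<in>#A. [:-r, 1:]) f) s \<noteq> 0"
    using A'
  proof (induction A)
    case empty
    then show ?case using f by simp
  next
    case (add r A)
    have "dop (\<Prod>r\<in>#add_mset r A. [:-r, 1:]) f =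
        smult (-r) (dop (\<Prod>r\<in>#A. [:-r, 1:]) f) + pderiv (dop (\<Prod>r\<in>#A. [:-r, 1:]) f)"
      unfolding image_mset_add_mset prod_mset.add_mset dop_mult by (simp add: one_pCons[symmetric])
    moreover have "r \<noteq> 0 \<and> Re (cnj \<omega> * r) \<ge> 0" by (rule add.prems) simp
    then have "Re (cnj \<omega> * (-r)) \<le> 0" "-r \<noteq> 0" by simp_all
    ultimately show ?case using halfplane_step[of \<omega> x "dop (\<Prod>r\<in>#A. [:-r, 1:]) f" "-r"] add by auto
  qed
  then show ?thesis using s c0 by (simp add: RA dop_smult)
qed

section \<open>Laguerre polynomials\<close>

abbreviation poch :: "real \<Rightarrow> nat \<Rightarrow> real" where
  "poch \<alpha> n \<equiv> pochhammer (\<alpha> + 1) n"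

lemma poch_pos: "\<alpha> > -1 \<Longrightarrow> poch \<alpha> n > 0"
  by (rule pochhammer_pos) simp

lemma gchoose_poch: "(real k + \<alpha>) gchoose k = poch \<alpha> k / fact k"
  by (simp add: gbinomial_pochhammer' algebra_simps)

lemma coeff_laguerre:
  assumes "\<alpha> > -1"
  shows "coeff (laguerre \<alpha> n) j =
    (if j \<le> n then (-1) ^ j * poch \<alpha> n / (poch \<alpha> j * (fact (n - j) * fact j)) else 0)"
proof -
  have 1: "coeff (laguerre \<alpha> n) j =
     (\<Sum>k\<le>n. if k = j then ((real n + \<alpha>) gchoose (n - k)) * (-1) ^ k / fact k else 0)"
    unfolding laguerre_def coeff_sum by (intro sum.cong) auto
  have 2: "((real n + \<alpha>) gchoose (n - j)) = poch \<alpha> n / (poch \<alpha> j * fact (n - j))" if "j \<le> n"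
  proof -
    have "((real n + \<alpha>) gchoose (n - j)) = pochhammer (\<alpha> + 1 + real j) (n - j) / fact (n - j)"
      using that by (simp add: gbinomial_pochhammer' of_nat_diff algebra_simps)
    also have "poch \<alpha> n = poch \<alpha> j * pochhammer (\<alpha> + 1 + real j) (n - j)"
      using that by (rule pochhammer_product)
    then have "pochhammer (\<alpha> + 1 + real j) (n - j) = poch \<alpha> n / poch \<alpha> j"
      using poch_pos[OF assms, of j] by (simp add: field_simps)
    finally show ?thesis by simp
  qed
  show ?thesis using 2 unfolding 1 by (auto simp: field_simps)
qed

lemma degree_laguerre_le: "degree (laguerre \<alpha> n) \<le> n"
  unfolding laguerre_def by (intro degree_sum_le) (auto intro: order.trans[OF degree_smult_le]
      degree_monom_le order.trans)

lemma lead_coeff_laguerre: "\<alpha> > -1 \<Longrightarrow> coeff (laguerre \<alpha> n) n = (-1) ^ n / fact n"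
  using poch_pos[of \<alpha> n] by (simp add: coeff_laguerre)

lemma degree_laguerre [simp]: "\<alpha> > -1 \<Longrightarrow> degree (laguerre \<alpha> n) = n"
  using degree_laguerre_le[of \<alpha> n] lead_coeff_laguerre[of \<alpha> n]
  by (metis le_degree order_antisym divide_eq_0_iff fact_nonzero power_eq_0_iff zero_neq_neg_one)

lemma laguerre_neq_0 [simp]: "\<alpha> > -1 \<Longrightarrow> laguerre \<alpha> n \<noteq> 0"
  using lead_coeff_laguerre[of \<alpha> n] by auto

lemma laguerre_0 [simp]: "laguerre \<alpha> 0 = 1"
  by (simp add: laguerre_def)

lemma coeff_laguerre_0: "\<alpha> > -1 \<Longrightarrow> coeff (laguerre \<alpha> n) 0 = poch \<alpha> n / fact n"
  by (simp add: coeff_laguerre)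

text \<open>This ratio of consecutive coefficients is the Laguerre differential equation read off
  coefficient by coefficient.\<close>

lemma coeff_laguerre_Suc:
  assumes "\<alpha> > -1"
  shows "real (Suc j) * (real j + 1 + \<alpha>) * coeff (laguerre \<alpha> n) (Suc j) =
    (real j - real n) * coeff (laguerre \<alpha> n) j"
proof (cases "j < n")
  case True
  then obtain m where m: "n = Suc (j + m)" using less_imp_Suc_add by blast
  define J M q p P where "J = real (Suc j)" and "M = real (Suc m)" and "q = \<alpha> + 1 + real j"
    and "p = poch \<alpha> j" and "P = poch \<alpha> n"
  note defs = this
  have pos: "J > 0" "M > 0" "q > 0" "p > 0" using assms poch_pos[OF assms] by (auto simp: defs)
  have "coeff (laguerre \<alpha> n) (Suc j) = - ((-1) ^ j) * P / (p * q * (fact m * (J * fact j)))"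
    using m by (simp add: coeff_laguerre[OF assms] defs pochhammer_Suc)
  moreover have "coeff (laguerre \<alpha> n) j = (-1) ^ j * P / (p * (M * fact m * fact j))"
    using m by (simp add: coeff_laguerre[OF assms] defs)
  moreover have "J * q * (- ((-1) ^ j) * P / (p * q * (fact m * (J * fact j)))) =
      - M * ((-1) ^ j * P / (p * (M * fact m * fact j)))"
    using pos by (simp add: divide_simps)
  moreover have "real j + 1 + \<alpha> = q" "real j - real n = - M" using m by (simp_all add: defs)
  ultimately show ?thesis by (simp only: J_def)
qed (auto simp: coeff_laguerre[OF assms])

lemma laguerre_ode:
  assumes "\<alpha> > -1"
  shows "[:0, 1:] * pderiv (pderiv (laguerre \<alpha> n)) + [:\<alpha> + 1, -1:] * pderiv (laguerre \<alpha> n)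
     + smult (real n) (laguerre \<alpha> n) = 0"
proof (rule poly_eqI)
  fix j
  show "coeff ([:0, 1:] * pderiv (pderiv (laguerre \<alpha> n)) + [:\<alpha> + 1, -1:] * pderiv (laguerre \<alpha> n)
     + smult (real n) (laguerre \<alpha> n)) j = coeff 0 j"
    using coeff_laguerre_Suc[OF assms, of j n]
    by (cases j) (simp_all add: coeff_pderiv algebra_simps)
qed

lemma laguerre_Suc:
  assumes "\<alpha> > -1"
  shows "smult (real (Suc n)) (laguerre \<alpha> (Suc n)) =
    [:0, 1:] * pderiv (laguerre \<alpha> n) + [:real n + 1 + \<alpha>, -1:] * laguerre \<alpha> n"
proof (rule poly_eqI)
  fix j
  note c = coeff_laguerre[OF assms]
  define N where "N = real (Suc n)"
  have N: "N > 0" "real n = N - 1" "fact (Suc n) = N * fact n" by (simp_all add: N_def)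
  have Suc_n: "poch \<alpha> (Suc n) = (\<alpha> + N) * poch \<alpha> n"
    by (simp add: pochhammer_Suc N_def algebra_simps)
  show "coeff (smult (real (Suc n)) (laguerre \<alpha> (Suc n))) j =
    coeff ([:0, 1:] * pderiv (laguerre \<alpha> n) + [:real n + 1 + \<alpha>, -1:] * laguerre \<alpha> n) j"
  proof (cases j)
    case 0
    have "N * (poch \<alpha> (Suc n) / fact (Suc n)) = (N + \<alpha>) * (poch \<alpha> n / fact n)"
      unfolding Suc_n N(3) using N(1) by (simp add: divide_simps)
    then show ?thesis using 0 coeff_laguerre_0[OF assms] unfolding N(2) N_def[symmetric]
      by (simp del: of_nat_Suc pochhammer_Suc fact_Suc)
  next
    case (Suc i)
    define J q p P where "J = real (Suc i)" and "q = \<alpha> + J" and "p = poch \<alpha> i" and "P = poch \<alpha> n"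
    note defs = this
    have pos: "J > 0" "q > 0" "p > 0" "P > 0"
      using assms poch_pos[OF assms] by (auto simp: defs)
    have Suc_i: "poch \<alpha> (Suc i) = p * q" "fact (Suc i) = J * fact i"
      by (simp_all add: pochhammer_Suc defs algebra_simps)
    have R: "coeff ([:0, 1:] * pderiv (laguerre \<alpha> n) + [:real n + 1 + \<alpha>, -1:] * laguerre \<alpha> n) j =
        (J + N + \<alpha>) * coeff (laguerre \<alpha> n) (Suc i) - coeff (laguerre \<alpha> n) i"
      using Suc N by (simp add: coeff_pderiv defs algebra_simps)
    have L: "coeff (smult (real (Suc n)) (laguerre \<alpha> (Suc n))) j = N * coeff (laguerre \<alpha> (Suc n)) (Suc i)"
      using Suc by (simp add: N_def)
    consider "i > n" | "i = n" | m where "n = Suc (i + m)"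
      using less_imp_Suc_add by (metis linorder_neqE_nat)
    then show ?thesis
    proof cases
      case 1
      then show ?thesis unfolding L R by (simp add: c)
    next
      case 2
      then have "coeff (laguerre \<alpha> (Suc n)) (Suc i) = - ((-1) ^ n) / (N * fact n)"
        using lead_coeff_laguerre[OF assms, of "Suc n"] by (simp add: N_def)
      moreover have "coeff (laguerre \<alpha> n) (Suc i) = 0" "coeff (laguerre \<alpha> n) i = (-1) ^ n / fact n"
        using 2 lead_coeff_laguerre[OF assms, of n] by (simp_all add: coeff_eq_0 assms)
      ultimately show ?thesis unfolding L R using N(1) by simp
    next
      case 3
      define M where "M = real (Suc m)"
      have M: "M > 0" "N = J + M" using 3 by (simp_all add: M_def N_def J_def)
      have l1: "coeff (laguerre \<alpha> (Suc n)) (Suc i) = - ((-1) ^ i) * ((\<alpha>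
          + N) * P) / (p * q * (M * fact m * (J * fact i)))"
        unfolding c Suc_i Suc_n using 3 by (simp add: M_def P_def)
      have l2: "coeff (laguerre \<alpha> n) (Suc i) = - ((-1) ^ i) * P / (p * q * (fact m * (J * fact i)))"
        unfolding c Suc_i using 3 by (simp add: P_def)
      have l3: "coeff (laguerre \<alpha> n) i = (-1) ^ i * P / (p * (M * fact m * fact i))"
        unfolding c using 3 by (simp add: P_def p_def M_def)
      \<comment> \<open>All three coefficients are multiples of \<open>K\<close>; what remains is N
        (\<alpha> + N) = M (J + N + \<alpha>) + q J with N = J + M and q = \<alpha> + J.\<close>
      define K where "K = (-1) ^ i * P / (p * q * (M * fact m * (J * fact i)))"
      have k1: "coeff (laguerre \<alpha> (Suc n)) (Suc i) = - ((\<alpha> + N) * K)"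
        unfolding l1 K_def by (simp add: ac_simps)
      have k2: "coeff (laguerre \<alpha> n) (Suc i) = - M * K"
        unfolding l2 K_def using M(1) by (simp add: divide_simps)
      have k3: "coeff (laguerre \<alpha> n) i = q * J * K"
        unfolding l3 K_def using pos by (simp add: divide_simps)
      show ?thesis unfolding L R k1 k2 k3 q_def M(2) by (simp add: algebra_simps)
    qed
  qed
qed

text \<open>With \<open>r\<close> ranging over the roots of \<open>f\<close>, \<open>(x f' + (m - x) f)/f = \<Sum> x/(x - r) + m - x\<close> has negative
  imaginary part in the upper half-plane and is positive for \<open>x \<le> 0\<close>. By \<open>laguerre_Suc\<close> this makes
  all roots of Laguerre polynomials positive.\<close>

lemma positive_roots_step:
  fixes A :: "real multiset" and x :: complex
  assumes A: "\<And>r. r \<in># A \<Longrightarrow> r > 0" and m: "m > 0"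
    and f_def: "f = (\<Prod>r\<in>#A. [:-r, 1:])"
    and x: "Im x > 0 \<or> (Im x = 0 \<and> Re x \<le> 0)"
  shows "poly (cpoly ([:0, 1:] * pderiv f + [:m, -1:] * f)) x \<noteq> 0"
proof -
  have "\<exists>w. poly (cpoly f) x \<noteq> 0 \<and> x * poly (cpoly (pderiv f)) x = w * poly (cpoly f) x \<and>
      Im w \<le> 0 \<and> (Im x = 0 \<longrightarrow> Re w \<ge> 0)"
    using A f_def
  proof (induction A arbitrary: f)
    case empty
    then show ?case by (intro exI[of _ 0]) (simp add: cpoly_1)
  next
    case (add r A)
    define g where "g = (\<Prod>r\<in>#A. [:-r, 1:])"
    have f: "f = [:-r, 1:] * g" by (simp add: add.prems(2) g_def)
    obtain w where w: "poly (cpoly g) x \<noteq> 0" "x * poly (cpoly (pderiv g)) x = w * poly (cpoly g) x"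
      "Im w \<le> 0" "Im x = 0 \<longrightarrow> Re w \<ge> 0"
      using add.IH[of g] add.prems(1) by (auto simp: g_def)
    have r: "r > 0" using add.prems(1) by simp
    have xr: "x - of_real r \<noteq> 0" using x r by (auto simp: complex_eq_iff)
    have 1: "poly (cpoly f) x = (x - of_real r) * poly (cpoly g) x"
      by (simp only: f cpoly_mult poly_mult) (simp add: cpoly_pCons)
    have 2: "poly (cpoly (pderiv f)) x = poly (cpoly g) x + (x - of_real r) * poly (cpoly (pderiv g)) x"
      by (simp only: f pderiv_mult cpoly_mult cpoly_add poly_mult poly_add)
        (simp add: cpoly_pCons pderiv_pCons cpoly_1)
    define v where "v = x / (x - of_real r)"
    have v: "v * (x - of_real r) = x" using xr by (simp add: v_def)
    have "x * poly (cpoly (pderiv f)) x = v * (x - of_real r) * poly (cpoly g) x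
        + (x - of_real r) * (x * poly (cpoly (pderiv g)) x)"
      unfolding v 2 by (simp add: algebra_simps)
    also have "\<dots> = (v + w) * poly (cpoly f) x" unfolding w(2) 1 by (simp add: algebra_simps)
    finally have "x * poly (cpoly (pderiv f)) x = (v + w) * poly (cpoly f) x" .
    moreover have "Im v \<le> 0"
    proof -
      have "Im v = - (r * Im x) / ((Re x - r)\<^sup>2 + (Im x)\<^sup>2)"
        by (simp add: v_def Im_divide algebra_simps)
      moreover have "Im x \<ge> 0" using x by auto
      ultimately show ?thesis using r by (simp add: divide_nonneg_nonneg)
    qed
    moreover have "Re v \<ge> 0" if "Im x = 0"
    proof -
      have "Re v = Re x * (Re x - r) / (Re x - r)\<^sup>2" using that by (simp add: v_def Re_divide)
      moreover have "Re x * (Re x - r) \<ge> 0" using x r that by (intro mult_nonpos_nonpos) auto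
      ultimately show ?thesis by simp
    qed
    ultimately show ?case using w xr 1 by (intro exI[of _ "v + w"]) auto
  qed
  then obtain w where w: "poly (cpoly f) x \<noteq> 0" "x * poly (cpoly (pderiv f)) x = w * poly (cpoly f) x"
      "Im w \<le> 0" "Im x = 0 \<longrightarrow> Re w \<ge> 0" by blast
  have "poly (cpoly ([:0, 1:] * pderiv f + [:m, -1:] * f)) x =
      x * poly (cpoly (pderiv f)) x + (of_real m - x) * poly (cpoly f) x"
    by (simp only: cpoly_mult cpoly_add poly_mult poly_add) (simp add: cpoly_pCons)
  also have "\<dots> = (w + of_real m - x) * poly (cpoly f) x" unfolding w(2) by (simp add: algebra_simps)
  finally have "poly (cpoly ([:0, 1:] * pderiv f + [:m, -1:] * f)) x = (w + of_real m - x) * poly (cpoly f) x" .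
  moreover have "w + of_real m - x \<noteq> 0"
  proof (cases "Im x = 0")
    case True
    then have "Re (w + of_real m - x) > 0" using w x m by auto
    then show ?thesis by (metis order_less_irrefl zero_complex.sel(1))
  next
    case False
    then have "Im (w + of_real m - x) < 0" using w x by auto
    then show ?thesis by (metis order_less_irrefl zero_complex.sel(2))
  qed
  ultimately show ?thesis using w(1) by simp
qed

text \<open>Induction along \<open>laguerre_Suc\<close>. The region joins the upper half-plane to
  the closed negative axis, so the hypothesis for \<open>n\<close> says that all roots are real and
  positive, which is the input of \<open>positive_roots_step\<close>.\<close>

lemma laguerre_no_zero:
  assumes \<alpha>: "\<alpha> > -1" and x: "Im x > 0 \<or> (Im x = 0 \<and> Re x \<le> 0)"
  shows "poly (cpoly (laguerre \<alpha> n)) x \<noteq> 0"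
  using x
proof (induction n arbitrary: x)
  case 0
  then show ?case by (simp add: cpoly_1)
next
  case (Suc n)
  define L where "L = laguerre \<alpha> n"
  have L0: "L \<noteq> 0" using \<alpha> by (simp add: L_def)
  have "real_rooted L" using Suc.IH by (auto simp: real_rooted_iff L_def)
  then obtain A where A: "L = smult (lead_coeff L) (\<Prod>x\<in>#A. [:-x, 1:])"
    using real_rooted_decompose L0 by blast
  define f where "f = (\<Prod>x\<in>#A. [:-x, 1:])"
  define c where "c = lead_coeff L"
  have Lf: "L = smult c f" using A by (simp add: f_def c_def)
  have "r > 0" if "r \<in># A" for r
  proof -
    have "poly L r = 0" using that by (auto simp: Lf f_def poly_prod_mset prod_mset_zero_iff)
    then have "poly (cpoly L) (of_real r) = 0" by (simp add: poly_cpoly_of_real)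
    then show ?thesis using Suc.IH[of "of_real r"] by (force simp: L_def)
  qed
  then have "poly (cpoly ([:0, 1:] * pderiv f + [:real n + 1 + \<alpha>, -1:] * f)) x \<noteq> 0"
    using positive_roots_step[of A "real n + 1 + \<alpha>" f x] Suc.prems f_def \<alpha> by auto
  moreover have "smult (real (Suc n)) (laguerre \<alpha> (Suc n)) =
      smult c ([:0, 1:] * pderiv f + [:real n + 1 + \<alpha>, -1:] * f)"
    unfolding laguerre_Suc[OF \<alpha>] L_def[symmetric] Lf
    by (simp only: pderiv_smult mult_smult_right smult_add_right)
  then have "of_real (real (Suc n)) * poly (cpoly (laguerre \<alpha> (Suc n))) x =
      of_real c * poly (cpoly ([:0, 1:] * pderiv f + [:real n + 1 + \<alpha>, -1:] * f)) x"
    by (metis cpoly_smult poly_smult)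
  moreover have "c \<noteq> 0" using L0 by (simp add: c_def)
  ultimately show ?case by (metis mult_eq_0_iff of_real_eq_0_iff)
qed

lemma real_rooted_laguerre: "\<alpha> > -1 \<Longrightarrow> real_rooted (laguerre \<alpha> n)"
  by (simp add: real_rooted_iff laguerre_no_zero)

section \<open>Multipliers as differential operators\<close>

text \<open>The normally ordered operator with symbol \<open>c(x(1 - D))\<close>.\<close>

definition lsub :: "real poly \<Rightarrow> real poly \<Rightarrow> real poly" where
  "lsub c g = fold_coeffs (\<lambda>a h g. smult a g + [:0, 1:] * h (g - pderiv g)) c (\<lambda>_. 0) g"

lemma lsub_0 [simp]: "lsub 0 g = 0"
  by (simp add: lsub_def)

lemma lsub_pCons [simp]: "lsub (pCons a c) g = smult a g + [:0, 1:] * lsub c (g - pderiv g)"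
  by (cases "a = 0 \<and> c = 0") (auto simp: lsub_def)

lemma lsub_add: "lsub (c + d) g = lsub c g + lsub d g"
  by (induction c d arbitrary: g rule: poly_induct2)
    (simp_all add: smult_add_left algebra_simps del: mult_pCons_left)

lemma lsub_smult: "lsub (smult a c) g = smult a (lsub c g)"
  by (induction c arbitrary: g) (simp_all add: smult_add_right mult_smult_right del: mult_pCons_left)

lemma lsub_uminus: "lsub (-c) g = - lsub c g"
  using lsub_smult[of "-1" c g] by simp

lemma lsub_diff: "lsub (c - d) g = lsub c g - lsub d g"
  using lsub_add[of c "-d" g] by (simp add: lsub_uminus)

lemma lsub_add_right: "lsub c (f + g) = lsub c f + lsub c g"
proof (induction c arbitrary: f g)
  case (pCons a c)
  have "f + g - pderiv (f + g) = (f - pderiv f) + (g - pderiv g)" by (simp add: pderiv_add)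
  then show ?case
    by (simp only: lsub_pCons pCons.IH smult_add_right distrib_left ac_simps)
qed simp

lemma lsub_smult_right: "lsub c (smult a g) = smult a (lsub c g)"
proof (induction c arbitrary: g)
  case (pCons b c)
  have "smult a g - pderiv (smult a g) = smult a (g - pderiv g)" by (simp add: pderiv_smult smult_diff_right)
  then show ?case
    by (simp only: lsub_pCons pCons.IH smult_add_right mult_smult_right) (simp add: mult.commute)
qed simp

lemma lsub_uminus_right: "lsub c (-g) = - lsub c g"
  using lsub_smult_right[of c "-1" g] by simp

lemma lsub_monom: "lsub (monom a j) g = monom a j * ((\<lambda>g. g - pderiv g) ^^ j) g"
proof (induction j arbitrary: g)
  case 0
  then show ?case by (simp add: monom_0)
next
  case (Suc j)
  have "lsub (monom a (Suc j)) g = [:0, 1:] * lsub (monom a j) (g - pderiv g)"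
    by (simp add: monom_Suc)
  also have "\<dots> = [:0, 1:] * monom a j * ((\<lambda>g. g - pderiv g) ^^ Suc j) g"
    by (simp only: Suc.IH funpow_Suc_right o_apply mult.assoc)
  also have "[:0, 1:] * monom a j = monom a (Suc j)" by (simp add: monom_Suc)
  finally show ?case .
qed

section \<open>Commutation of the Laguerre differential operator with normally ordered
  operators\<close>

definition lag_op :: "real \<Rightarrow> real poly \<Rightarrow> real poly" where
  "lag_op \<alpha> g = - ([:0, 1:] * pderiv (pderiv g) + [:\<alpha> + 1, -1:] * pderiv g)"

lemma lag_op_add: "lag_op \<alpha> (f + g) = lag_op \<alpha> f + lag_op \<alpha> g"
  unfolding lag_op_def pderiv_add by (simp only: algebra_simps)

lemma lag_op_smult: "lag_op \<alpha> (smult c g) = smult c (lag_op \<alpha> g)"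
  unfolding lag_op_def pderiv_smult by (simp only: mult_smult_right smult_add_right smult_minus_right)

text \<open>Normal ordering: with E = 1 - D the inner operator is x^j E^j. Differentiating produces
  terms such as x^(j-1) E^j with one E too many, which are split by E^j = E^(j-1) (1 - D); this is
  the origin of the second summand. Both symbols on the right are differential expressions in
  \<open>c\<close>, so the Laguerre equation can later act on \<open>c\<close>.\<close>

lemma lag_op_lsub_monom:
  assumes "c = monom a j"
  shows "lag_op \<alpha> (lsub c g) =
    lsub ([:0, 1:] * pderiv c - smult (1 + \<alpha>) (pderiv c) - [:0, 1:] * pderiv (pderiv c)) g
    + lsub ([:0, 1:] * c - smult 2 ([:0, 1:] * pderiv c) - smult (\<alpha> + 1) c
        + smult (1 + \<alpha>) (pderiv c) + [:0, 1:] * pderiv (pderiv c)) (pderiv g)"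
proof -
  define E where "E = (\<lambda>g::real poly. g - pderiv g)"
  have Ed: "(E ^^ i) (pderiv g) = pderiv ((E ^^ i) g)" for i g
    by (induction i) (simp_all add: E_def pderiv_diff)
  have ls: "lsub (monom b i) g = monom b i * (E ^^ i) g" for b i g
    by (simp add: lsub_monom E_def)
  have X: "[:0, 1:] * monom b i = monom b (Suc i)" for b :: real and i
    by (simp add: monom_Suc)
  define h where "h = (E ^^ j) g"
  have ES: "(E ^^ Suc j) g = h - pderiv h" "(E ^^ Suc j) (pderiv g) = pderiv h - pderiv (pderiv h)"
    "(E ^^ j) (pderiv g) = pderiv h"
    by (simp_all add: h_def Ed) (simp_all add: E_def pderiv_diff)
  show ?thesis
  proof (cases j)
    case 0
    then have c: "c = monom a 0" "pderiv c = 0" using assms by (simp_all add: monom_0)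
    show ?thesis
      unfolding c pderiv_0 mult_zero_right smult_0_right X diff_0_right add_0_right lsub_diff lsub_0
          lsub_smult ls
      by (intro poly_eq_poly_eq_iff[THEN iffD1] ext)
        (simp add: lag_op_def E_def pderiv_smult pderiv_diff monom_0 poly_monom monom_Suc pderiv_pCons
            algebra_simps)
  next
    case (Suc i)
    have d1: "pderiv c = monom (real j * a) i" using assms Suc by (simp add: pderiv_monom)
    have Xd1: "[:0, 1:] * pderiv c = monom (real j * a) j" by (simp only: d1 X Suc)
    have Xd2: "[:0, 1:] * pderiv (pderiv c) = monom (real j * real i * a) i"
      by (cases i) (simp_all add: d1 pderiv_monom X mult.commute del: mult_pCons_left)
    define f where "f = (E ^^ i) g"
    have hf: "h = f - pderiv f" "(E ^^ i) (pderiv g) = pderiv f"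
      using Suc by (simp_all add: h_def f_def Ed) (simp add: E_def)
    have L: "lag_op \<alpha> (lsub c g) = lag_op \<alpha> (monom a j * h)"
      by (simp add: assms ls h_def)
    show ?thesis
      unfolding L unfolding Xd1 Xd2 unfolding d1 unfolding assms X lsub_diff lsub_add lsub_smult ls ES hf(2)
        f_def[symmetric] h_def[symmetric]
    proof (intro poly_eq_poly_eq_iff[THEN iffD1] ext)
      fix t :: real
      define u H H1 H2 F1 where "u = a * t ^ i" and "H = poly h t" and "H1 = poly (pderiv h) t"
        and "H2 = poly (pderiv (pderiv h)) t" and "F1 = poly (pderiv f) t"
      note defs = this
      have F: "poly f t = H + F1" by (simp add: H_def F1_def hf(1))
      have e1: "poly (monom (b * a) i) t = b * u" for b by (simp add: poly_monom u_def)
      have e2: "poly (monom (b * a) j) t = b * t * u" for b by (simp add: poly_monom u_def Suc)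
      have e3: "poly (monom a j) t = t * u" by (simp add: poly_monom u_def Suc)
      have e4: "poly (monom a (Suc j)) t = t * t * u" by (simp add: poly_monom u_def Suc)
      have p1: "poly (pderiv (monom a j)) t = real j * u" by (simp add: pderiv_monom poly_monom u_def Suc)
      have p2: "t * poly (pderiv (pderiv (monom a j))) t = real j * real i * u"
        by (cases i) (simp_all add: pderiv_monom poly_monom u_def Suc)
      have "poly (lag_op \<alpha> (monom a j * h)) t =
          - ((t * poly (pderiv (pderiv (monom a j))) t) * H + t * (2 * (real j * u) * H1) + t * (t * u) * H2
             + (\<alpha> + 1 - t) * (real j * u * H + t * u * H1))"
        by (simp add: lag_op_def pderiv_mult pderiv_add defs[symmetric] e3 p1 algebra_simps)
      then have lhs: "poly (lag_op \<alpha> (monom a j * h)) t =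
          - ((real j * real i * u) * H + t * (2 * (real j * u) * H1) + t * (t * u) * H2
             + (\<alpha> + 1 - t) * (real j * u * H + t * u * H1))" by (simp only: p2)
      have rj: "real j = real i + 1" using Suc by simp
      show "poly (lag_op \<alpha> (monom a j * h)) t = poly
        (monom (real j * a) j * h - smult (1 + \<alpha>) (monom (real j * a) i * f)
          - monom (real j * real i * a) i * f
          + (monom a (Suc j) * (pderiv h - pderiv (pderiv h)) - smult 2 (monom (real j * a) j * pderiv h)
             - smult (\<alpha> + 1) (monom a j * pderiv h) + smult (1 + \<alpha>) (monom (real j * a) i * pderiv f)
             + monom (real j * real i * a) i * pderiv f)) t"
        unfolding lhs poly_add poly_diff poly_mult poly_smult e1 e2 e3 e4 F defs(2-5)[symmetric] rj
        by (simp add: algebra_simps)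
    qed
  qed
qed

lemma lag_op_lsub:
  "lag_op \<alpha> (lsub c g) =
    lsub ([:0, 1:] * pderiv c - smult (1 + \<alpha>) (pderiv c) - [:0, 1:] * pderiv (pderiv c)) g
    + lsub ([:0, 1:] * c - smult 2 ([:0, 1:] * pderiv c) - smult (\<alpha> + 1) c
        + smult (1 + \<alpha>) (pderiv c) + [:0, 1:] * pderiv (pderiv c)) (pderiv g)"
proof -
  define R where "R c = lsub ([:0, 1:] * pderiv c - smult (1 + \<alpha>) (pderiv c) - [:0, 1:] * pderiv (pderiv c)) g
    + lsub ([:0, 1:] * c - smult 2 ([:0, 1:] * pderiv c) - smult (\<alpha> + 1) c
        + smult (1 + \<alpha>) (pderiv c) + [:0, 1:] * pderiv (pderiv c)) (pderiv g)" for c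
  have add: "R (c + d) = R c + R d" for c d
    unfolding R_def pderiv_add distrib_left smult_add_right lsub_add lsub_diff by (simp only: algebra_simps)
  have mon: "lag_op \<alpha> (lsub (monom a j) g) = R (monom a j)" for a j
    by (simp only: R_def lag_op_lsub_monom[OF refl])
  have "lag_op \<alpha> (lsub (\<Sum>i\<in>I. monom (coeff c i) i) g) = R (\<Sum>i\<in>I. monom (coeff c i) i)" if "finite I" for I
    using that
  proof (induction I)
    case empty
    show ?case by (simp add: R_def lag_op_def)
  next
    case (insert i I)
    then show ?case
      by (simp only: sum.insert[OF insert.hyps] add lsub_add lag_op_add mon insert.IH)
  qed
  from this[of "{..degree c}"] show ?thesis by (simp only: poly_as_sum_of_monoms finite_atMost R_def)
qed

text \<open>The operator with symbol \<open>y^k L_k(x(1 + y))\<close>, where \<open>y = -D\<close>, has \<open>L_n\<close> as an eigenvector with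
  eigenvalue \<open>n choose k\<close>.\<close>

lemma lag_op_lsub_laguerre:
  assumes "\<alpha> > -1"
  shows "lag_op \<alpha> (lsub (laguerre \<alpha> k) g) =
    smult (real k) (lsub (laguerre \<alpha> k) g) + smult (real (Suc k)) (lsub (laguerre \<alpha> (Suc k)) (- pderiv g))"
proof -
  define L where "L = laguerre \<alpha> k"
  have ode: "[:0, 1:] * pderiv (pderiv L) = - ([:\<alpha> + 1, -1:] * pderiv L) - smult (real k) L"
    using laguerre_ode[OF assms, of k] unfolding L_def by (simp only: eq_neg_iff_add_eq_0 algebra_simps)
  have lin: "[:\<alpha> + 1, -1:] * d = smult (\<alpha> + 1) d - [:0, 1:] * d" for d by simp
  \<comment> \<open>The Laguerre equation, solved for x L'', reduces the symbol acting on
    \<open>g\<close> to k L_k; with \<open>laguerre_Suc\<close> the one acting on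
    \<open>pderiv g\<close> becomes -(k+1) L_(k+1).\<close>
  have 1: "[:0, 1:] * pderiv L - smult (1 + \<alpha>) (pderiv L) - [:0, 1:] * pderiv (pderiv L) = smult (real k) L"
    unfolding ode lin by (simp add: algebra_simps)
  have lin2: "[:real k + 1 + \<alpha>, -1:] * L = smult (real k + 1 + \<alpha>) L - [:0, 1:] * L" by simp
  have 2: "[:0, 1:] * L - smult 2 ([:0, 1:] * pderiv L) - smult (\<alpha> + 1) L
        + smult (1 + \<alpha>) (pderiv L) + [:0, 1:] * pderiv (pderiv L) = smult (real (Suc k)) (- laguerre \<alpha> (Suc k))"
    unfolding smult_minus_right laguerre_Suc[OF assms] L_def[symmetric] ode lin lin2
    by (intro poly_eq_poly_eq_iff[THEN iffD1] ext) (simp add: algebra_simps)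
  show ?thesis
    unfolding L_def[symmetric] lag_op_lsub[of \<alpha> L] 1 2 lsub_smult lsub_uminus lsub_uminus_right ..
qed

text \<open>Applying \<open>lag_op\<close> to the induction hypothesis multiplies it by n and
  isolates the next operator, whose eigenvalue is therefore (n - k)/(k + 1) times the previous
  one.\<close>

lemma lsub_laguerre_eigen:
  assumes "\<alpha> > -1"
  shows "lsub (laguerre \<alpha> k) (((\<lambda>g. - pderiv g) ^^ k) (laguerre \<alpha> n))
      = smult (real (n choose k)) (laguerre \<alpha> n)"
proof (induction k)
  case 0
  then show ?case by (simp add: one_pCons)
next
  case (Suc k)
  define g where "g = ((\<lambda>g. - pderiv g) ^^ k) (laguerre \<alpha> n)"
  have L: "lag_op \<alpha> (laguerre \<alpha> n) = smult (real n) (laguerre \<alpha> n)"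
    using laguerre_ode[OF assms, of n] unfolding lag_op_def by (simp only: neg_eq_iff_add_eq_0 algebra_simps)
  have IH: "lsub (laguerre \<alpha> k) g = smult (real (n choose k)) (laguerre \<alpha> n)" using Suc by (simp add: g_def)
  have "smult (real (n choose k)) (smult (real n) (laguerre \<alpha> n)) =
      smult (real k) (smult (real (n choose k)) (laguerre \<alpha> n))
      + smult (real (Suc k)) (lsub (laguerre \<alpha> (Suc k)) (- pderiv g))"
    using lag_op_lsub_laguerre[OF assms, of k g] unfolding IH lag_op_smult L .
  then have "smult (real (Suc k)) (lsub (laguerre \<alpha> (Suc k)) (- pderiv g)) =
      smult ((real n - real k) * real (n choose k)) (laguerre \<alpha> n)"
    by (simp add: algebra_simps smult_diff_left)
  also have "(real n - real k) * real (n choose k) = real (Suc k) * real (n choose Suc k)"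
  proof (cases "k \<le> n")
    case True
    have "Suc k * (n choose Suc k) = (n - k) * (n choose k)" by (metis binomial_absorption binomial_absorb_comp)
    then show ?thesis using True by (metis of_nat_diff of_nat_mult)
  qed (simp add: binomial_eq_0)
  finally have "smult (real (Suc k)) (lsub (laguerre \<alpha> (Suc k)) (- pderiv g)) =
      smult (real (Suc k)) (smult (real (n choose Suc k)) (laguerre \<alpha> n))" by simp
  then have "lsub (laguerre \<alpha> (Suc k)) (- pderiv g) = smult (real (n choose Suc k)) (laguerre \<alpha> n)"
    by (metis of_nat_eq_0_iff nat.distinct(1) smult_cancel)
  then show ?case by (simp add: g_def)
qed

text \<open>In normal order all multiplications by x stand on the left, so at a fixed point they
  become constants. The value there is that of a constant-coefficient operator, to which the
  half-plane principle applies.\<close>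

lemma poly_lsub:
  "poly (cpoly (lsub c g)) x = poly (dop (pcompose (cpoly c) [:x, -x:]) (cpoly g)) x"
proof (induction c arbitrary: g)
  case (pCons a c)
  define q where "q = pcompose (cpoly c) [:x, -x:]"
  have "poly (cpoly (lsub (pCons a c) g)) x = of_real a * poly (cpoly g) x
      + x * poly (dop q (cpoly (g - pderiv g))) x"
    unfolding q_def pCons.IH[symmetric]
    by (simp add: cpoly_add cpoly_mult cpoly_smult cpoly_pCons del: mult_pCons_left)
  also have "\<dots> = poly (smult (of_real a) (cpoly g) + dop ([:x, -x:] * q) (cpoly g)) x"
    unfolding dop_mult cpoly_diff cpoly_pderiv dop_diff_right dop_pderiv
    by (simp add: pderiv_smult pderiv_minus algebra_simps)
  also have "smult (of_real a) (cpoly g) + dop ([:x, -x:] * q) (cpoly g)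
      = dop (pcompose (cpoly (pCons a c)) [:x, -x:]) (cpoly g)"
    by (simp add: q_def cpoly_pCons pcompose_pCons dop_add del: mult_pCons_left)
  finally show ?case .
qed simp

section \<open>Sufficiency\<close>

lemma tendsto_falling:
  "(\<lambda>n. fact n / (fact (n - j) * real n ^ j)) \<longlonglongrightarrow> (1::real)"
proof (induction j)
  case (Suc j)
  have "(\<lambda>n. fact n / (fact (n - j) * real n ^ j) * (1 - real j / real n)) \<longlonglongrightarrow> 1 * (1 - 0)"
    by (intro tendsto_intros Suc tendsto_divide_0[OF tendsto_const] filterlim_real_sequentially
        filterlim_at_top_imp_at_infinity)
  moreover have "eventually (\<lambda>n. fact n / (fact (n - j) * real n ^ j) * (1 - real j / real n) =
      fact n / (fact (n - Suc j) * real n ^ Suc j)) sequentially"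
  proof (rule eventually_mono[OF eventually_gt_at_top[of j]])
    fix n assume n: "j < n"
    then have f: "fact (n - j) = real (n - j) * fact (n - Suc j)"
      by (metis Suc_diff_Suc fact_Suc of_nat_Suc of_nat_mult of_nat_fact)
    have r: "real (n - j) = real n - real j" "real n - real j > 0" "real n > 0" using n by auto
    show "fact n / (fact (n - j) * real n ^ j) * (1 - real j / real n) =
      fact n / (fact (n - Suc j) * real n ^ Suc j)"
      unfolding f r(1) using r(2,3) by (simp add: divide_simps)
  qed
  ultimately show ?case using tendsto_cong by fastforce
qed simp

text \<open>Real-rooted polynomials converging to the Bessel-type function \<open>\<Sum>j. (-s)^j / (j! (\<alpha> + 1)_j)\<close>.\<close>

definition scaled_laguerre :: "real \<Rightarrow> nat \<Rightarrow> real poly" where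
  "scaled_laguerre \<alpha> n = smult (fact n / poch \<alpha> n) (pcompose (laguerre \<alpha> n) [:0, 1 / real n:])"

lemma coeff_scaled_laguerre_limit:
  assumes "\<alpha> > -1"
  shows "(\<lambda>n. fact j * coeff (scaled_laguerre \<alpha> n) j) \<longlonglongrightarrow> (-1) ^ j / poch \<alpha> j"
proof -
  have "(\<lambda>n. (-1) ^ j / poch \<alpha> j * (fact n / (fact (n - j) * real n ^ j))) \<longlonglongrightarrow> (-1) ^ j / poch \<alpha> j * 1"
    by (intro tendsto_intros tendsto_falling)
  moreover have "eventually (\<lambda>n. (-1) ^ j / poch \<alpha> j * (fact n / (fact (n - j) * real n ^ j)) =
      fact j * coeff (scaled_laguerre \<alpha> n) j) sequentially"
  proof (rule eventually_mono[OF eventually_gt_at_top[of j]])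
    fix n assume n: "j < n"
    show "(-1) ^ j / poch \<alpha> j * (fact n / (fact (n - j) * real n ^ j)) = fact j * coeff (scaled_laguerre \<alpha> n) j"
      using n poch_pos[OF assms, of n]
      by (simp add: scaled_laguerre_def coeff_pcompose_linear coeff_laguerre[OF assms] field_simps)
  qed
  ultimately show ?thesis using tendsto_cong by fastforce
qed

lemma laguerre_root_pos:
  assumes "\<alpha> > -1" "poly (cpoly (laguerre \<alpha> n)) x = 0"
  shows "Im x = 0 \<and> Re x > 0"
proof -
  have "Im x = 0" using real_rooted_no_zero[OF real_rooted_laguerre[OF assms(1)]] assms by auto
  then show ?thesis using laguerre_no_zero[OF assms(1), of x n] assms(2) by force
qed

lemma scaled_laguerre_no_zero:
  assumes \<alpha>: "\<alpha> > -1" and n: "n > 0" and \<omega>: "Re \<omega> > 0" "Re (\<omega> * s) \<le> 0"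
  shows "poly (cpoly (scaled_laguerre \<alpha> n)) s \<noteq> 0"
proof
  assume z: "poly (cpoly (scaled_laguerre \<alpha> n)) s = 0"
  have comp: "poly (cpoly (pcompose p [:0, c:])) s = poly (cpoly p) (s * of_real c)" for p and c :: real
    by (simp add: cpoly_pcompose cpoly_pCons poly_pcompose)
  have "poly (cpoly (laguerre \<alpha> n)) (s * of_real (1 / real n)) = 0"
    using z poch_pos[OF \<alpha>, of n] by (simp add: scaled_laguerre_def cpoly_smult comp)
  from laguerre_root_pos[OF \<alpha> this] n have "Im s = 0" "Re s > 0"
    by (auto simp: zero_less_divide_iff)
  then show False using \<omega> by (simp add: mult_le_0_iff)
qed

lemma pcompose_linear_sum:
  fixes Q :: "complex poly"
  shows "pcompose Q r = (\<Sum>k\<le>degree Q. smult (coeff Q k) (r ^ k))"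
  by (intro poly_eq_poly_eq_iff[THEN iffD1] ext) (simp add: poly_pcompose poly_sum poly_altdef[of Q])

text \<open>A polynomial in \<open>D = -y\<close>. For \<open>\<phi> j = j! F_j\<close> it is \<open>p(y + x y (1 + y) d/ds) F(s)\<close> at \<open>s = 0\<close>, and for
  \<open>\<phi> j = (-1)^j / (\<alpha> + 1)_j\<close> it is the symbol \<open>\<Sum>k. a_k y^k L_k(x(1 + y))\<close> of the multiplier.\<close>

definition symb :: "(nat \<Rightarrow> complex) \<Rightarrow> real poly \<Rightarrow> complex \<Rightarrow> complex poly" where
  "symb \<phi> p x = (\<Sum>k\<le>degree p. smult (of_real (coeff p k))
     (\<Sum>j\<le>k. smult (of_nat (k choose j) * \<phi> j * x ^ j) ([:1, -1:] ^ j * [:0, -1:] ^ k)))"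

lemma symb_eval:
  "poly (symb \<phi> p x) (-y) = (\<Sum>k\<le>degree p. of_real (coeff p k) *
     (\<Sum>j\<le>k. of_nat (k choose j) * \<phi> j * x ^ j * ((1 + y) ^ j * y ^ k)))"
  by (simp add: symb_def poly_sum)

text \<open>Since y^k (x (1+y))^j = y^(k-j) v^j, the inner sum is the binomial expansion of (y + v
  d/ds)^k, and the j-th derivative of \<open>G\<close> at 0 is j! times its coefficient.\<close>

lemma symb_eval_dop:
  assumes v: "v = x * y * (1 + y)"
  shows "poly (symb (\<lambda>j. fact j * coeff G j) p x) (-y) = poly (dop (pcompose (cpoly p) [:y, v:]) G) 0"
proof -
  have "poly (dop ([:y, v:] ^ k) G) 0 = (\<Sum>j\<le>k. of_nat (k choose j) * v ^ j * y ^ (k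
      - j) * (fact j * coeff G j))" for k
  proof -
    have d: "degree ([:y, v:] ^ k) \<le> k"
      using degree_power_le[of "[:y, v:]" k] by (auto split: if_splits simp: order.trans)
    have "poly (dop ([:y, v:] ^ k) G) 0 = (\<Sum>j\<le>k. coeff ([:y, v:] ^ k) j * (fact j * coeff G j))"
      unfolding poly_dop_0 by (rule sum.mono_neutral_left) (use d in \<open>auto simp: coeff_eq_0\<close>)
    then show ?thesis by (simp add: coeff_linear_poly_power)
  qed
  then have eq: "poly (dop (pcompose (cpoly p) [:y, v:]) G) 0 = (\<Sum>k\<le>degree p. of_real (coeff p k) *
      (\<Sum>j\<le>k. of_nat (k choose j) * v ^ j * y ^ (k - j) * (fact j * coeff G j)))"
    by (simp add: pcompose_linear_sum dop_sum dop_smult poly_sum degree_cpoly coeff_map_poly)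
  have inner: "(\<Sum>j\<le>k. of_nat (k choose j) * v ^ j * y ^ (k - j) * (fact j * coeff G j)) =
      (\<Sum>j\<le>k. of_nat (k choose j) * (fact j * coeff G j) * x ^ j * ((1 + y) ^ j * y ^ k))" for k
  proof (intro sum.cong refl)
    fix j assume "j \<in> {..k}"
    then have "y ^ k = y ^ j * y ^ (k - j)" by (simp add: power_add[symmetric])
    then show "of_nat (k choose j) * v ^ j * y ^ (k - j) * (fact j * coeff G j) =
        of_nat (k choose j) * (fact j * coeff G j) * x ^ j * ((1 + y) ^ j * y ^ k)"
      by (simp add: v power_mult_distrib mult_ac)
  qed
  show ?thesis unfolding symb_eval eq inner ..
qed

definition zeros_in_unit :: "real poly \<Rightarrow> bool" where
  "zeros_in_unit p \<longleftrightarrow> real_rooted p \<and> p \<noteq> 0 \<and> (\<forall>x. poly p x = 0 \<longrightarrow> -1 \<le> x \<and> x \<le> 0)"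

lemma zeros_in_unit_complex:
  assumes "zeros_in_unit p" "poly (cpoly p) z = 0"
  obtains c where "z = - of_real c" "0 \<le> c" "c \<le> 1"
proof -
  have "Im z = 0" using real_rooted_no_zero assms by (auto simp: zeros_in_unit_def)
  then have z: "z = of_real (Re z)" by (simp add: complex_eq_iff)
  then have "poly p (Re z) = 0" using assms(2) poly_cpoly_of_real[of p "Re z"] by simp
  then show ?thesis using that[of "- Re z"] assms(1) z by (auto simp: zeros_in_unit_def)
qed

lemma symb_scaled_no_zero:
  assumes \<alpha>: "\<alpha> > -1" and p: "zeros_in_unit p" and n: "n > 0" and x: "Im x > 0" and y: "Im y > 0"
  shows "poly (symb (\<lambda>j. of_real (fact j * coeff (scaled_laguerre \<alpha> n) j)) p x) (-y) \<noteq> 0"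
proof -
  define v where "v = x * y * (1 + y)"
  \<comment> \<open>This choice gives Re \<omega> = Im x > 0, which puts the positive zeros of
    \<open>scaled_laguerre\<close> in the right half-plane, and \<open>cnj \<omega>\<close> cancels
    the factor x of \<open>v\<close>.\<close>
  define \<omega> where "\<omega> = \<i> * cnj x"
  have y0: "y \<noteq> 0" "1 + y \<noteq> 0" using y by (auto simp: complex_eq_iff)
  then have v0: "v \<noteq> 0" using x by (auto simp: v_def)
  have "poly (dop (pcompose (cpoly p) [:y, v:]) (cpoly (scaled_laguerre \<alpha> n))) 0 \<noteq> 0"
  proof (rule halfplane_dop[of \<omega> 0])
    show "poly (cpoly (scaled_laguerre \<alpha> n)) s \<noteq> 0" if "Re (\<omega> * (s - 0)) \<le> 0" for s
      using scaled_laguerre_no_zero[OF \<alpha> n, of \<omega> s] that x by (simp add: \<omega>_def)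
    show "pcompose (cpoly p) [:y, v:] \<noteq> 0"
      using p v0 pcompose_eq_0[of "cpoly p" "[:y, v:]"] by (auto simp: zeros_in_unit_def cpoly_eq_0_iff)
    show "\<rho> \<noteq> 0 \<and> Re (cnj \<omega> * \<rho>) \<ge> 0" if "poly (pcompose (cpoly p) [:y, v:]) \<rho> = 0" for \<rho>
    proof -
      have "poly (cpoly p) (y + v * \<rho>) = 0" using that by (simp add: poly_pcompose mult.commute)
      then obtain c where c: "y + v * \<rho> = - of_real c" "0 \<le> c" "c \<le> 1"
        using zeros_in_unit_complex[OF p] by blast
      have "\<rho> \<noteq> 0"
      proof
        assume "\<rho> = 0"
        then have "Im y = 0" using arg_cong[OF c(1), of Im] by simp
        then show False using y by simp
      qed
      moreover have "cnj \<omega> * \<rho> = \<i> * (of_real c / y + of_real (1 - c) / (1 + y))"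
      proof -
        have "v * \<rho> = - (y + of_real c)" using c(1) by (simp add: algebra_simps eq_neg_iff_add_eq_0)
        then have \<rho>: "\<rho> = - ((y + of_real c) / v)" using v0 by (simp add: field_simps)
        have "x \<noteq> 0" using x by auto
        then have "cnj \<omega> * \<rho> = \<i> * ((y + of_real c) / (y * (1 + y)))"
          unfolding \<rho> using y0 by (simp add: \<omega>_def v_def mult.assoc)
        also have "(y + of_real c) / (y * (1 + y)) = of_real c / y + of_real (1 - c) / (1 + y)"
          using y0 by (simp add: divide_simps) (simp add: algebra_simps)
        finally show ?thesis .
      qed
      then have "Re (cnj \<omega> * \<rho>) = - Im (of_real c / y) - Im (of_real (1 - c) / (1 + y))" by simp
      moreover have "Im (of_real c / y) \<le> 0"
        using c(2) y by (simp add: Im_divide divide_nonpos_nonneg mult_nonneg_nonneg)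
      moreover have "Im (of_real (1 - c) / (1 + y)) \<le> 0"
        using c(3) y by (simp add: Im_divide divide_nonpos_nonneg mult_nonneg_nonneg)
      ultimately show ?thesis by simp
    qed
  qed simp
  then show ?thesis
    using symb_eval_dop[OF v_def, of "cpoly (scaled_laguerre \<alpha> n)" p] by (simp add: coeff_map_poly)
qed

text \<open>Hurwitz's theorem in the variable Y = -y carries \<open>symb_scaled_no_zero\<close> to
  the limit. As \<open>poly R 0\<close> is the constant coefficient of \<open>p\<close>, its
  nonvanishing excludes the root 0, as \<open>halfplane_dop\<close> demands.\<close>

lemma symb_limit_no_zero:
  assumes \<alpha>: "\<alpha> > -1" and p: "zeros_in_unit p" and p0: "coeff p 0 \<noteq> 0" and x: "Im x > 0"
  defines "R \<equiv> symb (\<lambda>j. of_real ((-1) ^ j / poch \<alpha> j)) p x"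
  shows "R \<noteq> 0" and "poly R \<rho> = 0 \<Longrightarrow> \<rho> \<noteq> 0 \<and> Im \<rho> \<ge> 0"
proof -
  have "poly R 0 = of_real (coeff p 0)"
  proof -
    have "poly R 0 = (\<Sum>k\<le>degree p. if k = 0 then of_real (coeff p 0) else 0)"
      unfolding R_def symb_eval[of _ p x 0, unfolded minus_zero] by (intro sum.cong) (auto simp: power_0_left)
    then show ?thesis by simp
  qed
  then have R0: "poly R 0 \<noteq> 0" using p0 by simp
  then show R: "R \<noteq> 0" by auto
  define F where "F n = symb (\<lambda>j. of_real (fact j * coeff (scaled_laguerre \<alpha> (Suc n)) j)) p x" for n
  have nz: "poly R Y \<noteq> 0" if "Im Y < 0" for Y
  proof (rule Hurwitz_poly[of "{Y. Im Y < 0}" F "2 * degree p"])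
    show "open {Y. Im Y < 0}" by (rule open_halfspace_Im_lt)
    show "connected {Y. Im Y < 0}" by (intro convex_connected convex_halfspace_Im_lt)
    show "degree (F n) \<le> 2 * degree p" for n
      unfolding F_def symb_def
    proof (intro degree_sum_le finite_atMost order.trans[OF degree_smult_le])
      fix k j assume "k \<in> {..degree p}" "j \<in> {..k}"
      then have "j + k \<le> 2 * degree p" by auto
      moreover have "degree ([:1, - 1:] ^ j * [:0, - 1:] ^ k :: complex poly) \<le> j + k"
        using degree_mult_le[of "[:1, - 1:] ^ j :: complex poly" "[:0, - 1:] ^ k"]
          degree_power_le[of "[:1, -1::complex:]" j] degree_power_le[of "[:0, -1::complex:]" k] by simp
      ultimately show "degree ([:1, - 1:] ^ j * [:0, - 1:] ^ k :: complex poly) \<le> 2 * degree p" by simp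
    qed
    show "(\<lambda>n. coeff (F n) i) \<longlonglongrightarrow> coeff R i" for i
      unfolding F_def R_def symb_def coeff_sum coeff_smult
      by (intro tendsto_intros LIMSEQ_Suc coeff_scaled_laguerre_limit \<alpha>)
    show "poly (F n) z \<noteq> 0" if "z \<in> {Y. Im Y < 0}" for n z
      using symb_scaled_no_zero[OF \<alpha> p _ x, of "Suc n" "-z"] that by (simp add: F_def)
  qed (use that R in auto)
  show "\<rho> \<noteq> 0 \<and> Im \<rho> \<ge> 0" if "poly R \<rho> = 0"
    using nz[of \<rho>] R0 that by (metis not_less)
qed

section \<open>The multiplier as a differential operator that preserves real-rootedness\<close>

definition lag_mult :: "real \<Rightarrow> (nat \<Rightarrow> real) \<Rightarrow> nat \<Rightarrow> real poly \<Rightarrow> real poly" where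
  "lag_mult \<alpha> a d f = (\<Sum>k\<le>d. smult (a k) (lsub (laguerre \<alpha> k) (((\<lambda>g. - pderiv g) ^^ k) f)))"

text \<open>Here the weight (\<alpha>+1)_k / k! between \<open>p\<close> and \<open>a\<close> shows
  its purpose: it turns a_k times the j-th coefficient of L_k into p_k (k choose j) (-1)^j /
  (\<alpha>+1)_j, a symbol depending on \<open>p\<close> alone.\<close>

lemma poly_lag_mult:
  assumes \<alpha>: "\<alpha> > -1" and a: "\<And>k. coeff p k = poch \<alpha> k / fact k * a k"
  shows "poly (cpoly (lag_mult \<alpha> a (degree p) f)) x =
    poly (dop (symb (\<lambda>j. of_real ((-1) ^ j / poch \<alpha> j)) p x) (cpoly f)) x"
proof -
  have D: "cpoly (((\<lambda>g. - pderiv g) ^^ k) f) = dop ([:0, -1:] ^ k) (cpoly f)" for k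
  proof (induction k)
    case (Suc k)
    have "cpoly (- pderiv g) = - pderiv (cpoly g)" for g
      using cpoly_diff[of 0 "pderiv g"] by (simp add: cpoly_pderiv)
    then show ?case by (simp add: dop_mult Suc pderiv_minus del: mult_pCons_left)
  qed simp
  have comp: "smult (of_real (a k)) (pcompose (cpoly (laguerre \<alpha> k)) [:x, -x:]) =
      smult (of_real (coeff p k)) (\<Sum>j\<le>k. smult (of_nat (k choose j) * of_real ((-1) ^ j / poch \<alpha> j) * x ^ j)
          ([:1, -1:] ^ j))" for k
  proof -
    have x: "[:x, -x:] ^ j = smult (x ^ j) ([:1, -1:] ^ j)" for j
      using smult_power[of x "[:1, -1:]" j] by simp
    have c: "a k * coeff (laguerre \<alpha> k) j = coeff p k * (real (k choose j) * ((-1) ^ j / poch \<alpha> j))"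
        if "j \<le> k" for j
      using that poch_pos[OF \<alpha>, of j] poch_pos[OF \<alpha>, of k]
      by (simp add: coeff_laguerre[OF \<alpha>] a binomial_fact field_simps)
    have "smult (of_real (a k)) (pcompose (cpoly (laguerre \<alpha> k)) [:x, -x:]) =
      (\<Sum>j\<le>k. smult (of_real (a k * coeff (laguerre \<alpha> k) j)) (smult (x ^ j) ([:1, -1:] ^ j)))"
      by (simp add: pcompose_linear_sum degree_cpoly \<alpha> x coeff_map_poly smult_sum_right mult_ac)
    also have "\<dots> = (\<Sum>j\<le>k. smult (of_real (coeff p k * (real (k choose j) * ((-1) ^ j / poch \<alpha> j)))) (smult
        (x ^ j) ([:1, -1:] ^ j)))"
      by (intro sum.cong refl) (simp add: c)
    finally show ?thesis by (simp add: smult_sum_right mult_ac)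
  qed
  have "poly (cpoly (lag_mult \<alpha> a (degree p) f)) x =
      poly (\<Sum>k\<le>degree p. dop (smult (of_real (a k)) (pcompose (cpoly (laguerre \<alpha> k)) [:x, -x:]) * [:0, -1:]
          ^ k) (cpoly f)) x"
    unfolding lag_mult_def cpoly_sum cpoly_smult poly_sum poly_smult poly_lsub D dop_mult dop_smult by simp
  also have "(\<Sum>k\<le>degree p. dop (smult (of_real (a k)) (pcompose (cpoly (laguerre \<alpha> k)) [:x, -x:]) * [:0,
      -1:] ^ k) (cpoly f)) =
      dop (symb (\<lambda>j. of_real ((-1) ^ j / poch \<alpha> j)) p x) (cpoly f)"
    unfolding comp symb_def dop_sum[symmetric] by (simp add: sum_distrib_right)
  finally show ?thesis .
qed

lemma real_rooted_lag_mult_nz: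
  assumes \<alpha>: "\<alpha> > -1" and a: "\<And>k. coeff p k = poch \<alpha> k / fact k * a k"
    and p: "zeros_in_unit p" "coeff p 0 \<noteq> 0" and f: "real_rooted f"
  shows "real_rooted (lag_mult \<alpha> a (degree p) f)"
proof (cases "f = 0")
  case True
  have "((\<lambda>g. - pderiv g) ^^ k) 0 = (0 :: real poly)" for k by (induction k) auto
  moreover have "lsub c 0 = 0" for c using lsub_smult_right[of c 0 0] by simp
  ultimately show ?thesis using True by (simp add: lag_mult_def real_rooted_def)
next
  case False
  \<comment> \<open>For \<open>\<omega> = \<i>\<close> the zero-free half-plane is Im s \<ge> Im x,
    and the condition on the roots of the symbol reads Im \<rho> \<ge> 0.\<close>
  have "poly (cpoly (lag_mult \<alpha> a (degree p) f)) x \<noteq> 0" if x: "Im x > 0" for x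
    unfolding poly_lag_mult[OF \<alpha> a]
  proof (rule halfplane_dop[of \<i> x])
    show "poly (cpoly f) s \<noteq> 0" if "Re (\<i> * (s - x)) \<le> 0" for s
      using that x f False real_rooted_no_zero[of f s] by simp
    show "\<rho> \<noteq> 0 \<and> 0 \<le> Re (cnj \<i> * \<rho>)"
      if "poly (symb (\<lambda>j. of_real ((-1) ^ j / poch \<alpha> j)) p x) \<rho> = 0" for \<rho>
      using symb_limit_no_zero(2)[OF \<alpha> p x that] by simp
  qed (use symb_limit_no_zero(1)[OF \<alpha> p x] in auto)
  then show ?thesis by (simp add: real_rooted_iff)
qed

lemma tendsto_coeff_power:
  fixes F :: "nat \<Rightarrow> real poly"
  assumes "\<And>i. (\<lambda>n. coeff (F n) i) \<longlonglongrightarrow> coeff g i"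
  shows "(\<lambda>n. coeff (F n ^ k) i) \<longlonglongrightarrow> coeff (g ^ k) i"
proof (induction k arbitrary: i)
  case (Suc k)
  then show ?case by (simp add: coeff_mult) (intro tendsto_intros assms Suc)
qed simp

lemma real_rooted_lag_mult:
  assumes \<alpha>: "\<alpha> > -1" and a: "\<And>k. coeff p k = poch \<alpha> k / fact k * a k"
    and p: "zeros_in_unit p" and f: "real_rooted f"
  shows "real_rooted (lag_mult \<alpha> a (degree p) f)"
proof -
  define e where "e n = 1 / real (Suc n)" for n
  have e: "e n > 0" for n by (simp add: e_def)
  have e_lim: "e \<longlonglongrightarrow> 0" unfolding e_def by (rule LIMSEQ_inverse_real_of_nat[unfolded inverse_eq_divide])
  \<comment> \<open>A root t of \<open>p\<close> moves to (t - e)/(1 + e): -1 stays fixed and 0 goes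
    to -e/(1 + e), so all roots remain in [-1, 0] but avoid 0.\<close>
  define P where "P n = pcompose p [:e n, 1 + e n:]" for n
  define b where "b n k = coeff (P n) k * fact k / poch \<alpha> k" for n k
  have b: "coeff (P n) k = poch \<alpha> k / fact k * b n k" for n k
    using poch_pos[OF \<alpha>, of k] by (simp add: b_def)
  have poly_P: "poly (P n) x = poly p (e n + (1 + e n) * x)" for n x
    by (simp add: P_def poly_pcompose mult.commute)
  have cpoly_P: "poly (cpoly (P n)) z = poly (cpoly p) (of_real (e n) + of_real (1 + e n) * z)" for n z
    by (simp add: P_def cpoly_pcompose cpoly_pCons poly_pcompose mult.commute)
  have p0: "p \<noteq> 0" using p by (simp add: zeros_in_unit_def)
  have dP: "degree (P n) = degree p" for n using e[of n] by (simp add: P_def degree_pcompose)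
  have Pe: "poly (P n) 0 \<noteq> 0" for n
    using p e[of n] by (force simp: poly_P zeros_in_unit_def)
  have "zeros_in_unit (P n)" for n
    unfolding zeros_in_unit_def
  proof (intro conjI allI impI)
    show "P n \<noteq> 0" using Pe[of n] by auto
    show "real_rooted (P n)"
      unfolding real_rooted_iff cpoly_P
    proof (intro disjI2 allI impI)
      fix z assume "0 < Im z"
      then have "Im (of_real (e n) + of_real (1 + e n) * z) > 0" using e[of n] by simp
      then have "Im (of_real (e n) + of_real (1 + e n) * z) \<noteq> 0" by linarith
      then show "poly (cpoly p) (of_real (e n) + of_real (1 + e n) * z) \<noteq> 0"
        using real_rooted_no_zero p unfolding zeros_in_unit_def by blast
    qed
    fix x assume "poly (P n) x = 0"
    then have x: "-1 \<le> e n + (1 + e n) * x" "e n + (1 + e n) * x \<le> 0"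
      using p by (auto simp: poly_P zeros_in_unit_def)
    have "0 \<le> (1 + e n) * (x + 1)" using x(1) by (simp add: algebra_simps)
    then show "-1 \<le> x" using e[of n] by (simp add: zero_le_mult_iff)
    have "(1 + e n) * x \<le> 0" using x(2) e[of n] by simp
    then show "x \<le> 0" using e[of n] by (simp add: mult_le_0_iff)
  qed
  then have rr: "real_rooted (lag_mult \<alpha> (b n) (degree p) f)" for n
    using real_rooted_lag_mult_nz[OF \<alpha> b[of n] _ _ f] Pe[of n] dP[of n] by (simp add: poly_0_coeff_0)
  have P_lim: "(\<lambda>n. coeff (P n) k) \<longlonglongrightarrow> coeff p k" for k
  proof -
    have lin: "(\<lambda>n. coeff [:e n, 1 + e n:] i) \<longlonglongrightarrow> coeff [:0, 1:] i" for i
    proof -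
      have "(\<lambda>n. 1 + e n) \<longlonglongrightarrow> 1 + 0" by (intro tendsto_intros e_lim)
      then show ?thesis using e_lim by (auto simp: coeff_pCons split: nat.split)
    qed
    have sm: "pcompose p r = (\<Sum>k\<le>degree p. smult (coeff p k) (r ^ k))" for r :: "real poly"
      by (intro poly_eq_poly_eq_iff[THEN iffD1] ext) (simp add: poly_pcompose poly_sum poly_altdef[of p])
    have "(\<lambda>n. coeff (P n) k) \<longlonglongrightarrow> coeff (pcompose p [:0, 1:]) k"
      unfolding P_def sm coeff_sum coeff_smult by (intro tendsto_intros tendsto_coeff_power lin)
    then show ?thesis by (simp add: pcompose_idR)
  qed
  have b_lim: "(\<lambda>n. b n k) \<longlonglongrightarrow> a k" for k
  proof -
    have "(\<lambda>n. b n k) \<longlonglongrightarrow> coeff p k * fact k / poch \<alpha> k"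
      unfolding b_def by (intro tendsto_intros P_lim) (use poch_pos[OF \<alpha>, of k] in auto)
    also have "coeff p k * fact k / poch \<alpha> k = a k" using poch_pos[OF \<alpha>, of k] by (simp add: a)
    finally show ?thesis .
  qed
  define q where "q k = lsub (laguerre \<alpha> k) (((\<lambda>g. - pderiv g) ^^ k) f)" for k
  show ?thesis
  proof (rule real_rooted_limit[of "\<lambda>n. lag_mult \<alpha> (b n) (degree p) f" "\<Sum>k\<le>degree p. degree (q k)"])
    show "degree (lag_mult \<alpha> (b n) (degree p) f) \<le> (\<Sum>k\<le>degree p. degree (q k))" for n
      unfolding lag_mult_def q_def[symmetric]
      by (intro degree_sum_le order.trans[OF degree_smult_le] member_le_sum) auto
    show "(\<lambda>n. coeff (lag_mult \<alpha> (b n) (degree p) f) i) \<longlonglongrightarrow> coeff (lag_mult \<alpha> a (degree p) f) i" for i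
      unfolding lag_mult_def coeff_sum coeff_smult by (intro tendsto_intros b_lim)
  qed (rule rr)
qed

lemma laguerre_multiplier_sufficient:
  assumes \<alpha>: "\<alpha> > -1" and a: "\<And>k. coeff p k = poch \<alpha> k / fact k * a k"
    and p: "zeros_in_unit p"
    and lam: "\<And>n. lam n = (\<Sum>k\<le>n. a k * real (n choose k))"
  shows "laguerre_multiplier_seq \<alpha> lam"
  unfolding laguerre_multiplier_seq_def
proof (intro exI[of _ "lag_mult \<alpha> a (degree p)"] conjI allI impI)
  have nD: "((\<lambda>g. - pderiv g) ^^ k) (f + g) = ((\<lambda>g. - pderiv g) ^^ k) f + ((\<lambda>g. - pderiv g) ^^ k) g"
    "((\<lambda>g. - pderiv g) ^^ k) (smult c f) = smult c (((\<lambda>g. - pderiv g) ^^ k) f)" for k c and f g :: "real poly"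
    by (induction k) (simp_all add: pderiv_add pderiv_smult)
  show "lag_mult \<alpha> a (degree p) (f + g) = lag_mult \<alpha> a (degree p) f + lag_mult \<alpha> a (degree p) g" for f g
    by (simp add: lag_mult_def nD lsub_add_right smult_add_right sum.distrib)
  show "lag_mult \<alpha> a (degree p) (smult c f) = smult c (lag_mult \<alpha> a (degree p) f)" for c f
    by (simp add: lag_mult_def nD lsub_smult_right smult_sum_right mult.commute)
  show "real_rooted f \<Longrightarrow> real_rooted (lag_mult \<alpha> a (degree p) f)" for f
    by (rule real_rooted_lag_mult[OF \<alpha> a p])
  fix n
  have a0: "a k = 0" if "k > degree p" for k
    using a[of k] that poch_pos[OF \<alpha>, of k] by (simp add: coeff_eq_0)
  have "lag_mult \<alpha> a (degree p) (laguerre \<alpha> n) = smult (\<Sum>k\<le>degree p. a k * real (n choose k)) (laguerre \<alpha> n)"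
    by (simp add: lag_mult_def lsub_laguerre_eigen[OF \<alpha>] smult_sum)
  also have "(\<Sum>k\<le>degree p. a k * real (n choose k)) = (\<Sum>k\<le>degree p + n. a k * real (n choose k))"
    by (rule sum.mono_neutral_left) (auto simp: a0)
  also have "\<dots> = lam n"
    unfolding lam by (rule sum.mono_neutral_right) (auto simp: binomial_eq_0)
  finally show "lag_mult \<alpha> a (degree p) (laguerre \<alpha> n) = smult (lam n) (laguerre \<alpha> n)" .
qed

section \<open>Real-rooted pencils\<close>

lemma tendsto_poly_leading:
  fixes f :: "'a::real_normed_field poly"
  assumes "degree f \<le> m"
  shows "((\<lambda>R::real. poly f (of_real R * z) / of_real R ^ m) \<longlongrightarrow> coeff f m * z ^ m) at_top"
proof -
  have pw: "((\<lambda>R::real. R ^ i / R ^ m) \<longlongrightarrow> (if i = m then 1 else 0)) at_top" if "i \<le> m" for i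
  proof -
    have "((\<lambda>R::real. inverse R ^ (m - i)) \<longlongrightarrow> 0 ^ (m - i)) at_top"
      by (intro tendsto_intros tendsto_inverse_0_at_top filterlim_ident)
    moreover have "eventually (\<lambda>R::real. inverse R ^ (m - i) = R ^ i / R ^ m) at_top"
    proof (rule eventually_mono[OF eventually_gt_at_top[of 0]])
      fix R :: real assume "R > 0"
      moreover have "R ^ m = R ^ i * R ^ (m - i)" using that by (simp add: power_add[symmetric])
      ultimately show "inverse R ^ (m - i) = R ^ i / R ^ m" by (simp add: field_simps)
    qed
    moreover have "(0::real) ^ (m - i) = (if i = m then 1 else 0)" using that by (auto simp: power_0_left)
    ultimately show ?thesis using tendsto_cong by fastforce
  qed
  have "((\<lambda>R::real. \<Sum>i\<le>m. coeff f i * z ^ i * of_real (R ^ i / R ^ m)) \<longlongrightarrow>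
      (\<Sum>i\<le>m. coeff f i * z ^ i * of_real (if i = m then 1 else 0))) at_top"
    by (intro tendsto_intros pw) auto
  moreover have "(\<Sum>i\<le>m. coeff f i * z ^ i * of_real (if i = m then 1 else 0)) = coeff f m * z ^ m"
  proof -
    have "(\<Sum>i\<le>m. coeff f i * z ^ i * of_real (if i = m then 1 else 0)) = (\<Sum>i\<le>m.
        if i = m then coeff f i * z ^ i else 0)"
      by (intro sum.cong) auto
    then show ?thesis by simp
  qed
  moreover have "(\<Sum>i\<le>m. coeff f i * z ^ i * of_real (R ^ i / R ^ m))
      = poly f (of_real R * z) / of_real R ^ m" for R :: real
    unfolding poly_as_sum_upto[OF assms] by (simp add: sum_divide_distrib power_mult_distrib mult_ac)
  ultimately show ?thesis by simp
qed

lemma coeff_mult_top: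
  fixes p q :: "'a::comm_semiring_0 poly"
  assumes "degree p \<le> m" "degree q \<le> n"
  shows "coeff (p * q) (m + n) = coeff p m * coeff q n"
proof -
  have "coeff (p * q) (m + n) = (\<Sum>i\<le>m + n. if i = m then coeff p m * coeff q n else 0)"
    unfolding coeff_mult
  proof (intro sum.cong refl)
    fix i assume "i \<in> {..m + n}"
    then consider "i = m" | "i > m" | "m + n - i > n" by fastforce
    then show "coeff p i * coeff q (m + n - i) = (if i = m then coeff p m * coeff q n else 0)"
      by cases (use assms in \<open>auto simp: coeff_eq_0\<close>)
  qed
  then show ?thesis by simp
qed

definition wronsk :: "real poly \<Rightarrow> real poly \<Rightarrow> real poly" where
  "wronsk u v = pderiv u * v - u * pderiv v"

text \<open>The two products have top coefficients n + 1 and n times the same number, and the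
  difference leaves it exactly once. A Wronskian of constant sign thus has the sign of this
  number.\<close>

lemma wronsk_lead:
  assumes u: "degree u \<le> Suc n" and v: "degree v \<le> n"
  shows "degree (wronsk u v) \<le> 2 * n" "coeff (wronsk u v) (2 * n) = coeff u (Suc n) * coeff v n"
proof -
  have du: "degree (pderiv u) \<le> n" using u by (simp add: degree_pderiv)
  have 1: "coeff (pderiv u * v) (2 * n) = real (Suc n) * coeff u (Suc n) * coeff v n"
    using coeff_mult_top[OF du v] by (simp add: mult_2 coeff_pderiv)
  have d1: "degree (pderiv u * v) \<le> 2 * n" using degree_mult_le[of "pderiv u" v] du v by simp
  have "degree (u * pderiv v) \<le> 2 * n \<and> coeff (u * pderiv v) (2 * n) = real n * coeff u (Suc n) * coeff v n"
  proof (cases n)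
    case 0
    then have "pderiv v = 0" using v by (simp add: pderiv_eq_0_iff)
    then show ?thesis using 0 by simp
  next
    case (Suc m)
    have dv: "degree (pderiv v) \<le> m" using v Suc by (simp add: degree_pderiv)
    have "coeff (u * pderiv v) (2 * n) = coeff u (Suc n) * coeff (pderiv v) m"
      using coeff_mult_top[OF u dv] Suc by (simp add: mult_2)
    moreover have "degree (u * pderiv v) \<le> 2 * n" using degree_mult_le[of u "pderiv v"] dv u Suc by simp
    ultimately show ?thesis using Suc by (simp add: coeff_pderiv)
  qed
  then show "degree (wronsk u v) \<le> 2 * n" "coeff (wronsk u v) (2 * n) = coeff u (Suc n) * coeff v n"
    using 1 d1 by (auto simp: wronsk_def algebra_simps intro!: degree_diff_le)
qed

lemma nonneg_poly_coeff:
  fixes W :: "real poly"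
  assumes "degree W \<le> m" "\<And>x. poly W x \<ge> 0"
  shows "coeff W m \<ge> 0"
proof (rule tendsto_lowerbound)
  show "((\<lambda>R. poly W (of_real R * 1) / of_real R ^ m) \<longlongrightarrow> coeff W m) at_top"
    using tendsto_poly_leading[OF assms(1), of 1] by simp
  show "\<forall>\<^sub>F R in at_top. 0 \<le> poly W (of_real R * 1) / of_real R ^ m"
    by (rule eventually_mono[OF eventually_gt_at_top[of 0]]) (use assms(2) in auto)
qed simp

text \<open>If every member of the pencil spanned by \<open>u, v\<close> is real-rooted, then \<open>u/v\<close> omits all real
  values on the upper half-plane, so \<open>Im (u/v)\<close>, which has the sign of \<open>Im (u cnj v)\<close>, has constant sign
      there. Its normal
  derivative on the real line is the Wronskian.\<close>

lemma pencil_sign: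
  assumes rr: "\<And>s. real_rooted (u + smult s v)" "real_rooted v"
    and nz: "v \<noteq> 0" "\<And>s. u + smult s v \<noteq> 0"
  obtains \<sigma> :: real where "\<sigma> = 1 \<or> \<sigma> = -1"
    "\<And>x. Im x > 0 \<Longrightarrow> \<sigma> * Im (poly (cpoly u) x * cnj (poly (cpoly v) x)) > 0"
    "\<And>x. \<sigma> * poly (wronsk u v) x \<ge> 0"
proof -
  define g where "g x = Im (poly (cpoly u) x * cnj (poly (cpoly v) x))" for x
  define H where "H = {x. Im x > 0}"
  have g0: "g x \<noteq> 0" if x: "x \<in> H" for x
  proof
    assume g: "g x = 0"
    define U V where "U = poly (cpoly u) x" and "V = poly (cpoly v) x"
    have V: "V \<noteq> 0" using real_rooted_no_zero[OF rr(2) nz(1), of x] x by (auto simp: H_def V_def)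
    define s where "s = - Re (U * cnj V) / (cmod V)\<^sup>2"
    have "U * cnj V = of_real (Re (U * cnj V))" using g by (simp add: g_def U_def V_def complex_eq_iff)
    then have "(U + of_real s * V) * cnj V = of_real (Re (U * cnj V)) + of_real s * of_real ((cmod V)\<^sup>2)"
      by (simp add: distrib_right mult.assoc complex_norm_square[symmetric])
    also have "\<dots> = of_real (Re (U * cnj V) + s * (cmod V)\<^sup>2)" by simp
    also have "Re (U * cnj V) + s * (cmod V)\<^sup>2 = 0" using V by (simp add: s_def)
    finally have "U + of_real s * V = 0" using V by simp
    then have "poly (cpoly (u + smult s v)) x = 0" by (simp add: cpoly_add cpoly_smult U_def V_def)
    then show False using real_rooted_no_zero[OF rr(1) nz(2), of x] x by (auto simp: H_def)
  qed
  have "connected (g ` H)"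
    unfolding g_def H_def
    by (intro connected_continuous_image continuous_intros convex_connected convex_halfspace_Im_gt)
  then have conn: "z \<in> g ` H" if "x \<in> g ` H" "y \<in> g ` H" "x \<le> z" "z \<le> y" for x y z
    using that connected_iff_interval by metis
  have no0: "0 \<notin> g ` H" using g0 by auto
  obtain \<sigma> :: real where \<sigma>: "\<sigma> = 1 \<or> \<sigma> = -1" "\<And>x. x \<in> H \<Longrightarrow> \<sigma> * g x > 0"
  proof (cases "g \<i> > 0")
    case True
    have "g x > 0" if "x \<in> H" for x
    proof (rule ccontr)
      assume "\<not> g x > 0"
      then have "0 \<in> g ` H" using conn[of "g x" "g \<i>" 0] that True by (auto simp: H_def)
      then show False using no0 by simp
    qed
    then show ?thesis using that[of 1] by simp
  next
    case False
    have "g x < 0" if "x \<in> H" for x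
    proof (rule ccontr)
      assume "\<not> g x < 0"
      then have "0 \<in> g ` H" using conn[of "g \<i>" "g x" 0] that False by (auto simp: H_def)
      then show False using no0 by simp
    qed
    then show ?thesis using that[of "-1"] by simp
  qed
  have "\<sigma> * poly (wronsk u v) x0 \<ge> 0" for x0
  proof (rule ccontr)
    assume neg: "\<not> \<sigma> * poly (wronsk u v) x0 \<ge> 0"
    \<comment> \<open>\<open>h\<close> follows Im (u cnj v) along the vertical line through x0, with
      the conjugate moved into the argument to make it differentiable. It vanishes at 0 and has the
      Wronskian as derivative there, so a wrong sign would show just above the axis.\<close>
    define h where "h t = Im (poly (cpoly u) (of_real x0
        + \<i> * of_real t) * poly (cpoly v) (of_real x0 - \<i> * of_real t))" for t
    have hg: "h t = g (of_real x0 + \<i> * of_real t)" for t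
      unfolding h_def g_def poly_cpoly_cnj[symmetric] by simp
    have l1: "((\<lambda>t::real. of_real x0 + \<i> * of_real t) has_vector_derivative \<i>) (at 0)"
      "((\<lambda>t::real. of_real x0 - \<i> * of_real t) has_vector_derivative -\<i>) (at 0)"
      by (auto intro!: derivative_eq_intros)
    have c: "((\<lambda>t. poly (cpoly f) (of_real x0 + k * of_real t)) has_vector_derivative k * of_real (poly
        (pderiv f) x0)) (at 0)"
      if "((\<lambda>t::real. of_real x0 + k * of_real t) has_vector_derivative k) (at 0)" for f k
    proof -
      have "(poly (cpoly f) has_field_derivative of_real (poly (pderiv f) x0)) (at (of_real x0
          + k * of_real 0))"
        using poly_DERIV[of "cpoly f" "of_real x0"] by (simp add: cpoly_pderiv[symmetric] poly_cpoly_of_real)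
      from field_vector_diff_chain_at[OF that this] show ?thesis by (simp add: o_def)
    qed
    have "((\<lambda>t. poly (cpoly u) (of_real x0 + \<i> * of_real t) * poly (cpoly v) (of_real x0 - \<i> * of_real t))
        has_vector_derivative (\<i> * of_real (poly (wronsk u v) x0))) (at 0)"
      using has_vector_derivative_mult[OF c[of \<i> u] c[of "-\<i>" v]] l1
      by (simp add: poly_cpoly_of_real wronsk_def algebra_simps)
    then have "(h has_real_derivative poly (wronsk u v) x0) (at 0)"
      unfolding h_def has_real_derivative_iff_has_vector_derivative
      using bounded_linear.has_vector_derivative[OF bounded_linear_Im] by fastforce
    then have "((\<lambda>t. \<sigma> * h t) has_real_derivative \<sigma> * poly (wronsk u v) x0) (at 0)"
      by (rule DERIV_cmult)
    then obtain d where d: "d > 0" "\<And>t. t > 0 \<Longrightarrow> t < d \<Longrightarrow> \<sigma> * h (0 + t) < \<sigma> * h 0"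
      using DERIV_neg_dec_right[of "\<lambda>t. \<sigma> * h t" _ 0] neg by (metis not_le)
    have "h 0 = 0" by (simp add: h_def poly_cpoly_of_real)
    then have "\<sigma> * h (d / 2) < 0" using d(1) d(2)[of "d / 2"] by simp
    moreover have "\<sigma> * h (d / 2) > 0" unfolding hg by (rule \<sigma>(2)) (use d(1) in \<open>simp add: H_def\<close>)
    ultimately show False by simp
  qed
  then show ?thesis using that[of \<sigma>] \<sigma> by (simp add: H_def g_def)
qed

text \<open>The undetermined sign of \<open>pencil_sign\<close> is fixed by the leading coefficient
  of the Wronskian, which must share the sign of the whole polynomial.\<close>

lemma pencil_lead:
  assumes rr: "\<And>s. real_rooted (u + smult s v)" "real_rooted v"
    and u: "degree u \<le> Suc n" and v: "degree v \<le> n"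
    and lc: "coeff u (Suc n) * coeff v n \<noteq> 0"
  shows "Im x > 0 \<Longrightarrow> coeff u (Suc n) * coeff v n * Im (poly (cpoly u) x * cnj (poly (cpoly v) x)) > 0"
    and "coeff u (Suc n) * coeff v n * poly (wronsk u v) y \<ge> 0"
proof -
  have v0: "v \<noteq> 0" using lc by auto
  have "coeff (u + smult s v) (Suc n) = coeff u (Suc n)" for s using v by (simp add: coeff_eq_0)
  then have u0: "u + smult s v \<noteq> 0" for s using lc by (metis coeff_0 mult_zero_left)
  obtain \<sigma> :: real where \<sigma>: "\<sigma> = 1 \<or> \<sigma> = -1"
    "\<And>x. Im x > 0 \<Longrightarrow> \<sigma> * Im (poly (cpoly u) x * cnj (poly (cpoly v) x)) > 0"
    "\<And>x. \<sigma> * poly (wronsk u v) x \<ge> 0"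
    using pencil_sign[OF rr v0 u0] by blast
  have "coeff (smult \<sigma> (wronsk u v)) (2 * n) \<ge> 0"
    by (rule nonneg_poly_coeff) (use \<sigma>(1,3) wronsk_lead(1)[OF u v] in auto)
  then have "\<sigma> * (coeff u (Suc n) * coeff v n) \<ge> 0" by (simp add: wronsk_lead(2)[OF u v])
  moreover have "\<sigma> * (coeff u (Suc n) * coeff v n) \<noteq> 0" using lc \<sigma>(1) by auto
  ultimately have pos: "\<sigma> * (coeff u (Suc n) * coeff v n) > 0" by linarith
  define c where "c = coeff u (Suc n) * coeff v n"
  have c: "c = (c * \<sigma>) * \<sigma>" "c * \<sigma> > 0" using \<sigma>(1) pos by (auto simp: c_def mult.commute)
  show "Im x > 0 \<Longrightarrow> coeff u (Suc n) * coeff v n * Im (poly (cpoly u) x * cnj (poly (cpoly v) x)) > 0"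
    using \<sigma>(2)[of x] c unfolding c_def[symmetric] by (metis mult.assoc mult_pos_pos)
  show "coeff u (Suc n) * coeff v n * poly (wronsk u v) y \<ge> 0"
    using \<sigma>(3)[of y] c unfolding c_def[symmetric] by (metis mult.assoc mult_nonneg_nonneg less_imp_le)
qed

text \<open>Along the ray through z of modulus 1, Im (u cnj v) grows like a constant times Im (z^d),
  d being the degree gap. For d \<ge> 2 this changes sign inside the upper half-plane, against
  \<open>pencil_sign\<close>.\<close>

lemma pencil_degree_gap:
  assumes rr: "\<And>s. real_rooted (u + smult s v)" "real_rooted v"
    and v0: "v \<noteq> 0" and gap: "degree u \<ge> degree v + 2"
  shows False
proof -
  define k j d where "k = degree u" and "j = degree v" and "d = degree u - degree v"
  have d: "d \<ge> 2" "k = j + d" using gap by (auto simp: d_def k_def j_def)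
  have u0: "u \<noteq> 0" using gap by auto
  have "coeff (u + smult s v) k = coeff u k" for s using gap by (simp add: coeff_eq_0 k_def)
  then have us: "u + smult s v \<noteq> 0" for s using u0 by (metis coeff_0 k_def leading_coeff_0_iff)
  define g where "g x = Im (poly (cpoly u) x * cnj (poly (cpoly v) x))" for x
  obtain \<sigma> :: real where \<sigma>: "\<sigma> = 1 \<or> \<sigma> = -1" "\<And>x. Im x > 0 \<Longrightarrow> \<sigma> * g x > 0"
    using pencil_sign[OF rr v0 us] unfolding g_def by metis
  define c where "c = lead_coeff u * lead_coeff v"
  have c0: "c \<noteq> 0" using u0 v0 by (simp add: c_def)
  have lim: "\<sigma> * c * Im (z ^ d) \<ge> 0" if z: "Im z > 0" "cmod z = 1" for z
  proof (rule tendsto_lowerbound)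
    have zz: "z ^ j * cnj z ^ j = 1"
      using z(2) by (simp add: power_mult_distrib[symmetric] complex_norm_square[symmetric])
    have l: "((\<lambda>R::real. Im ((poly (cpoly u) (of_real R * z) / of_real R ^ k) * cnj (poly (cpoly v) (of_real
        R * z) / of_real R ^ j)))
       \<longlongrightarrow> Im (coeff (cpoly u) k * z ^ k * cnj (coeff (cpoly v) j * z ^ j))) at_top"
      by (intro tendsto_intros tendsto_poly_leading) (simp_all add: degree_cpoly k_def j_def)
    have e1: "coeff (cpoly u) k * z ^ k * cnj (coeff (cpoly v) j * z ^ j) = of_real c * z ^ d"
    proof -
      have "coeff (cpoly u) k * z ^ k * cnj (coeff (cpoly v) j * z ^ j)
          = of_real c * z ^ d * (z ^ j * cnj z ^ j)"
        by (simp add: coeff_map_poly c_def k_def[symmetric] j_def[symmetric] d(2) power_add)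
      then show ?thesis by (simp add: zz)
    qed
    have e2: "Im ((poly (cpoly u) (of_real R * z) / of_real R ^ k) * cnj (poly (cpoly v) (of_real R * z) /
        of_real R ^ j)) =
        g (of_real R * z) / R ^ (k + j)" for R
    proof -
      have "(poly (cpoly u) (of_real R * z) / of_real R ^ k) * cnj (poly (cpoly v) (of_real R * z) / of_real
          R ^ j) =
        (poly (cpoly u) (of_real R * z) * cnj (poly (cpoly v) (of_real R * z))) / of_real (R ^ (k + j))"
        by (simp add: power_add)
      then show ?thesis unfolding g_def by (simp only: Im_divide_of_real)
    qed
    have e3: "Im (of_real c * z ^ d) = c * Im (z ^ d)" by simp
    have "((\<lambda>R. g (of_real R * z) / R ^ (k + j)) \<longlongrightarrow> c * Im (z ^ d)) at_top"
      using l unfolding e1 e2 e3 .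
    then show "((\<lambda>R. \<sigma> * (g (of_real R * z) / R ^ (k + j))) \<longlongrightarrow> \<sigma> * c * Im (z ^ d)) at_top"
      unfolding mult.assoc by (rule tendsto_mult_left)
    show "\<forall>\<^sub>F R in at_top. 0 \<le> \<sigma> * (g (of_real R * z) / R ^ (k + j))"
    proof (rule eventually_mono[OF eventually_gt_at_top[of 0]])
      fix R :: real assume "0 < R"
      then have "\<sigma> * g (of_real R * z) > 0" "R ^ (k + j) > 0" using \<sigma>(2)[of "of_real R * z"] z(1) by simp_all
      then have "0 \<le> (\<sigma> * g (of_real R * z)) / R ^ (k + j)" by simp
      then show "0 \<le> \<sigma> * (g (of_real R * z) / R ^ (k + j))" by simp
    qed
  qed simp
  \<comment> \<open>The d-th powers of \<open>z 1\<close> and \<open>z 3\<close> are i and -i, and d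
    \<ge> 2 keeps both angles below pi.\<close>
  define z where "z m = cis (real m * pi / (2 * real d))" for m
  have zd: "z m ^ d = cis (real m * (pi / 2))" for m
    unfolding z_def Complex.DeMoivre using d(1) by simp
  have "3 * pi / (2 * real d) < pi" using d(1) by (simp add: divide_less_eq)
  then have "Im (z 1) > 0" "Im (z 3) > 0"
    using d(1) by (auto simp: z_def intro!: sin_gt_zero divide_pos_pos simp: divide_less_eq)
  then have "\<sigma> * c * Im (z 1 ^ d) \<ge> 0" "\<sigma> * c * Im (z 3 ^ d) \<ge> 0"
    using lim[of "z 1"] lim[of "z 3"] by (auto simp: z_def)
  moreover have "Im (z 1 ^ d) = 1" unfolding zd by simp
  moreover have "real 3 * (pi / 2) = 3 / 2 * pi" by simp
  then have "Im (z 3 ^ d) = -1" unfolding zd cis.sel by (simp only: sin_3over2_pi)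
  ultimately show False using c0 \<sigma>(1) by auto
qed

section \<open>Perturbation of simple roots\<close>

text \<open>The differentiated Laguerre equations form a recursion for the derivatives at r, with r
  > 0 in front of the highest one. A double root would make all derivatives vanish, including the
  n-th, which is a nonzero constant.\<close>

lemma laguerre_simple_root:
  assumes \<alpha>: "\<alpha> > -1" and r: "poly (laguerre \<alpha> n) r = 0"
  shows "poly (pderiv (laguerre \<alpha> n)) r \<noteq> 0"
proof
  assume r': "poly (pderiv (laguerre \<alpha> n)) r = 0"
  define L where "L = laguerre \<alpha> n"
  have r0: "r > 0" using laguerre_root_pos[OF \<alpha>, of n "of_real r"] r by (simp add: poly_cpoly_of_real)
  have ode: "[:0, 1:] * (pderiv ^^ Suc (Suc j)) L + [:\<alpha> + 1 + real j, -1:] * (pderiv ^^ Suc j) L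
      + smult (real n - real j) ((pderiv ^^ j) L) = 0" for j
  proof (induction j)
    case 0
    then show ?case using laguerre_ode[OF \<alpha>, of n] by (simp add: L_def)
  next
    case (Suc j)
    have "pderiv ([:0, 1:] * (pderiv ^^ Suc (Suc j)) L + [:\<alpha> + 1 + real j, -1:] * (pderiv ^^ Suc j) L
      + smult (real n - real j) ((pderiv ^^ j) L)) = 0" by (simp only: Suc.IH pderiv_0)
    moreover have "pderiv ([:0, 1:] * (pderiv ^^ Suc (Suc j)) L + [:\<alpha> + 1 + real j, -1:] * (pderiv ^^ Suc j) L
      + smult (real n - real j) ((pderiv ^^ j) L)) =
      [:0, 1:] * (pderiv ^^ Suc (Suc (Suc j))) L + [:\<alpha> + 1 + real (Suc j), -1:] * (pderiv ^^ Suc (Suc j)) L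
      + smult (real n - real (Suc j)) ((pderiv ^^ Suc j) L)"
      unfolding pderiv_add pderiv_mult pderiv_smult funpow.simps o_apply
      by (intro poly_eq_poly_eq_iff[THEN iffD1] ext) (simp add: pderiv_pCons algebra_simps)
    ultimately show ?case by simp
  qed
  have "poly ((pderiv ^^ j) L) r = 0 \<and> poly ((pderiv ^^ Suc j) L) r = 0" for j
  proof (induction j)
    case 0
    then show ?case using r r' by (simp add: L_def)
  next
    case (Suc j)
    have "poly ([:0, 1:] * (pderiv ^^ Suc (Suc j)) L + [:\<alpha> + 1 + real j, -1:] * (pderiv ^^ Suc j) L
      + smult (real n - real j) ((pderiv ^^ j) L)) r = 0" by (simp only: ode poly_0)
    then have "r * poly ((pderiv ^^ Suc (Suc j)) L) r = 0"
      using Suc unfolding poly_add poly_mult poly_smult by simp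
    then show ?case using r0 Suc by simp
  qed
  then have "poly ((pderiv ^^ n) L) r = 0" by blast
  moreover have "degree ((pderiv ^^ n) L) = 0" using \<alpha> by (simp add: degree_higher_pderiv L_def)
  then have "(pderiv ^^ n) L = [:coeff ((pderiv ^^ n) L) 0:]" by (rule degree_0_id[symmetric])
  ultimately have "coeff ((pderiv ^^ n) L) 0 = 0" by (metis poly_const_conv)
  then have "fact n * coeff L n = 0" by (simp add: coeff_higher_pderiv pochhammer_fact)
  then show False using lead_coeff_laguerre[OF \<alpha>, of n] by (simp add: L_def)
qed

lemma card_roots_simple:
  assumes f: "real_rooted f" "f \<noteq> 0" and simple: "\<And>r. poly f r = 0 \<Longrightarrow> poly (pderiv f) r \<noteq> 0"
  shows "card {r. poly f r = 0} = degree f"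
proof -
  obtain A where A: "f = smult (lead_coeff f) (\<Prod>x\<in>#A. [:-x, 1:])" "size A = degree f"
    using real_rooted_decompose[OF f] by blast
  obtain c where c: "f = smult c (\<Prod>x\<in>#A. [:-x, 1:])" using A(1) by blast
  then have c0: "c \<noteq> 0" using f(2) by auto
  have roots: "{r. poly f r = 0} = set_mset A"
    using c0 by (auto simp: c poly_prod_mset prod_mset_zero_iff)
  have "count A r \<le> 1" for r
  proof (rule ccontr)
    assume "\<not> count A r \<le> 1"
    then have "{#r, r#} \<subseteq># A" by (simp add: subseteq_mset_def)
    then obtain B where "A = {#r, r#} + B" by (metis subset_mset.add_diff_inverse)
    then have "f = [:-r, 1:] * ([:-r, 1:] * smult c (\<Prod>x\<in>#B. [:-x, 1:]))"
      by (simp add: c del: mult_pCons_left)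
    then obtain g where g: "f = [:-r, 1:] * ([:-r, 1:] * g)" by blast
    have "poly f r = 0" "poly (pderiv f) r = 0"
      unfolding g pderiv_mult by simp_all
    then show False using simple by blast
  qed
  then have "A = mset_set (set_mset A)"
    by (intro multiset_eqI) (metis count_mset_set(1,3) finite_set_mset le_antisym not_in_iff
        count_greater_eq_one_iff)
  then have "size A = card (set_mset A)" by (metis size_mset_set)
  then show ?thesis using A(2) roots by simp
qed

lemma real_rooted_if_card:
  assumes "g \<noteq> 0" "degree g \<le> card Z" "finite Z" "\<And>z. z \<in> Z \<Longrightarrow> poly g z = 0"
  shows "real_rooted g"
proof -
  have fin: "finite {z. poly (cpoly g) z = 0}" using assms(1)
      by (intro poly_roots_finite) (simp add: cpoly_eq_0_iff)
  have sub: "complex_of_real ` Z \<subseteq> {z. poly (cpoly g) z = 0}" using assms(4) by (auto simp: poly_cpoly_of_real)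
  have "card {z. poly (cpoly g) z = 0} \<le> degree g"
    using card_poly_roots_bound[of "cpoly g"] assms(1) by (simp add: degree_cpoly cpoly_eq_0_iff)
  also have "\<dots> \<le> card (complex_of_real ` Z)" using assms(2) by (simp add: card_image inj_on_def)
  finally have eq: "complex_of_real ` Z = {z. poly (cpoly g) z = 0}"
    using card_seteq[OF fin sub] by simp
  show ?thesis unfolding real_rooted_def
  proof (intro disjI2 allI impI)
    fix z assume "poly (cpoly g) z = 0"
    then have "z \<in> complex_of_real ` Z" using eq by blast
    then show "z \<in> \<real>" by auto
  qed
qed

text \<open>\<open>f\<close> changes sign across each root on disjoint intervals of radius d. These
  sign changes persist for small e, and since the degree does not grow, the roots they produce are
  all the roots.\<close>

lemma simple_roots_perturb:
  assumes f: "f \<noteq> 0" "card {r. poly f r = 0} = degree f"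
    and simple: "\<And>r. poly f r = 0 \<Longrightarrow> poly (pderiv f) r \<noteq> 0"
    and q: "degree q \<le> degree f"
  obtains e where "e \<noteq> 0" "real_rooted (f + smult e q)"
proof (cases "degree f = 0")
  case True
  then have "real_rooted (f + smult 1 q)" using q degree_add_le[of f 0 q] by (simp add: real_rooted_def)
  then show ?thesis using that[of 1] by simp
next
  case False
  define Z where "Z = {r. poly f r = 0}"
  have fin: "finite Z" using f by (simp add: Z_def poly_roots_finite)
  have sgn: "eventually (\<lambda>d. poly f (r - d) * poly f (r + d) < 0) (at_right 0)" if "r \<in> Z" for r
  proof -
    have fr: "poly f r = 0" using that by (simp add: Z_def)
    then obtain g where g: "f = [:-r, 1:] * g" by (meson dvdE poly_eq_0_iff_dvd)
    have "poly (pderiv f) r = poly g r" unfolding g pderiv_mult by (simp add: pderiv_pCons)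
    then have gr: "poly g r \<noteq> 0" using simple[OF fr] by simp
    have "((\<lambda>d. poly g (r - d) * poly g (r + d)) \<longlongrightarrow> poly g (r - 0) * poly g (r + 0)) (at_right 0)"
      by (intro tendsto_intros tendsto_poly) 
    moreover have "poly g (r - 0) * poly g (r + 0) > 0" using gr
        by (simp add: not_sum_power2_lt_zero zero_less_mult_iff) linarith
    ultimately have "eventually (\<lambda>d. poly g (r - d) * poly g (r + d) > 0) (at_right 0)"
      by (rule order_tendstoD(1))
    then show ?thesis using eventually_at_right_less
    proof eventually_elim
      case (elim d)
      have "poly f (r - d) * poly f (r + d) = - (d * d) * (poly g (r - d) * poly g (r + d))"
        by (simp add: g algebra_simps)
      then show ?case using elim by (simp add: mult_pos_neg mult_less_0_iff)
    qed
  qed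
  have "eventually (\<lambda>d. \<forall>r\<in>Z. poly f (r - d) * poly f (r + d) < 0) (at_right 0)"
    using sgn by (simp add: eventually_ball_finite[OF fin])
  moreover have "eventually (\<lambda>d. \<forall>r\<in>Z. \<forall>s\<in>Z. r \<noteq> s \<longrightarrow> 2 * d < \<bar>r - s\<bar>) (at_right 0)"
  proof (intro eventually_ball_finite[OF fin] ballI)
    fix r s assume "r \<in> Z" "s \<in> Z"
    have "eventually (\<lambda>d. d < \<bar>r - s\<bar> / 2) (at_right 0)" if "r \<noteq> s"
      using that by (intro eventually_at_right_field[THEN iffD2] exI[of _ "\<bar>r - s\<bar> / 2"]) auto
    then show "eventually (\<lambda>d. r \<noteq> s \<longrightarrow> 2 * d < \<bar>r - s\<bar>) (at_right 0)"
      by (cases "r = s") (auto elim: eventually_mono)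
  qed
  moreover have "eventually (\<lambda>d. d > 0) (at_right (0::real))" by (rule eventually_at_right_less)
  ultimately have "eventually (\<lambda>d. d > 0 \<and> (\<forall>r\<in>Z. poly f (r - d) * poly f (r + d) < 0) \<and>
      (\<forall>r\<in>Z. \<forall>s\<in>Z. r \<noteq> s \<longrightarrow> 2 * d < \<bar>r - s\<bar>)) (at_right 0)"
    by eventually_elim blast
  from eventually_happens'[OF trivial_limit_at_right_real this] obtain d where d: "d > 0" "\<And>r. r \<in> Z \<Longrightarrow> poly
      f (r - d) * poly f (r + d) < 0"
      "\<And>r s. r \<in> Z \<Longrightarrow> s \<in> Z \<Longrightarrow> r \<noteq> s \<Longrightarrow> 2 * d < \<bar>r - s\<bar>"
    by blast
  have "eventually (\<lambda>e. poly (f + smult e q) (r - d) * poly (f + smult e q) (r + d) < 0) (at_right 0)"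
      if "r \<in> Z" for r
  proof -
    have "((\<lambda>e. poly (f + smult e q) (r - d) * poly (f + smult e q) (r + d)) \<longlongrightarrow>
        (poly f (r - d) + 0 * poly q (r - d)) * (poly f (r + d) + 0 * poly q (r + d))) (at_right 0)"
      unfolding poly_add poly_smult by (intro tendsto_intros)
    then show ?thesis by (rule order_tendstoD(2)) (use d(2)[OF that] in simp)
  qed
  then have "eventually (\<lambda>e. \<forall>r\<in>Z. poly (f + smult e q) (r - d) * poly (f + smult e q) (r
      + d) < 0) (at_right 0)"
    by (simp add: eventually_ball_finite[OF fin])
  moreover have "eventually (\<lambda>e. e > 0) (at_right (0::real))" by (rule eventually_at_right_less)
  ultimately have "eventually (\<lambda>e. e > 0 \<and> (\<forall>r\<in>Z. poly (f + smult e q) (r - d) * poly (f + smult e q) (r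
      + d) < 0)) (at_right 0)"
    by eventually_elim blast
  from eventually_happens'[OF trivial_limit_at_right_real this] obtain e where e: "e > 0" "\<And>r. r \<in> Z \<Longrightarrow> poly
      (f + smult e q) (r - d) * poly (f + smult e q) (r + d) < 0"
    by blast
  define g where "g = f + smult e q"
  have "\<exists>x. r - d < x \<and> x < r + d \<and> poly g x = 0" if "r \<in> Z" for r
    using poly_IVT[of "r - d" "r + d" g] d(1) e(2)[OF that] by (auto simp: g_def)
  then obtain \<rho> where \<rho>: "\<And>r. r \<in> Z \<Longrightarrow> r - d < \<rho> r \<and> \<rho> r < r + d \<and> poly g (\<rho> r) = 0" by metis
  have inj: "inj_on \<rho> Z"
  proof (rule inj_onI, rule ccontr)
    fix r s assume rs: "r \<in> Z" "s \<in> Z" "\<rho> r = \<rho> s" "r \<noteq> s"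
    then show False using \<rho>[of r] \<rho>[of s] d(3)[of r s] by linarith
  qed
  have card: "card (\<rho> ` Z) = degree f" using inj f(2) by (simp add: card_image Z_def)
  obtain r where "r \<in> Z" using False f(2) by (metis Z_def card.empty ex_in_conv)
  then have g0: "g \<noteq> 0" using e(2)[of r] unfolding g_def[symmetric] by auto
  have "degree g \<le> degree f" unfolding g_def using q by (intro degree_add_le order.trans[OF
      degree_smult_le]) auto
  then have "real_rooted g" using \<rho> fin card by (intro real_rooted_if_card[OF g0, of "\<rho> ` Z"]) auto
  then show ?thesis using that[of e] e(1) by (simp add: g_def)
qed

section \<open>Necessity\<close>

locale lag_multiplier =
  fixes \<alpha> :: real and a lam :: "nat \<Rightarrow> real" and T :: "real poly \<Rightarrow> real poly"
  assumes alpha: "\<alpha> > -1"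
    and lam: "\<And>n. lam n = (\<Sum>k\<le>n. a k * real (n choose k))"
    and T_add: "\<And>p q. T (p + q) = T p + T q"
    and T_smult: "\<And>c p. T (smult c p) = smult c (T p)"
    and T_lag: "\<And>n. T (laguerre \<alpha> n) = smult (lam n) (laguerre \<alpha> n)"
    and T_rr: "\<And>p. real_rooted p \<Longrightarrow> real_rooted (T p)"
begin

lemma T_0 [simp]: "T 0 = 0"
  using T_smult[of 0 0] by simp

lemma T_sum: "T (sum f A) = (\<Sum>i\<in>A. T (f i))"
  by (induction A rule: infinite_finite_induct) (simp_all add: T_add)

text \<open>\<open>L_n + e q\<close> is real-rooted for small \<open>e\<close>, and \<open>T\<close> maps it to \<open>e T q\<close>.\<close>

lemma T_real_rooted_of_zero:
  assumes n: "lam n = 0" and q: "degree q \<le> n"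
  shows "real_rooted (T q)"
proof -
  define L where "L = laguerre \<alpha> n"
  have simple: "\<And>r. poly L r = 0 \<Longrightarrow> poly (pderiv L) r \<noteq> 0"
    using laguerre_simple_root[OF alpha] by (simp add: L_def)
  have L0: "L \<noteq> 0" "real_rooted L" "degree L = n" using alpha by (simp_all add: L_def real_rooted_laguerre)
  obtain e where e: "e \<noteq> 0" "real_rooted (L + smult e q)"
    using simple_roots_perturb[OF L0(1) card_roots_simple[OF L0(2,1) simple] simple, of q] q L0(3) by blast
  have "T (L + smult e q) = smult e (T q)" by (simp add: T_add T_smult L_def T_lag n)
  then have "real_rooted (smult (1 / e) (smult e (T q)))" using T_rr[OF e(2)] real_rooted_smult by metis
  then show ?thesis using e(1) by simp
qed

text \<open>Nontriviality yields nonzero \<open>lam i\<close> and \<open>lam k\<close> with k \<ge>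
  i + 2. If \<open>lam n = 0\<close> for some n \<ge> k, \<open>T\<close> would give real-rooted
  images of everything of degree at most n, hence all combinations of L_k and L_i would be
  real-rooted, contrary to \<open>pencil_degree_gap\<close>.\<close>

lemma lam_eventually_nonzero:
  assumes "\<not> trivial_seq lam"
  obtains n0 where "\<And>n. n \<ge> n0 \<Longrightarrow> lam n \<noteq> 0"
proof -
  have nt: "\<exists>n. n \<notin> {k, Suc k} \<and> lam n \<noteq> 0" for k using assms by (auto simp: trivial_seq_def)
  define i where "i = (LEAST n. lam n \<noteq> 0)"
  have i: "lam i \<noteq> 0" using nt[of 0] LeastI[of "\<lambda>n. lam n \<noteq> 0"] by (auto simp: i_def)
  obtain k where k: "k \<notin> {i, Suc i}" "lam k \<noteq> 0" using nt by blast
  have "i \<le> k" using k(2) by (simp add: i_def Least_le)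
  then have gap: "k \<ge> i + 2" using k(1) by (simp) 
  have "lam n \<noteq> 0" if n: "n \<ge> k" for n
  proof
    assume z: "lam n = 0"
    have *: "real_rooted (smult c (laguerre \<alpha> k) + smult s (laguerre \<alpha> i))" for c s
    proof -
      have "T (smult (c / lam k) (laguerre \<alpha> k) + smult (s / lam i) (laguerre \<alpha> i)) =
          smult c (laguerre \<alpha> k) + smult s (laguerre \<alpha> i)"
        using i k(2) by (simp add: T_add T_smult T_lag)
      moreover have "degree (smult (c / lam k) (laguerre \<alpha> k) + smult (s / lam i) (laguerre \<alpha> i)) \<le> n"
        using alpha gap n by (intro degree_add_le order.trans[OF degree_smult_le]) auto
      ultimately show ?thesis using T_real_rooted_of_zero[OF z] by metis
    qed
    show False
      by (rule pencil_degree_gap[of "laguerre \<alpha> k" "laguerre \<alpha> i"])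
        (use *[of 1] *[of 0 1] alpha gap in auto)
  qed
  then show ?thesis using that by blast
qed

end

section \<open>The matrix of the multiplier and the images of powers of x + z\<close>

definition appell :: "(nat \<Rightarrow> real) \<Rightarrow> nat \<Rightarrow> real poly" where
  "appell c n = (\<Sum>k\<le>n. monom (real (n choose k) * c k) (n - k))"

lemma poly_appell: "poly (appell c n) z = (\<Sum>k\<le>n. real (n choose k) * c k * z ^ (n - k))"
  by (simp add: appell_def poly_sum poly_monom)

lemma coeff_appell: "coeff (appell c n) i = (if i \<le> n then real (n choose i) * c (n - i) else 0)"
proof -
  have "coeff (appell c n) i = (\<Sum>k\<le>n. if k = n - i \<and> i \<le> n then real (n choose k) * c k else 0)"
    unfolding appell_def coeff_sum by (intro sum.cong) auto
  also have "\<dots> = (if i \<le> n then real (n choose (n - i)) * c (n - i) else 0)"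
    by (cases "i \<le> n") simp_all
  finally show ?thesis using binomial_symmetric[of i n] by simp
qed

text \<open>The Appell property; through it \<open>rayleigh\<close> replaces index n by a derivative
  at index n + 1.\<close>

lemma pderiv_appell: "pderiv (appell c (Suc n)) = smult (real (Suc n)) (appell c n)"
proof (rule poly_eqI)
  fix i
  have "real (Suc i) * real (Suc n choose Suc i) = real (Suc n) * real (n choose i)"
    using Suc_times_binomial_eq[of n i] by (metis mult.commute of_nat_mult)
  then show "coeff (pderiv (appell c (Suc n))) i = coeff (smult (real (Suc n)) (appell c n)) i"
    by (simp add: coeff_pderiv coeff_appell mult.assoc[symmetric] del: of_nat_Suc)
qed

lemma degree_appell_le: "degree (appell c n) \<le> n"
  by (rule degree_le) (simp add: coeff_appell)

context lag_multiplier
begin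

definition tcoeff :: "nat \<Rightarrow> nat \<Rightarrow> real" where
  "tcoeff i k = coeff (T (monom 1 k)) i"

lemma coeff_T:
  assumes "degree q \<le> n"
  shows "coeff (T q) i = (\<Sum>k\<le>n. coeff q k * tcoeff i k)"
proof -
  have "q = (\<Sum>k\<le>n. monom (coeff q k) k)" using assms by (simp add: poly_as_sum_of_monoms')
  also have "\<dots> = (\<Sum>k\<le>n. smult (coeff q k) (monom 1 k))" by (simp add: smult_monom)
  finally have "T q = (\<Sum>k\<le>n. smult (coeff q k) (T (monom 1 k)))"
      by (metis (no_types, lifting) T_smult T_sum sum.cong)
  then show ?thesis by (simp add: coeff_sum tcoeff_def)
qed

lemma tcoeff_eq:
  "(\<Sum>k\<le>n. coeff (laguerre \<alpha> n) k * tcoeff i k) = lam n * coeff (laguerre \<alpha> n) i"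
  using coeff_T[of "laguerre \<alpha> n" n i] alpha by (simp add: T_lag)

text \<open>The matrix of Laguerre coefficients is triangular with nonzero diagonal. A proposed
  formula for the matrix of \<open>T\<close> need therefore only be tested against the eigenvalue
  relation \<open>tcoeff_eq\<close>.\<close>

lemma triangular_unique:
  assumes "\<And>n. (\<Sum>k\<le>n. coeff (laguerre \<alpha> n) k * g k) = (\<Sum>k\<le>n. coeff (laguerre \<alpha> n) k * h k)"
  shows "g n = h n"
proof (induction n rule: less_induct)
  case (less n)
  have "(\<Sum>k\<le>n. coeff (laguerre \<alpha> n) k * f k) = (\<Sum>k<n. coeff (laguerre \<alpha> n) k * f k)
      + coeff (laguerre \<alpha> n) n * f n" for f
    by (simp add: lessThan_Suc_atMost[symmetric])
  then have "coeff (laguerre \<alpha> n) n * g n = coeff (laguerre \<alpha> n) n * h n" using assms[of n] less by simp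
  then show ?case using lead_coeff_laguerre[OF alpha, of n] by simp
qed

lemma tcoeff_lead: "j \<le> i \<Longrightarrow> tcoeff i j = (if j = i then lam i else 0)"
proof (induction j rule: less_induct)
  case (less j)
  have "(\<Sum>k\<le>j. coeff (laguerre \<alpha> j) k * tcoeff i k) =
      (\<Sum>k<j. coeff (laguerre \<alpha> j) k * tcoeff i k) + coeff (laguerre \<alpha> j) j * tcoeff i j"
    by (simp add: lessThan_Suc_atMost[symmetric])
  also have "(\<Sum>k<j. coeff (laguerre \<alpha> j) k * tcoeff i k) = 0" using less by (intro sum.neutral) auto
  finally have "coeff (laguerre \<alpha> j) j * tcoeff i j = lam j * coeff (laguerre \<alpha> j) i"
      using tcoeff_eq[of j i] by simp
  moreover have "coeff (laguerre \<alpha> j) j \<noteq> 0" using lead_coeff_laguerre[OF alpha, of j] by simp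
  moreover have "coeff (laguerre \<alpha> j) i = 0" if "j \<noteq> i" using that less.prems alpha by (simp add: coeff_eq_0)
  ultimately show ?case by (cases "j = i") auto
qed

text \<open>These are k! times the coefficients of the associated power series p.\<close>

definition \<gamma> :: "nat \<Rightarrow> real" where
  "\<gamma> k = poch \<alpha> k * a k"

text \<open>Multiplied by the k-th coefficient of L_n, the proposed value becomes a_k (n choose k)
  times L_n(0), and these sum to \<open>lam n\<close> L_n(0).\<close>

lemma tcoeff_0: "tcoeff 0 k = (-1) ^ k * \<gamma> k"
proof (rule triangular_unique)
  fix n
  have "coeff (laguerre \<alpha> n) k * ((-1) ^ k * \<gamma> k) = a k * real (n choose k) * (poch \<alpha> n / fact n)"
      if "k \<le> n" for k
    using that poch_pos[OF alpha, of k]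
    by (simp add: coeff_laguerre[OF alpha] \<gamma>_def binomial_fact field_simps flip: power_add)
  then have "(\<Sum>k\<le>n. coeff (laguerre \<alpha> n) k * ((-1) ^ k * \<gamma> k)) = lam n * (poch \<alpha> n / fact n)"
    by (simp add: lam sum_distrib_right sum_divide_distrib)
  then show "(\<Sum>k\<le>n. coeff (laguerre \<alpha> n) k * tcoeff 0 k) = (\<Sum>k\<le>n. coeff (laguerre \<alpha> n) k * ((-1) ^ k * \<gamma> k))"
    by (simp add: tcoeff_eq coeff_laguerre_0[OF alpha])
qed

text \<open>The relation originates in the constant coefficients of T(\<open>lag_op\<close>(x^k)) =
  \<open>lag_op\<close>(T(x^k)), both operators being diagonal in the Laguerre basis; here it is
  checked by \<open>triangular_unique\<close>. At k = 0 the truncated index k - 1 is multiplied by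
  0.\<close>

lemma tcoeff_1:
  "(\<alpha> + 1) * tcoeff 1 k = real k * ((real k + \<alpha>) * tcoeff 0 (k - 1) - tcoeff 0 k)"
proof (rule triangular_unique)
  fix n
  define s where "s k = real k * ((real k + \<alpha>) * tcoeff 0 (k - 1) - tcoeff 0 k)" for k
  show "(\<Sum>k\<le>n. coeff (laguerre \<alpha> n) k * ((\<alpha> + 1) * tcoeff 1 k)) =
      (\<Sum>k\<le>n. coeff (laguerre \<alpha> n) k * (real k * ((real k + \<alpha>) * tcoeff 0 (k - 1) - tcoeff 0 k)))"
  proof (cases n)
    case 0
    then show ?thesis using tcoeff_lead[of 0 1] by simp
  next
    case (Suc m)
    define c where "c i = a i / (fact (n - i) * fact i)" for i
    have lamc: "lam n = fact n * (\<Sum>i\<le>n. c i)"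
      by (simp add: lam c_def sum_distrib_left binomial_fact mult.commute)
    \<comment> \<open>In the sum over i, each \<open>c i\<close> collects n - i from one term and i
      from the preceding one, n in total.\<close>
    have s1: "coeff (laguerre \<alpha> n) (Suc i) * s (Suc i) =
        - poch \<alpha> n * (real (n - i) * c i + real (Suc i) * c (Suc i))" if "i \<le> m" for i
    proof -
      have ni: "n - i = Suc (m - i)" "n - Suc i = m - i" using Suc that by auto
      define q p M J where "q = \<alpha> + 1 + real i" and "p = poch \<alpha> i" and "M = real (Suc (m - i))" and "J
          = real (Suc i)"
      note defs = this
      have pos: "q > 0" "p > 0" "M > 0" "J > 0" using alpha poch_pos[OF alpha] by (auto simp: defs)
      have "coeff (laguerre \<alpha> n) (Suc i) = - ((-1) ^ i) * poch \<alpha> n / (p * q * (fact (m - i) * (J * fact i)))"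
        using that Suc by (simp add: coeff_laguerre[OF alpha] ni pochhammer_Suc defs)
      moreover have "s (Suc i) = J * (q * ((-1) ^ i * (p * a i)) + (-1) ^ i * (p * q * a (Suc i)))"
        by (simp add: s_def tcoeff_0 \<gamma>_def defs pochhammer_Suc algebra_simps)
      moreover have "c i = a i / (M * fact (m - i) * fact i)" "c (Suc i)
          = a (Suc i) / (fact (m - i) * (J * fact i))"
        by (simp_all add: c_def ni defs)
      moreover have "(- ((-1) ^ i) * poch \<alpha> n / (p * q * (fact (m - i) * (J * fact i)))) *
         (J * (q * ((-1) ^ i * (p * a i)) + (-1) ^ i * (p * q * a (Suc i)))) =
         - poch \<alpha> n * (M * (a i / (M * fact (m - i) * fact i))
             + J * (a (Suc i) / (fact (m - i) * (J * fact i))))"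
      proof -
        have sq: "(-1) ^ i * ((-1) ^ i) = (1::real)" by (simp flip: power_add)
        have "(- ((-1) ^ i) * poch \<alpha> n / (p * q * (fact (m - i) * (J * fact i)))) *
           (J * (q * ((-1) ^ i * (p * a i)) + (-1) ^ i * (p * q * a (Suc i)))) =
           - ((-1) ^ i * ((-1) ^ i)) * (poch \<alpha> n / (p * q * (fact (m - i) * (J * fact i))) *
           (J * (q * p * a i + p * q * a (Suc i))))"
        proof -
          have "(- e * P / D) * (K * (q * (e * (p * x)) + e * (p * q * y))) =
              - (e * e) * (P / D * (K * (q * p * x + p * q * y)))" for e P D K x y :: real
            by (simp add: algebra_simps add_divide_distrib)
          then show ?thesis by blast
        qed
        also have "\<dots> = - (poch \<alpha> n / (p * q * (fact (m - i) * (J * fact i))) * (J * (q * p * a i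
            + p * q * a (Suc i))))"
          by (simp only: sq)
        also have "\<dots> = - poch \<alpha> n * (M * (a i / (M * fact (m - i) * fact i))
            + J * (a (Suc i) / (fact (m - i) * (J * fact i))))"
        proof -
          have "M * (a i / (M * fact (m - i) * fact i)) = a i / (fact (m - i) * fact i)"
            "J * (a (Suc i) / (fact (m - i) * (J * fact i))) = a (Suc i) / (fact (m - i) * fact i)"
            using pos by (simp_all add: divide_simps)
          moreover have "q * p * a i + p * q * a (Suc i) = p * q * (a i + a (Suc i))"
              by (simp add: algebra_simps)
          moreover have "poch \<alpha> n / (p * q * (fact (m - i) * (J * fact i))) * (J * (p * q * (a i
              + a (Suc i)))) =
              poch \<alpha> n * ((a i + a (Suc i)) / (fact (m - i) * fact i))"
            using pos by (simp add: divide_simps)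
          ultimately show ?thesis by (simp add: add_divide_distrib)
        qed
        finally show ?thesis .
      qed
      ultimately show ?thesis by (simp only: ni(1) M_def J_def)
    qed
    have "(\<Sum>k\<le>n. coeff (laguerre \<alpha> n) k * s k) = (\<Sum>i\<le>m. coeff (laguerre \<alpha> n) (Suc i) * s (Suc i))"
      unfolding Suc by (subst sum.atMost_Suc_shift) (simp add: s_def)
    also have "\<dots> = - poch \<alpha> n * ((\<Sum>i\<le>m. real (n - i) * c i) + (\<Sum>i\<le>m. real (Suc i) * c (Suc i)))"
      by (simp add: s1 sum_distrib_left sum.distrib distrib_left sum_subtractf sum_negf del: of_nat_Suc)
    also have "(\<Sum>i\<le>m. real (n - i) * c i) = (\<Sum>i\<le>n. real (n - i) * c i)" unfolding Suc by simp
    also have "(\<Sum>i\<le>m. real (Suc i) * c (Suc i)) = (\<Sum>i\<le>n. real i * c i)"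
      unfolding Suc by (subst sum.atMost_Suc_shift) simp
    also have "(\<Sum>i\<le>n. real (n - i) * c i) + (\<Sum>i\<le>n. real i * c i) = real n * (\<Sum>i\<le>n. c i)"
      unfolding sum.distrib[symmetric] sum_distrib_left
      by (intro sum.cong) (auto simp: of_nat_diff algebra_simps)
    also have "- poch \<alpha> n * (real n * (\<Sum>i\<le>n. c i)) = (\<alpha> + 1) * (lam n * coeff (laguerre \<alpha> n) 1)"
    proof -
      define S P \<beta> where "S = (\<Sum>i\<le>n. c i)" and "P = poch \<alpha> n" and "\<beta> = \<alpha> + 1"
      have \<beta>: "\<beta> \<noteq> 0" using alpha by (simp add: \<beta>_def)
      have "coeff (laguerre \<alpha> n) 1 = - P / (\<beta> * fact m)"
        using Suc by (simp add: coeff_laguerre[OF alpha] P_def \<beta>_def)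
      moreover have "lam n = real n * fact m * S" using lamc Suc by (simp add: S_def)
      moreover have "\<beta> * (real n * fact m * S * (- P / (\<beta> * fact m))) = - P * (real n * S)"
        using \<beta> by (simp add: divide_simps)
      ultimately show ?thesis by (simp add: S_def P_def \<beta>_def)
    qed
    finally have "(\<Sum>k\<le>n. coeff (laguerre \<alpha> n) k * s k) = (\<alpha> + 1) * (lam n * coeff (laguerre \<alpha> n) 1)" .
    moreover have "(\<Sum>k\<le>n. coeff (laguerre \<alpha> n) k * ((\<alpha> + 1) * tcoeff 1 k))
        = (\<alpha> + 1) * (lam n * coeff (laguerre \<alpha> n) 1)"
      unfolding tcoeff_eq[symmetric] by (simp add: sum_distrib_left mult_ac)
    ultimately show ?thesis by (simp add: s_def)
  qed
qed

text \<open>\<open>J n\<close> and \<open>H n\<close> are the value and the derivative of \<open>T ((x + z)^n)\<close> at \<open>x = 0\<close>, as polynomials in \<open>z\<close>.\<close>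

definition J :: "nat \<Rightarrow> real poly" where "J = appell (tcoeff 0)"
definition H :: "nat \<Rightarrow> real poly" where "H = appell (tcoeff 1)"

text \<open>On \<open>J n\<close> the index k acts as n - z d/dz, and the passage from the
  coefficient k to k times the coefficient k - 1 acts as d/dz. This translates
  \<open>tcoeff_1\<close> into a differential identity, so that \<open>rayleigh\<close> becomes a
  condition on \<open>J\<close> alone.\<close>

lemma H_eq:
  "smult (\<alpha> + 1) (H n) = [:real n + \<alpha>, 1:] * pderiv (J n) - smult (real n) (J n)
      - [:0, 1:] * pderiv (pderiv (J n))"
proof (rule poly_eqI)
  fix i
  have R: "coeff ([:real n + \<alpha>, 1:] * pderiv (J n) - smult (real n) (J n)
      - [:0, 1:] * pderiv (pderiv (J n))) i =
      (real i - real n) * coeff (J n) i + (real n + \<alpha> - real i) * (real (Suc i) * coeff (J n) (Suc i))"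
    by (cases i) (simp_all add: coeff_pderiv algebra_simps)
  show "coeff (smult (\<alpha> + 1) (H n)) i =
    coeff ([:real n + \<alpha>, 1:] * pderiv (J n) - smult (real n) (J n) - [:0, 1:] * pderiv (pderiv (J n))) i"
  proof (cases "i < n")
    case True
    have b: "real (Suc i) * real (n choose Suc i) = (real n - real i) * real (n choose i)"
      using True binomial_absorption[of i n] binomial_absorb_comp[of n i]
      by (metis less_imp_le of_nat_diff of_nat_mult)
    define B where "B = real (n choose i)"
    have J1: "real (Suc i) * coeff (J n) (Suc i) = (real n - real i) * B * tcoeff 0 (n - i - 1)"
      using True b by (simp add: J_def coeff_appell B_def mult.assoc[symmetric] del: of_nat_Suc)
    have J0: "coeff (J n) i = B * tcoeff 0 (n - i)" using True by (simp add: J_def coeff_appell B_def)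
    have "coeff (smult (\<alpha> + 1) (H n)) i = B * ((\<alpha> + 1) * tcoeff 1 (n - i))"
      using True by (simp add: H_def coeff_appell B_def)
    also have "\<dots> = B * ((real n - real i) * ((real n - real i + \<alpha>) * tcoeff 0 (n - i - 1) - tcoeff 0 (n - i)))"
      unfolding tcoeff_1 using True by (simp add: of_nat_diff)
    finally show ?thesis unfolding R J1 J0 by (simp add: algebra_simps)
  next
    case False
    then show ?thesis unfolding R using tcoeff_lead[of 0 1]
      by (cases "i = n") (simp_all add: J_def H_def coeff_appell)
  qed
qed

lemma degree_T_le: "degree q \<le> n \<Longrightarrow> degree (T q) \<le> n"
  by (rule degree_le) (auto simp: coeff_T tcoeff_lead)

lemma lead_coeff_T: "degree q \<le> n \<Longrightarrow> coeff (T q) n = lam n * coeff q n"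
proof -
  assume q: "degree q \<le> n"
  have "coeff (T q) n = (\<Sum>k\<le>n. if k = n then lam n * coeff q n else 0)"
    unfolding coeff_T[OF q] by (intro sum.cong) (auto simp: tcoeff_lead)
  then show ?thesis by simp
qed

lemma coeff_T_shift_power: "coeff (T ([:z, 1:] ^ n)) i = poly (appell (tcoeff i) n) z"
proof -
  have "coeff (T ([:z, 1:] ^ n)) i = (\<Sum>k\<le>n. coeff ([:z, 1:] ^ n) k * tcoeff i k)"
    by (rule coeff_T) (simp add: degree_linear_power)
  also have "\<dots> = poly (appell (tcoeff i) n) z"
    unfolding poly_appell by (intro sum.cong) (auto simp: coeff_linear_poly_power)
  finally show ?thesis .
qed

text \<open>The pencil (x+z)^n (x + z + s) is real-rooted. The Wronskian of the two images at x = 0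
  involves only their constant and linear coefficients, and \<open>pderiv_appell\<close> brings both
  to index n + 1.\<close>

lemma rayleigh:
  assumes "lam (Suc n) * lam n \<noteq> 0"
  shows "lam (Suc n) * lam n * (poly (H (Suc n)) z * poly (pderiv (J (Suc n))) z
    - poly (J (Suc n)) z * poly (pderiv (H (Suc n))) z) \<ge> 0"
proof -
  define u v where "u = T ([:z, 1:] ^ Suc n)" and "v = T ([:z, 1:] ^ n)"
  have d: "degree ([:z, 1:] ^ m) \<le> m" for m by (simp add: degree_linear_power)
  have lc: "coeff u (Suc n) = lam (Suc n)" "coeff v n = lam n"
    unfolding u_def v_def lead_coeff_T[OF d] by (simp_all add: coeff_linear_power del: power_Suc)
  have "u + smult s v = T ([:z + s, 1:] * [:z, 1:] ^ n)" for s
  proof -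
    have "u + smult s v = T ([:z, 1:] ^ Suc n + smult s ([:z, 1:] ^ n))"
        by (simp only: u_def v_def T_add T_smult)
    also have "[:z, 1:] ^ Suc n + smult s ([:z, 1:] ^ n) = [:z + s, 1:] * [:z, 1:] ^ n"
      by (simp add: smult_add_left)
    finally show ?thesis .
  qed
  then have rr: "real_rooted (u + smult s v)" "real_rooted v" for s
    unfolding v_def by (auto intro!: T_rr real_rooted_mult real_rooted_power simp del: mult_pCons_left)
  have "lam (Suc n) * lam n * poly (wronsk u v) 0 \<ge> 0"
    using pencil_lead(2)[OF rr, of n 0] degree_T_le[OF d] assms unfolding lc
        by (simp add: u_def v_def del: power_Suc)
  moreover have "poly (wronsk u v) 0 = coeff u 1 * coeff v 0 - coeff u 0 * coeff v 1"
    unfolding wronsk_def poly_diff poly_mult by (simp add: poly_0_coeff_0 coeff_pderiv)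
  moreover have "coeff u 1 = poly (H (Suc n)) z" "coeff v 0 = poly (J n) z" "coeff u 0
      = poly (J (Suc n)) z" "coeff v 1 = poly (H n) z"
    by (simp_all only: u_def v_def coeff_T_shift_power J_def H_def)
  ultimately have "lam (Suc n) * lam n * (poly (H (Suc n)) z * poly (J n) z
      - poly (J (Suc n)) z * poly (H n) z) \<ge> 0" by simp
  then have "real (Suc n) * (lam (Suc n) * lam n * (poly (H (Suc n)) z * poly (J n) z
      - poly (J (Suc n)) z * poly (H n) z)) \<ge> 0"
    by (rule mult_nonneg_nonneg[OF of_nat_0_le_iff])
  then show ?thesis by (simp add: J_def H_def pderiv_appell algebra_simps)
qed

text \<open>For s \<ge> 0 all x^n (x^2 + r x - s) are real-rooted. The Wronskian of the image pencil
  is affine in s, so large s forces its slope, the Wronskian at the lower indices, to carry the sign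
  belonging to the upper ones; leading coefficients then compare the two products.\<close>

lemma lam_sign_step:
  assumes "lam n \<noteq> 0" "lam (Suc n) \<noteq> 0" "lam (Suc (Suc n)) \<noteq> 0"
  shows "(lam (Suc (Suc n)) * lam (Suc n)) * (lam (Suc n) * lam n) > 0"
proof -
  define x where "x k = T (monom 1 k)" for k
  have dx: "degree (x k) \<le> k" for k unfolding x_def by (rule degree_T_le) (simp add: degree_monom_eq)
  have lx: "coeff (x k) k = lam k" for k unfolding x_def by (subst lead_coeff_T) (simp_all add: degree_monom_eq)
  define c where "c = lam (Suc (Suc n)) * lam (Suc n)"
  have W: "c * poly (wronsk (x (Suc (Suc n))) (x (Suc n))) y + s * (c * poly (wronsk (x (Suc n)) (x n)) y) \<ge> 0"
    if s: "s \<ge> 0" for s y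
  proof -
    define u where "u = x (Suc (Suc n)) - smult s (x n)"
    have T_diff: "T (f - g) = T f - T g" for f g using T_add[of f "-g"] T_smult[of "-1" g] by simp
    have "u + smult r (x (Suc n)) = T (monom 1 n * [:-s, r, 1:])" for r
    proof -
      have m: "monom 1 n * [:-s, r, 1:] = monom 1 (Suc (Suc n)) - smult s (monom 1 n)
          + smult r (monom 1 (Suc n))"
        by (intro poly_eq_poly_eq_iff[THEN iffD1] ext) (simp add: poly_monom algebra_simps)
      show ?thesis unfolding m u_def x_def T_add T_diff T_smult by simp
    qed
    moreover have "real_rooted (monom 1 n * [:-s, r, 1:])" for r
    proof -
      define q where "q = sqrt (r\<^sup>2 + 4 * s)"
      have q: "q * q = r\<^sup>2 + 4 * s" using s by (simp add: q_def)
      have "[:-s, r, 1:] = [:(r + q) / 2, 1:] * [:(r - q) / 2, 1:]"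
        using q by (simp add: field_simps power2_eq_square)
      moreover have "real_rooted (monom 1 n)"
        using real_rooted_power[OF real_rooted_linear[of 0 1], of n] by (simp add: monom_altdef)
      ultimately show ?thesis by (metis real_rooted_linear real_rooted_mult)
    qed
    ultimately have rr: "real_rooted (u + smult r (x (Suc n)))" for r using T_rr by simp
    have "real_rooted (monom 1 (Suc n))"
      using real_rooted_power[OF real_rooted_linear[of 0 1], of "Suc n"] by (simp add: monom_altdef)
    then have rr2: "real_rooted (x (Suc n))" unfolding x_def by (rule T_rr)
    have du: "degree u \<le> Suc (Suc n)" unfolding u_def
      using dx[of n] dx[of "Suc (Suc n)"] by (intro degree_diff_le order.trans[OF degree_smult_le]) auto
    have lu: "coeff u (Suc (Suc n)) = lam (Suc (Suc n))"
      using dx[of n] by (simp add: u_def lx coeff_eq_0)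
    have "c * poly (wronsk u (x (Suc n))) y \<ge> 0"
      using pencil_lead(2)[OF rr rr2 du dx] assms unfolding lu lx c_def by simp
    moreover have "poly (wronsk u (x (Suc n))) y = poly (wronsk (x (Suc (Suc n))) (x (Suc n))) y
        + s * poly (wronsk (x (Suc n)) (x n)) y"
      by (simp add: wronsk_def u_def pderiv_diff pderiv_smult algebra_simps)
    ultimately show ?thesis by (simp add: algebra_simps)
  qed
  have "c * poly (wronsk (x (Suc n)) (x n)) y \<ge> 0" for y
  proof (rule ccontr)
    define A B where "A = c * poly (wronsk (x (Suc (Suc n))) (x (Suc n))) y" and "B
        = c * poly (wronsk (x (Suc n)) (x n)) y"
    assume "\<not> c * poly (wronsk (x (Suc n)) (x n)) y \<ge> 0"
    then have B: "B < 0" by (simp add: B_def)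
    have "A + ((\<bar>A\<bar> + 1) / - B) * B \<ge> 0" unfolding A_def B_def
      by (rule W) (use B in \<open>simp add: B_def divide_nonneg_neg\<close>)
    then show False using B by simp
  qed
  then have "coeff (smult c (wronsk (x (Suc n)) (x n))) (2 * n) \<ge> 0"
    by (intro nonneg_poly_coeff order.trans[OF degree_smult_le] wronsk_lead(1) dx) simp
  then have "c * (lam (Suc n) * lam n) \<ge> 0"
    by (simp add: wronsk_lead(2)[OF dx dx] lx)
  moreover have "c * (lam (Suc n) * lam n) \<noteq> 0" using assms by (simp add: c_def)
  ultimately show ?thesis unfolding c_def by linarith
qed

end

section \<open>Newton's inequality and binomial transforms\<close>

lemma coeffs_prod_reversed:
  fixes A :: "real multiset"
  defines "q \<equiv> \<Prod>x\<in>#A. [:1, -x:]"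
  shows "coeff q 0 = 1" "coeff q 1 = - sum_mset A" "(coeff q 1)\<^sup>2 - 2 * coeff q 2 = (\<Sum>x\<in>#A. x\<^sup>2)"
proof -
  have "coeff q 0 = 1 \<and> coeff q 1 = - sum_mset A \<and> (coeff q 1)\<^sup>2 - 2 * coeff q 2 = (\<Sum>x\<in>#A. x\<^sup>2)"
    unfolding q_def
  proof (induction A)
    case (add x A)
    define g where "g = (\<Prod>x\<in>#A. [:1, -x:])"
    have eq: "(\<Prod>x\<in>#add_mset x A. [:1, -x:]) = g - pCons 0 (smult x g)" by (simp add: g_def)
    have "coeff g 0 = 1 \<and> coeff g 1 = - sum_mset A \<and> (coeff g 1)\<^sup>2 - 2 * coeff g 2 = (\<Sum>x\<in>#A. x\<^sup>2)"
      using add.IH unfolding g_def .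
    then have "coeff g 0 = 1" "coeff g 1 = - sum_mset A"
      "sum_mset A * sum_mset A - 2 * coeff g 2 = (\<Sum>x\<in>#A. x\<^sup>2)"
      by (auto simp: power2_eq_square)
    then show ?case
      unfolding eq by (simp add: coeff_pCons numeral_2_eq_2 power2_eq_square algebra_simps)
  qed simp
  then show "coeff q 0 = 1" "coeff q 1 = - sum_mset A" "(coeff q 1)\<^sup>2 - 2 * coeff q 2 = (\<Sum>x\<in>#A. x\<^sup>2)" by auto
qed

lemma sum_mset_squared_le:
  fixes A :: "real multiset"
  shows "(sum_mset A)\<^sup>2 \<le> real (size A) * (\<Sum>x\<in>#A. x\<^sup>2)"
proof (induction A)
  case (add x A)
  define S Q n where "S = sum_mset A" and "Q = (\<Sum>x\<in>#A. x\<^sup>2)" and "n = real (size A)"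
  have IH: "S\<^sup>2 \<le> n * Q" using add by (simp add: S_def Q_def n_def)
  have Q: "Q \<ge> 0" unfolding Q_def by (induction A) auto
  have "2 * S * x \<le> Q + n * x\<^sup>2"
  proof (cases "A = {#}")
    case True
    then show ?thesis by (simp add: S_def Q_def n_def)
  next
    case False
    then have n: "n > 0" by (simp add: n_def nonempty_has_size)
    have "n * (Q + n * x\<^sup>2 - 2 * S * x) \<ge> S\<^sup>2 + n\<^sup>2 * x\<^sup>2 - 2 * n * S * x"
      using IH by (simp add: algebra_simps power2_eq_square)
    also have "S\<^sup>2 + n\<^sup>2 * x\<^sup>2 - 2 * n * S * x = (S - n * x)\<^sup>2" by (simp add: algebra_simps power2_eq_square)
    finally have "n * (Q + n * x\<^sup>2 - 2 * S * x) \<ge> 0" by (smt (verit) zero_le_power2)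
    then show ?thesis using n by (simp add: zero_le_mult_iff)
  qed
  then have "(S + x)\<^sup>2 \<le> (n + 1) * (Q + x\<^sup>2)" using IH by (simp add: algebra_simps power2_eq_square)
  then show ?case by (simp add: S_def Q_def n_def add.commute)
qed simp

text \<open>The three lowest coefficients determine the sum and the sum of squares of the reciprocal
  roots, and Cauchy-Schwarz compares these. Only an upper bound on the number of roots enters, so
  \<open>N\<close> may exceed the degree.\<close>

lemma newton_inequality:
  assumes f: "real_rooted f" "degree f \<le> N" "coeff f 0 \<noteq> 0"
  shows "real N * (2 * coeff f 0 * coeff f 2) \<le> (real N - 1) * (coeff f 1)\<^sup>2"
proof -
  have f0: "f \<noteq> 0" using f(3) by auto
  obtain A where A: "f = smult (lead_coeff f) (\<Prod>x\<in>#A. [:-x, 1:])" "size A = degree f"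
    using real_rooted_decompose[OF f(1) f0] by blast
  have nz: "x \<noteq> 0" if "x \<in># A" for x
  proof
    assume "x = 0"
    then have "poly f 0 = 0" using that by (subst A(1)) (auto simp: poly_prod_mset prod_mset_zero_iff)
    then show False using f(3) by (simp add: poly_0_coeff_0)
  qed
  have "\<exists>c. (\<Prod>x\<in>#B. [:-x, 1:]) = smult c (\<Prod>x\<in>#image_mset inverse B. [:1, -x:])"
      if "\<And>x. x \<in># B \<Longrightarrow> x \<noteq> 0" for B :: "real multiset"
    using that
  proof (induction B)
    case empty
    show ?case by (intro exI[of _ 1]) simp
  next
    case (add x B)
    then obtain c where c: "(\<Prod>x\<in>#B. [:-x, 1:]) = smult c (\<Prod>x\<in>#image_mset inverse B. [:1, -x:])" by auto
    have "[:-x, 1:] = smult (-x) [:1, - inverse x:]" using add.prems[of x] by simp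
    then have "(\<Prod>x\<in>#add_mset x B. [:-x, 1:]) = smult (c * -x) (\<Prod>x\<in>#image_mset inverse (add_mset x B). [:1,
        -x:])"
      unfolding image_mset_add_mset prod_mset.add_mset c
          by (simp only: mult_smult_left mult_smult_right smult_smult)
    then show ?case by blast
  qed
  from this[OF nz] obtain c' where c': "(\<Prod>x\<in>#A. [:-x, 1:]) = smult c' (\<Prod>x\<in>#image_mset inverse A. [:1, -x:])"
      by blast
  define B q c where "B = image_mset inverse A" and "q = (\<Prod>x\<in>#B. [:1, -x:])" and "c = lead_coeff f * c'"
  have fq: "f = smult c q" by (subst A(1), subst c') (simp add: B_def q_def c_def)
  note q = coeffs_prod_reversed[of B, folded q_def]
  define Q where "Q = (\<Sum>x\<in>#B. x\<^sup>2)"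
  have Q: "Q \<ge> 0" unfolding Q_def by (induction B) auto
  have "(coeff q 1)\<^sup>2 \<le> real (size B) * Q" using sum_mset_squared_le[of B] q by (simp add: Q_def)
  also have "\<dots> \<le> real N * Q" using A(2) f(2) Q by (intro mult_right_mono) (simp_all add: B_def)
  also have "Q = (coeff q 1)\<^sup>2 - 2 * coeff q 2" using q(3) by (simp add: Q_def)
  finally have "real N * (2 * coeff q 2) \<le> (real N - 1) * (coeff q 1)\<^sup>2" by (simp add: algebra_simps)
  then have "c\<^sup>2 * (real N * (2 * coeff q 2)) \<le> c\<^sup>2 * ((real N - 1) * (coeff q 1)\<^sup>2)"
      by (intro mult_left_mono) auto
  then show ?thesis by (simp add: fq q(1) power_mult_distrib power2_eq_square algebra_simps)
qed

text \<open>By Pascal's rule the increment of the sum is the same sum for the shifted sequence,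
  which has one uncontrolled term fewer. Increments bounded below by a positive constant eventually
  outweigh any initial values.\<close>

lemma binomial_sum_eventually_pos:
  fixes \<mu> :: "nat \<Rightarrow> real"
  assumes "\<And>j. j \<ge> n0 \<Longrightarrow> \<mu> j > 0"
  shows "\<exists>c>0. \<exists>k0. \<forall>k\<ge>k0. (\<Sum>j\<le>k. real (k choose j) * \<mu> j) \<ge> c"
  using assms
proof (induction n0 arbitrary: \<mu>)
  case 0
  have "(\<Sum>j\<le>k. real (k choose j) * \<mu> j) \<ge> \<mu> 0" for k
  proof -
    have "real (k choose 0) * \<mu> 0 \<le> (\<Sum>j\<le>k. real (k choose j) * \<mu> j)"
      by (rule member_le_sum) (use 0 in \<open>auto simp: less_imp_le\<close>)
    then show ?thesis by simp
  qed
  then show ?case using 0[of 0] by auto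
next
  case (Suc n0)
  define b where "b k = (\<Sum>j\<le>k. real (k choose j) * \<mu> j)" for k
  obtain c k0 where c: "c > 0" "\<And>k. k \<ge> k0 \<Longrightarrow> (\<Sum>j\<le>k. real (k choose j) * \<mu> (Suc j)) \<ge> c"
    using Suc.IH[of "\<lambda>j. \<mu> (Suc j)"] Suc.prems by auto
  have diff: "b (Suc k) = b k + (\<Sum>j\<le>k. real (k choose j) * \<mu> (Suc j))" for k
  proof -
    have "b (Suc k) = \<mu> 0 + (\<Sum>j\<le>k. real (k choose Suc j) * \<mu> (Suc j)) + (\<Sum>j\<le>k. real (k choose j) * \<mu> (Suc j))"
      unfolding b_def by (subst sum.atMost_Suc_shift) (simp add: algebra_simps sum.distrib)
    also have "\<mu> 0 + (\<Sum>j\<le>k. real (k choose Suc j) * \<mu> (Suc j)) = (\<Sum>j\<le>Suc k. real (k choose j) * \<mu> j)"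
      by (subst sum.atMost_Suc_shift) simp
    also have "\<dots> = b k" by (simp add: b_def binomial_eq_0)
    finally show ?thesis .
  qed
  have lin: "b (k0 + i) \<ge> b k0 + real i * c" for i
  proof (induction i)
    case (Suc i)
    then show ?case using diff[of "k0 + i"] c(2)[of "k0 + i"] by (simp add: algebra_simps)
  qed simp
  obtain m where m: "real m * c \<ge> 1 - b k0" using c(1) by (meson ex_less_of_nat_mult less_imp_le)
  have "b k \<ge> 1" if "k \<ge> k0 + m" for k
  proof -
    have "real m * c \<le> real (k - k0) * c" using that c(1) by (intro mult_right_mono) auto
    then show ?thesis using lin[of "k - k0"] m that by simp
  qed
  then show ?case unfolding b_def by (intro exI[of _ 1]) auto
qed

lemma binomial_inversion:
  fixes a lam :: "nat \<Rightarrow> real"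
  assumes lam: "\<And>n. lam n = (\<Sum>k\<le>n. a k * real (n choose k))"
  shows "(-1) ^ n * a n = (\<Sum>j\<le>n. real (n choose j) * ((-1) ^ j * lam j))"
proof -
  have "(\<Sum>j\<le>n. real (n choose j) * ((-1) ^ j * lam j)) =
      (\<Sum>j\<le>n. \<Sum>k\<le>n. real (n choose j) * (-1) ^ j * (a k * real (j choose k)))"
  proof (intro sum.cong refl)
    fix j assume "j \<in> {..n}"
    then have "lam j = (\<Sum>k\<le>n. a k * real (j choose k))"
      unfolding lam by (intro sum.mono_neutral_left) (auto simp: binomial_eq_0)
    then show "real (n choose j) * ((-1) ^ j * lam j) = (\<Sum>k\<le>n. real (n choose j) * (-1) ^ j * (a k * real (j
        choose k)))"
      by (simp add: sum_distrib_left mult.assoc)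
  qed
  also have "\<dots> = (\<Sum>k\<le>n. a k * (\<Sum>j\<le>n. (-1) ^ j * (real (n choose j) * real (j choose k))))"
    by (subst sum.swap) (simp add: sum_distrib_left mult_ac)
  also have "\<dots> = (\<Sum>k\<le>n. if k = n then a n * (-1) ^ n else 0)"
  proof (intro sum.cong refl)
    fix k assume k: "k \<in> {..n}"
    have "(\<Sum>j\<le>n. (-1) ^ j * (real (n choose j) * real (j choose k))) =
        (\<Sum>j\<in>{k..n}. (-1) ^ j * (real (n choose j) * real (j choose k)))"
      by (intro sum.mono_neutral_right) (auto simp: binomial_eq_0)
    also have "\<dots> = (\<Sum>j\<in>{k..n}. (-1) ^ j * (real (n choose k) * real ((n - k) choose (j - k))))"
      by (intro sum.cong refl) (metis atLeastAtMost_iff choose_mult of_nat_mult)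
    also have "\<dots> = (\<Sum>i\<le>n - k. (-1) ^ (i + k) * (real (n choose k) * real ((n - k) choose i)))"
      using k by (intro sum.reindex_bij_witness[of _ "\<lambda>i. i + k" "\<lambda>j. j - k"]) auto
    also have "\<dots> = (-1) ^ k * real (n choose k) * (\<Sum>i\<le>n - k. (-1) ^ i * real ((n - k) choose i))"
      by (simp add: sum_distrib_left power_add mult_ac)
    also have "\<dots> = (if k = n then (-1) ^ n else 0)"
      using choose_alternating_sum[of "n - k", where ?'a = real] k by auto
    finally show "a k * (\<Sum>j\<le>n. (-1) ^ j * (real (n choose j) * real (j choose k))) = (if k
        = n then a n * (-1) ^ n else 0)"
      by auto
  qed
  finally show ?thesis by (simp add: mult.commute)
qed

context lag_multiplier
begin

text \<open>The real and imaginary parts of \<open>(x + z)^n\<close>, \<open>z\<close> non-real, span a real-rooted pencil; hence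
  \<open>T ((x + z)^n)\<close> has no zero for \<open>x\<close> in one of the open half-planes, and \<open>x\<close> tends to \<open>0\<close>.\<close>

lemma J_real_rooted:
  assumes "lam (Suc n) * lam n \<noteq> 0"
  shows "real_rooted (J (Suc n))"
proof (cases "J (Suc n) = 0")
  case True
  then show ?thesis by (simp add: real_rooted_def)
next
  case False
  define N where "N = Suc n"
  define \<sigma> where "\<sigma> = lam N * lam n"
  have \<sigma>0: "\<sigma> \<noteq> 0" using assms by (simp add: \<sigma>_def N_def)
  define \<tau> where "\<tau> k x = poly (cpoly (T (monom 1 k))) x" for k x
  define F where "F x w = (\<Sum>k\<le>N. of_nat (N choose k) * w ^ (N - k) * \<tau> k x)" for x w :: complex
  have F_nz: "F x w \<noteq> 0" if x: "Im x > 0" and w: "\<sigma> * Im w > 0" for x w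
  proof -
    define z where "z = Complex (Re w) \<bar>Im w\<bar>"
    have z: "Im z > 0" using w by (auto simp: z_def)
    have wz: "w = (if \<sigma> > 0 then z else cnj z)"
      using w by (auto simp: z_def complex_eq_iff zero_less_mult_iff)
    define u0 where "u0 = (\<Sum>k\<le>N. monom (real (N choose k) * Re (z ^ (N - k))) k)"
    define v0 where "v0 = (\<Sum>k\<le>N. monom (real (N choose k) * Im (z ^ (N - k))) k)"
    have eval: "poly (cpoly u0) y + \<i> * poly (cpoly v0) y = (y + z) ^ N"
      "poly (cpoly u0) y - \<i> * poly (cpoly v0) y = (y + cnj z) ^ N" for y
    proof -
      have u: "poly (cpoly u0) y = (\<Sum>k\<le>N. of_nat (N choose k) * y ^ k * of_real (Re (z ^ (N - k))))"
        by (simp add: u0_def cpoly_sum cpoly_monom poly_sum poly_monom mult_ac)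
      have v: "poly (cpoly v0) y = (\<Sum>k\<le>N. of_nat (N choose k) * y ^ k * of_real (Im (z ^ (N - k))))"
        by (simp add: v0_def cpoly_sum cpoly_monom poly_sum poly_monom mult_ac)
      have c: "c = of_real (Re c) + \<i> * of_real (Im c)" "cnj c = of_real (Re c) - \<i> * of_real (Im c)" for c
        by (simp_all add: complex_eq_iff)
      have "poly (cpoly u0) y + \<i> * poly (cpoly v0) y =
          (\<Sum>k\<le>N. of_nat (N choose k) * y ^ k * (of_real (Re (z ^ (N - k))) + \<i> * of_real (Im (z ^ (N - k)))))"
        by (simp add: u v sum_distrib_left sum.distrib distrib_left mult_ac)
      then show "poly (cpoly u0) y + \<i> * poly (cpoly v0) y = (y + z) ^ N"
        unfolding c(1)[symmetric] binomial_ring .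
      have "poly (cpoly u0) y - \<i> * poly (cpoly v0) y =
          (\<Sum>k\<le>N. of_nat (N choose k) * y ^ k * (of_real (Re (z ^ (N - k))) - \<i> * of_real (Im (z ^ (N - k)))))"
        by (simp add: u v sum_distrib_left sum_subtractf right_diff_distrib mult_ac)
      then show "poly (cpoly u0) y - \<i> * poly (cpoly v0) y = (y + cnj z) ^ N"
        unfolding c(2)[symmetric] complex_cnj_power binomial_ring .
    qed
    \<comment> \<open>A zero y of a member would give |y + z| = |y + cnj z|, impossible when y and z
      both lie in the upper half-plane.\<close>
    have rr0: "real_rooted (smult c u0 + smult d v0)" if cd: "c \<noteq> 0 \<or> d \<noteq> 0" for c d
      unfolding real_rooted_iff
    proof (intro disjI2 allI impI notI)
      fix y assume y: "Im y > 0" and 0: "poly (cpoly (smult c u0 + smult d v0)) y = 0"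
      define U V where "U = poly (cpoly u0) y" and "V = poly (cpoly v0) y"
      have UV: "of_real c * U + of_real d * V = 0" using 0 by (simp add: cpoly_add cpoly_smult U_def V_def)
      have E: "(of_real c - \<i> * of_real d) * (U + \<i> * V) + (of_real c + \<i> * of_real d) * (U - \<i> * V) =
          2 * (of_real c * U + of_real d * V)" by (simp add: algebra_simps)
      have "(of_real c - \<i> * of_real d) * (y + z) ^ N + (of_real c + \<i> * of_real d) * (y + cnj z) ^ N = 0"
        unfolding eval[symmetric] U_def[symmetric] V_def[symmetric] by (simp only: E UV mult_zero_right)
      then have "(of_real c - \<i> * of_real d) * (y + z) ^ N = - ((of_real c + \<i> * of_real d) * (y + cnj z) ^ N)"
        by (simp only: eq_neg_iff_add_eq_0)
      then have "cmod (of_real c - \<i> * of_real d) * cmod (y + z) ^ N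
          = cmod (of_real c + \<i> * of_real d) * cmod (y + cnj z) ^ N"
        by (metis norm_minus_cancel norm_mult norm_power)
      moreover have "cmod (of_real c - \<i> * of_real d) = cmod (of_real c + \<i> * of_real d)"
        "cmod (of_real c + \<i> * of_real d) \<noteq> 0"
        using cd by (auto simp: cmod_def complex_eq_iff)
      ultimately have "cmod (y + z) ^ N = cmod (y + cnj z) ^ N" by simp
      then have "cmod (y + z) = cmod (y + cnj z)" by (metis N_def norm_ge_zero power_eq_imp_eq_base
          zero_less_Suc)
      then have "(cmod (y + z))\<^sup>2 = (cmod (y + cnj z))\<^sup>2" by simp
      then have "(Im y + Im z)\<^sup>2 = (Im y - Im z)\<^sup>2" by (simp add: cmod_power2)
      then have "Im y * Im z = 0" by (simp add: power2_eq_square algebra_simps)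
      then show False using y z by simp
    qed
    define u v where "u = T u0" and "v = T v0"
    have rr: "real_rooted (u + smult s v)" "real_rooted v" for s
      using T_rr[OF rr0[of 1 s]] T_rr[OF rr0[of 0 1]] by (simp_all add: u_def v_def T_add T_smult)
    have cu: "coeff u0 k = (if k \<le> N then real (N choose k) * Re (z ^ (N - k)) else 0)" for k
      by (simp add: u0_def coeff_sum)
    have cv: "coeff v0 k = (if k \<le> N then real (N choose k) * Im (z ^ (N - k)) else 0)" for k
      by (simp add: v0_def coeff_sum)
    have du: "degree u0 \<le> Suc n" by (rule degree_le) (simp add: cu N_def)
    have dv: "degree v0 \<le> n"
    proof (rule degree_le, intro allI impI)
      fix i assume "n < i"
      then show "coeff v0 i = 0" by (cases "i = N") (auto simp: cv N_def)
    qed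
    have lu: "coeff u (Suc n) = lam N" unfolding u_def lead_coeff_T[OF du] by (simp add: cu N_def)
    have lv: "coeff v n = lam n * (real N * Im z)" unfolding v_def lead_coeff_T[OF dv] by (simp add: cv N_def)
    define U V where "U = poly (cpoly u) x" and "V = poly (cpoly v) x"
    have "lam N * (lam n * (real N * Im z)) * Im (U * cnj V) > 0"
      unfolding U_def V_def using pencil_lead(1)[OF rr _ _ _ x, of n] degree_T_le[OF du] degree_T_le[OF dv] \<sigma>0 z
      unfolding lu lv u_def[symmetric] v_def[symmetric] by (simp add: \<sigma>_def N_def)
    then have "(real N * Im z) * (\<sigma> * Im (U * cnj V)) > 0" by (simp add: \<sigma>_def mult_ac)
    moreover have "real N * Im z > 0" using z by (simp add: N_def)
    ultimately have pos: "\<sigma> * Im (U * cnj V) > 0" by (rule zero_less_mult_pos)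
    have TU: "T u0 = (\<Sum>k\<le>N. smult (real (N choose k) * Re (z ^ (N - k))) (T (monom 1 k)))"
      "T v0 = (\<Sum>k\<le>N. smult (real (N choose k) * Im (z ^ (N - k))) (T (monom 1 k)))"
      unfolding u0_def v0_def T_sum T_smult[symmetric] by (simp_all add: smult_monom)
    have U: "U = (\<Sum>k\<le>N. of_nat (N choose k) * of_real (Re (z ^ (N - k))) * \<tau> k x)"
      and V: "V = (\<Sum>k\<le>N. of_nat (N choose k) * of_real (Im (z ^ (N - k))) * \<tau> k x)"
      unfolding U_def V_def u_def v_def TU by (simp_all add: cpoly_sum cpoly_smult poly_sum \<tau>_def)
    \<comment> \<open>The sign of \<sigma> selects w = z or w = cnj z. Vanishing of U + i V would
      make Im (U cnj V) \<le> 0, that of U - i V would make it \<ge> 0; each contradicts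
      \<open>pos\<close> in its case.\<close>
    show ?thesis
    proof (cases "\<sigma> > 0")
      case True
      have "F x w = U + \<i> * V"
      proof -
        have "z ^ m = of_real (Re (z ^ m)) + \<i> * of_real (Im (z ^ m))" for m by (simp add: complex_eq_iff)
        then have "F x z = (\<Sum>k\<le>N. of_nat (N choose k) * (of_real (Re (z ^ (N - k)))
            + \<i> * of_real (Im (z ^ (N - k)))) * \<tau> k x)"
          unfolding F_def by metis
        then show ?thesis using True by (simp add: wz U V sum_distrib_left sum.distrib algebra_simps)
      qed
      moreover have "U + \<i> * V \<noteq> 0"
      proof
        assume "U + \<i> * V = 0"
        then have "U = - (\<i> * V)" by (simp add: eq_neg_iff_add_eq_0)
        then have "U * cnj V = - (\<i> * of_real ((cmod V)\<^sup>2))"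
            by (simp only: complex_norm_square) (simp add: mult_ac)
        then have "Im (U * cnj V) \<le> 0" by simp
        then show False using pos True by (simp add: zero_less_mult_iff)
      qed
      ultimately show ?thesis by simp
    next
      case False
      then have neg: "\<sigma> < 0" using \<sigma>0 by simp
      have "F x w = U - \<i> * V"
      proof -
        have "cnj z ^ m = of_real (Re (z ^ m)) - \<i> * of_real (Im (z ^ m))" for m
        proof -
          have "cnj c = of_real (Re c) - \<i> * of_real (Im c)" for c by (simp add: complex_eq_iff)
          from this[of "z ^ m"] show ?thesis by (simp only: complex_cnj_power)
        qed
        then have "F x (cnj z) = (\<Sum>k\<le>N. of_nat (N choose k) * (of_real (Re (z ^ (N - k)))
            - \<i> * of_real (Im (z ^ (N - k)))) * \<tau> k x)"
          unfolding F_def by metis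
        then show ?thesis using False by (simp add: wz U V sum_distrib_left sum_subtractf algebra_simps)
      qed
      moreover have "U - \<i> * V \<noteq> 0"
      proof
        assume "U - \<i> * V = 0"
        then have "U = \<i> * V" by simp
        then have "U * cnj V = \<i> * of_real ((cmod V)\<^sup>2)" by (simp only: complex_norm_square) (simp add: mult_ac)
        then have "Im (U * cnj V) \<ge> 0" by simp
        then show False using pos neg by (simp add: zero_less_mult_iff)
      qed
      ultimately show ?thesis by simp
    qed
  qed
  \<comment> \<open>The points \<open>x m\<close> approach 0 from inside the upper half-plane, where
    \<open>F_nz\<close> holds; at the limit F(0, w) is J(w).\<close>
  define x where "x m = \<i> * of_real (1 / real (Suc m))" for m
  define P where "P m = (\<Sum>k\<le>N. monom (of_nat (N choose k) * \<tau> k (x m)) (N - k))" for m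
  have x_lim: "x \<longlonglongrightarrow> 0"
  proof -
    have "(\<lambda>m. \<i> * complex_of_real (1 / real (Suc m))) \<longlonglongrightarrow> \<i> * of_real 0"
      by (intro tendsto_intros LIMSEQ_inverse_real_of_nat[unfolded inverse_eq_divide])
    then show ?thesis by (simp add: x_def[abs_def])
  qed
  have \<tau>_lim: "(\<lambda>m. \<tau> k (x m)) \<longlonglongrightarrow> of_real (tcoeff 0 k)" for k
  proof -
    have "(\<lambda>m. \<tau> k (x m)) \<longlonglongrightarrow> \<tau> k 0" unfolding \<tau>_def by (intro tendsto_poly x_lim)
    then show ?thesis by (simp add: \<tau>_def poly_0_coeff_0 coeff_map_poly tcoeff_def)
  qed
  have J_nz: "poly (cpoly (J N)) w \<noteq> 0" if w: "\<sigma> * Im w > 0" for w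
  proof (rule Hurwitz_poly[of "{w. \<sigma> * Im w > 0}" P N])
    have "{w. \<sigma> * Im w > 0} = (if \<sigma> > 0 then {w. Im w > 0} else {w. Im w < 0})"
      using \<sigma>0 by (auto simp: zero_less_mult_iff)
    then show "open {w. \<sigma> * Im w > 0}" "connected {w. \<sigma> * Im w > 0}"
      by (auto intro!: open_halfspace_Im_gt open_halfspace_Im_lt convex_connected convex_halfspace_Im_gt
          convex_halfspace_Im_lt)
    show "degree (P m) \<le> N" for m
      unfolding P_def by (intro degree_sum_le order.trans[OF degree_monom_le]) auto
    show "(\<lambda>m. coeff (P m) i) \<longlonglongrightarrow> coeff (cpoly (J N)) i" for i
    proof -
      have "coeff (cpoly (J N)) i = (\<Sum>k\<le>N. of_nat (N choose k) * of_real (tcoeff 0 k) * (if N - k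
          = i then 1 else 0))"
        by (simp add: J_def appell_def cpoly_sum cpoly_monom coeff_sum) (intro sum.cong, auto)
      moreover have "coeff (P m) i = (\<Sum>k\<le>N. of_nat (N choose k) * \<tau> k (x m) * (if N - k
          = i then 1 else 0))" for m
        by (simp add: P_def coeff_sum) (intro sum.cong, auto)
      ultimately show ?thesis by (simp only:) (intro tendsto_intros \<tau>_lim)
    qed
    show "poly (P m) y \<noteq> 0" if "y \<in> {w. \<sigma> * Im w > 0}" for m y
    proof -
      have "poly (P m) y = F (x m) y" by (simp add: P_def F_def poly_sum poly_monom mult_ac)
      moreover have "Im (x m) > 0" by (simp add: x_def)
      ultimately show ?thesis using F_nz that by simp
    qed
    show "cpoly (J N) \<noteq> 0" using False by (simp add: cpoly_eq_0_iff N_def)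
  qed (use w in auto)
  have "poly (cpoly (J N)) z \<noteq> 0" if z: "Im z > 0" for z
  proof (cases "\<sigma> > 0")
    case True
    then show ?thesis using J_nz[of z] z by simp
  next
    case False
    then have "\<sigma> * Im (cnj z) > 0" using z \<sigma>0 by (simp add: mult_less_0_iff)
    then have "poly (cpoly (J N)) (cnj z) \<noteq> 0" by (rule J_nz)
    then show ?thesis by (simp add: poly_cpoly_cnj)
  qed
  then show ?thesis by (simp add: real_rooted_iff N_def)
qed

text \<open>With alternating signs, binomial inversion writes (-1)^k a_k, up to a fixed sign, as a
  binomial sum with eventually positive terms, so |a_k| stays above a positive constant. Newton's
  inequality for \<open>J\<close> makes (\<alpha>+1)_k |a_k| eventually log-concave, hence at most
  geometric, while (\<alpha>+1)_k outgrows every geometric sequence.\<close>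

lemma not_alternating:
  assumes alt: "\<And>n. n \<ge> n0 \<Longrightarrow> lam (Suc n) * lam n < 0"
  shows False
proof -
  define \<epsilon> where "\<epsilon> = sgn ((-1) ^ n0 * lam n0)"
  define \<mu> where "\<mu> j = \<epsilon> * ((-1) ^ j * lam j)" for j
  have nz: "lam n \<noteq> 0" if "n \<ge> n0" for n using alt[OF that] by auto
  have \<mu>_pos: "\<mu> (n0 + i) > 0" for i
  proof (induction i)
    case 0
    define y where "y = (-1) ^ n0 * lam n0"
    have "\<mu> n0 = \<bar>y\<bar>" unfolding \<mu>_def \<epsilon>_def y_def[symmetric] by (metis abs_sgn mult.commute)
    moreover have "y \<noteq> 0" using nz[of n0] by (simp add: y_def)
    ultimately show ?case by simp
  next
    case (Suc i)
    have "\<mu> (n0 + Suc i) * \<mu> (n0 + i) = - (lam (Suc (n0 + i)) * lam (n0 + i)) * (\<epsilon> * \<epsilon>) * ((-1) ^ (n0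
        + i) * (-1) ^ (n0 + i))"
      by (simp add: \<mu>_def)
    also have "((-1) ^ (n0 + i) * (-1) ^ (n0 + i) :: real) = 1" by (simp flip: power_add)
    also have "\<epsilon> * \<epsilon> = 1" using nz[of n0] by (simp add: \<epsilon>_def sgn_if)
    finally have "\<mu> (n0 + Suc i) * \<mu> (n0 + i) > 0" using alt[of "n0 + i"] by simp
    then show ?case using Suc by (simp add: zero_less_mult_iff)
  qed
  define b where "b k = \<epsilon> * ((-1) ^ k * a k)" for k
  have "b k = (\<Sum>j\<le>k. real (k choose j) * \<mu> j)" for k
    unfolding b_def binomial_inversion[OF lam] \<mu>_def by (simp add: sum_distrib_left mult_ac)
  moreover have "\<mu> j > 0" if "j \<ge> n0" for j using \<mu>_pos[of "j - n0"] that by simp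
  ultimately obtain c k0 where c: "c > 0" "\<And>k. k \<ge> k0 \<Longrightarrow> b k \<ge> c"
    using binomial_sum_eventually_pos[of n0 \<mu>] by auto
  define k1 where "k1 = max k0 (n0 + 1)"
  define g where "g k = poch \<alpha> k * b k" for k
  have g_pos: "g k > 0" if "k \<ge> k1" for k
    using c(1) c(2)[of k] that poch_pos[OF alpha, of k] by (simp add: g_def k1_def)
  have \<epsilon>: "\<epsilon> * \<epsilon> = 1" using nz[of n0] by (simp add: \<epsilon>_def sgn_if)
  have tg: "tcoeff 0 k = \<epsilon> * g k" for k
    using \<epsilon> by (simp add: tcoeff_0 \<gamma>_def g_def b_def mult_ac)
  have newton: "g (Suc (Suc k)) * g k \<le> (g (Suc k))\<^sup>2" if k: "k \<ge> k1" for k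
  proof -
    define n where "n = Suc k"
    have rr: "real_rooted (J (Suc n))" by (rule J_real_rooted) (use alt[of n] k in \<open>auto simp: n_def k1_def\<close>)
    have c0: "coeff (J (Suc n)) 0 = \<epsilon> * g (Suc (Suc k))" "coeff (J (Suc n)) 1 = real (Suc n) * (\<epsilon> * g (Suc k))"
      by (simp_all add: J_def coeff_appell tg n_def)
    have c2: "coeff (J (Suc n)) 2 = real (Suc n choose 2) * (\<epsilon> * g k)"
      by (simp add: J_def coeff_appell tg n_def)
    have "\<epsilon> \<noteq> 0" using \<epsilon> by auto
    then have c00: "coeff (J (Suc n)) 0 \<noteq> 0" using g_pos[of "Suc (Suc k)"] k unfolding c0 by simp
    \<comment> \<open>The binomial weights in the coefficients of \<open>J\<close> exactly cancel
      the factor of Newton's inequality, leaving plain log-concavity of \<open>g\<close>.\<close>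
    have ch: "2 * real (Suc n choose 2) = real (Suc n) * real n"
    proof -
      have "2 * (Suc n choose 2) = Suc n * n" by (simp add: choose_two)
      then show ?thesis by (metis of_nat_mult of_nat_numeral)
    qed
    have "real (Suc n) * (2 * coeff (J (Suc n)) 0 * coeff (J (Suc n)) 2)
        \<le> (real (Suc n) - 1) * (coeff (J (Suc n)) 1)\<^sup>2"
      by (rule newton_inequality[OF rr _ c00]) (simp add: J_def degree_appell_le)
    then have "real (Suc n) * ((2 * real (Suc n choose 2)) * (\<epsilon> * \<epsilon>) * (g (Suc (Suc k)) * g k)) \<le>
        real n * ((real (Suc n))\<^sup>2 * (\<epsilon> * \<epsilon>) * (g (Suc k))\<^sup>2)"
      unfolding c0 c2 by (simp add: power_mult_distrib power2_eq_square mult_ac)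
    then have "(real n * (real (Suc n))\<^sup>2) * (g (Suc (Suc k)) * g k)
        \<le> (real n * (real (Suc n))\<^sup>2) * (g (Suc k))\<^sup>2"
      unfolding ch \<epsilon> by (simp only: power2_eq_square mult_ac mult_1_right mult_1_left)
    moreover have "real n * (real (Suc n))\<^sup>2 > 0" by (simp add: n_def)
    ultimately show ?thesis by (simp only: mult_le_cancel_left_pos)
  qed
  define \<rho> where "\<rho> = g (Suc k1) / g k1"
  have \<rho>: "\<rho> > 0" using g_pos[of k1] g_pos[of "Suc k1"] by (simp add: \<rho>_def)
  have ratio: "g (Suc (k1 + i)) \<le> \<rho> * g (k1 + i)" for i
  proof (induction i)
    case 0
    then show ?case using g_pos[of k1] by (simp add: \<rho>_def)
  next
    case (Suc i)
    have p: "g (k1 + i) > 0" "g (Suc (k1 + i)) > 0" using g_pos by auto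
    have "g (Suc (Suc (k1 + i))) * g (k1 + i) \<le> g (Suc (k1 + i)) * g (Suc (k1 + i))"
      using newton[of "k1 + i"] by (simp add: power2_eq_square)
    also have "\<dots> \<le> g (Suc (k1 + i)) * (\<rho> * g (k1 + i))" using Suc p by (intro mult_left_mono) auto
    finally have "g (Suc (Suc (k1 + i))) * g (k1 + i) \<le> (\<rho> * g (Suc (k1 + i))) * g (k1 + i)"
        by (simp add: mult_ac)
    then show ?case using p by simp
  qed
  have bound: "g (k1 + i) \<le> g k1 * \<rho> ^ i" for i
  proof (induction i)
    case (Suc i)
    have "g (k1 + Suc i) \<le> \<rho> * g (k1 + i)" using ratio[of i] by simp
    also have "\<dots> \<le> \<rho> * (g k1 * \<rho> ^ i)" using Suc \<rho> by (intro mult_left_mono) auto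
    finally show ?case by (simp add: mult_ac)
  qed simp
  \<comment> \<open>From index \<open>K\<close> on, \<open>r\<close> at least doubles at each step,
    although \<open>r_le\<close> bounds it.\<close>
  obtain K where K: "real K \<ge> 2 * \<rho>" using real_arch_simple by blast
  define r where "r i = poch \<alpha> (k1 + i) / \<rho> ^ i" for i
  have r_pos: "r i > 0" for i using poch_pos[OF alpha] \<rho> by (simp add: r_def)
  have r_le: "c * r i \<le> g k1" for i
  proof -
    have "c * poch \<alpha> (k1 + i) \<le> g (k1 + i)"
      using c(2)[of "k1 + i"] poch_pos[OF alpha, of "k1 + i"] by (simp add: g_def k1_def mult.commute)
    also have "\<dots> \<le> g k1 * \<rho> ^ i" by (rule bound)
    finally show ?thesis using \<rho> by (simp add: r_def divide_le_eq)
  qed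
  have r_Suc: "r (Suc i) \<ge> 2 * r i" if "i \<ge> K" for i
  proof -
    have "r (Suc i) = r i * ((\<alpha> + 1 + real (k1 + i)) / \<rho>)" by (simp add: r_def pochhammer_Suc)
    moreover have "(\<alpha> + 1 + real (k1 + i)) / \<rho> \<ge> 2"
      using K that alpha \<rho> by (simp add: le_divide_eq)
    ultimately show ?thesis using mult_left_mono[of 2 "(\<alpha> + 1 + real (k1 + i)) / \<rho>" "r i"] r_pos[of i]
      by (simp add: mult.commute)
  qed
  have r_lin: "r (K + i) \<ge> (1 + real i) * r K" for i
  proof (induction i)
    case (Suc i)
    have "(1 + real (Suc i)) * r K \<le> 2 * ((1 + real i) * r K)" using r_pos[of K] by (simp add: algebra_simps)
    then show ?case using Suc r_Suc[of "K + i"] by simp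
  qed simp
  obtain i where i: "real i * (c * r K) > g k1" using ex_less_of_nat_mult[of "c * r K" "g k1"] c(1) r_pos[of
      K] by auto
  have "c * ((1 + real i) * r K) \<le> c * r (K + i)" using r_lin[of i] c(1) by simp
  also have "\<dots> \<le> g k1" by (rule r_le)
  finally have "real i * (c * r K) + c * r K \<le> g k1" by (simp add: algebra_simps)
  then show False using i c(1) r_pos[of K] by (smt (verit) mult_pos_pos)
qed

end

section \<open>Root configurations compatible with the Wronskian inequality\<close>

text \<open>At a root of order e + 2, x - z0 times the Wronskian expression is an even power of x -
  z0 times a polynomial E. The sign change of x - z0 forces E(z0) = 0, whereas the x J'' term gives
  E(z0) = -2 z0 (e+2) (e+1) K(z0)^2, nonzero for z0 \<noteq> 0.\<close>

lemma nonzero_root_simple: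
  fixes Jp Ht :: "real poly"
  assumes Ht: "Ht = [:\<nu>, 1:] * pderiv Jp - smult \<kappa> Jp - [:0, 1:] * pderiv (pderiv Jp)"
    and ineq: "\<And>z. poly Ht z * poly (pderiv Jp) z - poly Jp z * poly (pderiv Ht) z \<ge> 0"
    and J0: "Jp \<noteq> 0" and z0: "z0 \<noteq> 0" "poly Jp z0 = 0"
  shows "poly (pderiv Jp) z0 \<noteq> 0"
proof
  assume d0: "poly (pderiv Jp) z0 = 0"
  define \<zeta> where "\<zeta> = [:-z0, 1:]"
  have dz: "pderiv \<zeta> = 1" by (simp add: \<zeta>_def pderiv_pCons)
  obtain K where K: "Jp = \<zeta> ^ order z0 Jp * K" "\<not> \<zeta> dvd K"
    using order_decomp[OF J0, of z0] by (auto simp: \<zeta>_def)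
  have Kz: "poly K z0 \<noteq> 0" using K(2) by (simp add: \<zeta>_def poly_eq_0_iff_dvd)
  have "order z0 Jp \<noteq> 0" using z0(2) J0 by (simp add: order_root)
  moreover have "order z0 Jp \<noteq> 1"
  proof
    assume "order z0 Jp = 1"
    then have "Jp = \<zeta> * K" using K(1) by simp
    then have "pderiv Jp = \<zeta> * pderiv K + K * pderiv \<zeta>" by (simp add: pderiv_mult)
    then have "poly (pderiv Jp) z0 = poly K z0" by (simp only: dz) (simp add: \<zeta>_def)
    then show False using Kz d0 by simp
  qed
  ultimately obtain e where e: "order z0 Jp = Suc (Suc e)" by (metis One_nat_def not0_implies_Suc)
  have J: "Jp = \<zeta> ^ Suc (Suc e) * K" using K(1) e by simp
  define K1 where "K1 = smult (real (Suc (Suc e))) K + \<zeta> * pderiv K"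
  define K2 where "K2 = smult (real (Suc e)) K1 + \<zeta> * pderiv K1"
  have pd: "pderiv (\<zeta> ^ Suc m * L) = \<zeta> ^ m * (smult (real (Suc m)) L + \<zeta> * pderiv L)" for m L
    unfolding pderiv_mult pderiv_power_Suc dz by (simp add: algebra_simps)
  have J1: "pderiv Jp = \<zeta> ^ Suc e * K1" unfolding J K1_def by (rule pd)
  have J2: "pderiv (pderiv Jp) = \<zeta> ^ e * K2" unfolding J1 K2_def by (rule pd)
  define M where "M = [:\<nu>, 1:] * (\<zeta> * K1) - smult \<kappa> (\<zeta> * (\<zeta> * K)) - [:0, 1:] * K2"
  have HM: "Ht = \<zeta> ^ e * M"
    unfolding Ht J2 unfolding J1 unfolding J M_def by (simp only: power_Suc algebra_simps mult_smult_right)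
  \<comment> \<open>The extra factor \<zeta> avoids the exponent e - 1, so that e = 0 fits the same
    formula.\<close>
  have HM': "\<zeta> * pderiv Ht = \<zeta> ^ e * (smult (real e) M + \<zeta> * pderiv M)"
  proof (cases e)
    case 0
    then show ?thesis by (simp add: HM)
  next
    case (Suc m)
    then show ?thesis unfolding HM Suc pd by (simp add: mult.assoc)
  qed
  define E where "E = M * K1 - K * (smult (real e) M + \<zeta> * pderiv M)"
  have main: "(x - z0) * (poly Ht x * poly (pderiv Jp) x - poly Jp x * poly (pderiv Ht) x)
      = ((x - z0) ^ Suc e)\<^sup>2 * poly E x" for x
  proof -
    have z: "poly \<zeta> x = x - z0" by (simp add: \<zeta>_def)
    have "(x - z0) * poly (pderiv Ht) x = (x - z0) ^ e * poly (smult (real e) M + \<zeta> * pderiv M) x"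
      using arg_cong[OF HM', of "\<lambda>p. poly p x"] by (simp only: poly_mult poly_power z)
    moreover have "(x - z0) * (poly Ht x * poly (pderiv Jp) x - poly Jp x * poly (pderiv Ht) x) =
        (x - z0) * (poly Ht x * poly (pderiv Jp) x) - poly Jp x * ((x - z0) * poly (pderiv Ht) x)"
      by (simp add: algebra_simps)
    ultimately have "(x - z0) * (poly Ht x * poly (pderiv Jp) x - poly Jp x * poly (pderiv Ht) x) =
        (x - z0) * (poly Ht x * poly (pderiv Jp) x) - poly Jp x * ((x - z0) ^ e * poly (smult (real e) M
            + \<zeta> * pderiv M) x)"
      by (simp only:)
    also have "\<dots> = ((x - z0) ^ Suc e)\<^sup>2 * poly E x"
      unfolding J1 HM unfolding J E_def poly_mult poly_power poly_diff z
      by (simp add: algebra_simps power2_eq_square)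
    finally show ?thesis .
  qed
  have Epos: "poly E x \<ge> 0" if "x > z0" for x
  proof -
    have "((x - z0) ^ Suc e)\<^sup>2 * poly E x \<ge> 0" unfolding main[symmetric] using that ineq
        by (intro mult_nonneg_nonneg) auto
    moreover have "((x - z0) ^ Suc e)\<^sup>2 > 0" using that by simp
    ultimately show ?thesis by (simp only: zero_le_mult_iff) linarith
  qed
  have Eneg: "poly E x \<le> 0" if "x < z0" for x
  proof -
    have "((x - z0) ^ Suc e)\<^sup>2 * poly E x \<le> 0" unfolding main[symmetric] using that ineq
        by (intro mult_nonpos_nonneg) auto
    moreover have "((x - z0) ^ Suc e)\<^sup>2 > 0" using that by simp
    ultimately show ?thesis by (simp only: mult_le_0_iff) linarith
  qed
  have lim: "(poly E \<longlongrightarrow> poly E z0) (at z0 within S)" for S by (intro tendsto_intros)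
  have "poly E z0 \<ge> 0"
    by (rule tendsto_lowerbound[OF lim[of "{z0<..}"]])
      (use Epos in \<open>auto simp: eventually_at_filter trivial_limit_at_right_real\<close>)
  moreover have "poly E z0 \<le> 0"
    by (rule tendsto_upperbound[OF lim[of "{..<z0}"]])
      (use Eneg in \<open>auto simp: eventually_at_filter trivial_limit_at_left_real\<close>)
  ultimately have "poly E z0 = 0" by simp
  moreover have "poly E z0 = - 2 * z0 * real (Suc (Suc e)) * real (Suc e) * (poly K z0)\<^sup>2"
  proof -
    have z: "poly \<zeta> z0 = 0" by (simp add: \<zeta>_def)
    have k1: "poly K1 z0 = real (Suc (Suc e)) * poly K z0" by (simp add: K1_def z)
    have k2: "poly K2 z0 = real (Suc e) * poly K1 z0" by (simp add: K2_def z)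
    have m: "poly M z0 = - z0 * poly K2 z0" unfolding M_def poly_diff poly_mult poly_smult z by simp
    have "poly E z0 = poly M z0 * (2 * poly K z0)"
      unfolding E_def poly_diff poly_mult poly_add poly_smult z k1 by (simp add: algebra_simps)
    then show ?thesis unfolding m k2 k1 by (simp add: power2_eq_square algebra_simps)
  qed
  ultimately show False using z0(1) Kz by simp
qed

lemma pderiv_prod_linear:
  fixes Z :: "real set"
  assumes "finite Z" "x \<notin> Z"
  shows "poly (pderiv (\<Prod>s\<in>Z. [:-s, 1:])) x = poly (\<Prod>s\<in>Z. [:-s, 1:]) x * (\<Sum>s\<in>Z. 1 / (x - s))"
  using assms
proof (induction Z)
  case (insert s Z)
  define P where "P = (\<Prod>s\<in>Z. [:-s, 1:])"
  have IH: "poly (pderiv P) x = poly P x * (\<Sum>s\<in>Z. 1 / (x - s))" using insert by (simp add: P_def)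
  have "poly (pderiv ([:-s, 1:] * P)) x = (x - s) * poly (pderiv P) x + poly P x"
    unfolding pderiv_mult by (simp add: pderiv_pCons algebra_simps)
  also have "\<dots> = (x - s) * poly P x * (1 / (x - s) + (\<Sum>s\<in>Z. 1 / (x - s)))"
    using insert.prems by (simp add: IH distrib_left mult_ac)
  finally show ?case using insert.hyps by (simp add: P_def[symmetric] del: mult_pCons_left)
qed simp

text \<open>Summing the hypothesis over the small roots with weight \<open>r^2\<close> symmetrises the interaction
  terms, since \<open>(r^3 - s^3)/(r - s) = r^2 + rs + s^2\<close>.\<close>

lemma cluster_inequality:
  fixes Z C B :: "real set"
  assumes fin: "finite Z" and Z: "Z = C \<union> B" "C \<inter> B = {}"
    and ineq: "\<And>r. r \<in> Z \<Longrightarrow> 2 * real m + (\<Sum>s\<in>Z - {r}. 2 * r / (r - s)) \<le> r + \<nu>"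
    and C: "\<And>r. r \<in> C \<Longrightarrow> r \<noteq> 0 \<and> \<bar>r\<bar> \<le> \<tau>" "C \<noteq> {}"
    and B: "\<And>s. s \<in> B \<Longrightarrow> \<bar>s\<bar> \<ge> \<tau> + g" "card B \<le> K" and g: "g > 0"
  shows "2 * real m + 2 * real (card C) - 3 - 2 * real K * \<tau> / g \<le> \<tau> + \<nu>"
proof -
  have finC: "finite C" and finB: "finite B" using fin Z by auto
  define Q where "Q = (\<Sum>r\<in>C. r\<^sup>2)"
  have Q: "Q > 0" unfolding Q_def using C finC by (intro sum_pos) auto
  have \<tau>: "\<tau> \<ge> 0" using C by fastforce
  define D where "D = (\<Sum>r\<in>C. \<Sum>s\<in>C - {r}. 2 * r ^ 3 / (r - s))"
  have D: "D \<ge> (2 * real (card C) - 3) * Q"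
  proof -
    define f where "f r s = (if r = s then 0 else 2 * r ^ 3 / (r - s))" for r s :: real
    have Df: "D = (\<Sum>r\<in>C. \<Sum>s\<in>C. f r s)"
      unfolding D_def
    proof (rule sum.cong[OF refl])
      fix r assume r: "r \<in> C"
      have "(\<Sum>s\<in>C. f r s) = f r r + (\<Sum>s\<in>C - {r}. f r s)" using r finC by (simp add: sum.remove)
      also have "(\<Sum>s\<in>C - {r}. f r s) = (\<Sum>s\<in>C - {r}. 2 * r ^ 3 / (r - s))" by (intro sum.cong) (auto simp: f_def)
      finally show "(\<Sum>s\<in>C - {r}. 2 * r ^ 3 / (r - s)) = (\<Sum>s\<in>C. f r s)" by (simp add: f_def)
    qed
    also have "\<dots> = (\<Sum>r\<in>C. \<Sum>s\<in>C. f s r)" by (rule sum.swap)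
    finally have "2 * D = (\<Sum>r\<in>C. \<Sum>s\<in>C. f r s + f s r)" using Df by (simp add: sum.distrib)
    \<comment> \<open>On the diagonal \<open>f\<close> is 0 while 2 (r^2 + r s + s^2) is 6 r^2,
      hence the correction; it is the source of the 3 in the bound.\<close>
    also have "\<dots> = (\<Sum>r\<in>C. \<Sum>s\<in>C. 2 * (r\<^sup>2 + r * s + s\<^sup>2) - (if s = r then 6 * r\<^sup>2 else 0))"
    proof (intro sum.cong refl)
      fix r s
      show "f r s + f s r = 2 * (r\<^sup>2 + r * s + s\<^sup>2) - (if s = r then 6 * r\<^sup>2 else 0)"
      proof (cases "r = s")
        case True
        then show ?thesis by (simp add: f_def power2_eq_square)
      next
        case False
        have "f r s + f s r = (2 * r ^ 3 - 2 * s ^ 3) / (r - s)"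
          using False by (simp add: f_def diff_divide_distrib) (metis minus_diff_eq minus_divide_right)
        also have "2 * r ^ 3 - 2 * s ^ 3 = 2 * (r\<^sup>2 + r * s + s\<^sup>2) * (r - s)"
          by (simp add: power2_eq_square power3_eq_cube algebra_simps)
        finally show ?thesis using False by simp
      qed
    qed
    also have "\<dots> = (\<Sum>r\<in>C. \<Sum>s\<in>C. 2 * (r\<^sup>2 + r * s + s\<^sup>2)) - 6 * Q"
      using finC by (simp add: sum_subtractf Q_def sum_distrib_left)
    also have "(\<Sum>r\<in>C. \<Sum>s\<in>C. 2 * (r\<^sup>2 + r * s + s\<^sup>2)) = 4 * real (card C) * Q + 2 * (\<Sum>r\<in>C. r)\<^sup>2"
    proof -
      define S where "S = (\<Sum>r\<in>C. r)"
      have "(\<Sum>s\<in>C. 2 * (r\<^sup>2 + r * s + s\<^sup>2)) = 2 * real (card C) * r\<^sup>2 + 2 * S * r + 2 * Q" for r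
        by (simp add: sum.distrib S_def Q_def sum_distrib_left sum_distrib_right distrib_left mult_ac)
      then have "(\<Sum>r\<in>C. \<Sum>s\<in>C. 2 * (r\<^sup>2 + r * s + s\<^sup>2)) = 2 * real (card C) * Q + 2 * S * S
          + real (card C) * (2 * Q)"
        by (simp add: sum.distrib sum_distrib_left[symmetric] sum_distrib_right[symmetric] S_def Q_def)
      then show ?thesis by (simp add: S_def power2_eq_square)
    qed
    finally have "2 * D = 4 * (real (card C) * Q) + 2 * (\<Sum>r\<in>C. r)\<^sup>2 - 6 * Q" by simp
    moreover have "(2 * real (card C) - 3) * Q = 2 * (real (card C) * Q) - 3 * Q" by (simp add: algebra_simps)
    moreover have "(\<Sum>r\<in>C. r)\<^sup>2 \<ge> 0" by simp
    ultimately show ?thesis by linarith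
  qed
  \<comment> \<open>Roots in \<open>B\<close> may interact with either sign, but the gap g bounds
    each term by 2 \<tau> r^2 / g.\<close>
  have X: "(\<Sum>s\<in>B. 2 * r ^ 3 / (r - s)) \<ge> - (2 * real K * \<tau> / g) * r\<^sup>2" if r: "r \<in> C" for r
  proof -
    have "(\<Sum>s\<in>B. - (2 * \<tau> / g * r\<^sup>2)) \<le> (\<Sum>s\<in>B. 2 * r ^ 3 / (r - s))"
    proof (rule sum_mono)
      fix s assume "s \<in> B"
      then have rs: "\<bar>r - s\<bar> \<ge> g" using B(1)[of s] C(1)[OF r] by linarith
      have "\<bar>2 * r ^ 3 / (r - s)\<bar> = 2 * r\<^sup>2 * \<bar>r\<bar> / \<bar>r - s\<bar>"
        by (simp add: abs_mult power2_eq_square power3_eq_cube)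
      also have "\<dots> \<le> 2 * r\<^sup>2 * \<tau> / g"
        using rs g C(1)[OF r] by (intro frac_le mult_left_mono) auto
      finally have "- (2 * r\<^sup>2 * \<tau> / g) \<le> 2 * r ^ 3 / (r - s)"
        using abs_ge_minus_self[of "2 * r ^ 3 / (r - s)"] by linarith
      moreover have "2 * r\<^sup>2 * \<tau> / g = 2 * \<tau> / g * r\<^sup>2" by simp
      ultimately show "- (2 * \<tau> / g * r\<^sup>2) \<le> 2 * r ^ 3 / (r - s)" by (simp only:)
    qed
    moreover have "real (card B) * (2 * \<tau> / g * r\<^sup>2) \<le> real K * (2 * \<tau> / g * r\<^sup>2)"
      using B(2) \<tau> g by (intro mult_right_mono) auto
    ultimately show ?thesis by (simp add: mult_ac)
  qed
  have "(\<Sum>r\<in>C. r\<^sup>2 * (2 * real m) + ((\<Sum>s\<in>C - {r}. 2 * r ^ 3 / (r - s)) + - (2 * real K * \<tau> / g) * r\<^sup>2))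
      \<le> (\<Sum>r\<in>C. r\<^sup>2 * (\<tau> + \<nu>))"
  proof (rule sum_mono)
    fix r assume r: "r \<in> C"
    have "Z - {r} = (C - {r}) \<union> B" "(C - {r}) \<inter> B = {}" using Z r by auto
    then have "(\<Sum>s\<in>Z - {r}. 2 * r / (r - s)) = (\<Sum>s\<in>C - {r}. 2 * r / (r - s)) + (\<Sum>s\<in>B. 2 * r / (r - s))"
      using finC finB by (simp add: sum.union_disjoint)
    then have "r\<^sup>2 * (\<Sum>s\<in>Z - {r}. 2 * r / (r - s)) = (\<Sum>s\<in>C - {r}. 2 * r ^ 3 / (r - s))
        + (\<Sum>s\<in>B. 2 * r ^ 3 / (r - s))"
      by (simp add: distrib_left sum_distrib_left power2_eq_square power3_eq_cube mult_ac)
    moreover have "r\<^sup>2 * (2 * real m + (\<Sum>s\<in>Z - {r}. 2 * r / (r - s))) \<le> r\<^sup>2 * (r + \<nu>)"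
      using ineq[of r] r Z by (intro mult_left_mono) auto
    moreover have "r\<^sup>2 * (r + \<nu>) \<le> r\<^sup>2 * (\<tau> + \<nu>)" using C(1)[OF r] by (intro mult_left_mono) auto
    ultimately show "r\<^sup>2 * (2 * real m) + ((\<Sum>s\<in>C - {r}. 2 * r ^ 3 / (r - s)) + - (2 * real K * \<tau> / g) * r\<^sup>2)
        \<le> r\<^sup>2 * (\<tau> + \<nu>)"
      using X[OF r] by (simp add: distrib_left)
  qed
  then have "Q * (2 * real m) + (D + - (2 * real K * \<tau> / g) * Q) \<le> Q * (\<tau> + \<nu>)"
    by (simp only: sum.distrib sum_distrib_right[symmetric] sum_distrib_left[symmetric] D_def Q_def)
  then have "Q * (2 * real m + 2 * real (card C) - 3 - 2 * real K * \<tau> / g) \<le> Q * (\<tau> + \<nu>)"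
    using D by (simp add: algebra_simps)
  then show ?thesis using Q by simp
qed

text \<open>Pigeonhole: K + 1 disjoint shells beyond \<open>\<beta>\<close> cannot all meet a set
  with at most K elements there.\<close>

lemma gap_exists:
  fixes X :: "real set"
  assumes "finite X" "card {r \<in> X. \<bar>r\<bar> \<ge> \<beta>} \<le> K" "h > 0"
  obtains i where "i \<le> K" "\<And>r. r \<in> X \<Longrightarrow> \<not> (\<beta> + real i * h \<le> \<bar>r\<bar> \<and> \<bar>r\<bar> < \<beta> + real (Suc i) * h)"
proof (rule ccontr)
  assume "\<not> thesis"
  then have "\<forall>i\<in>{..K}. \<exists>r. r \<in> X \<and> \<beta> + real i * h \<le> \<bar>r\<bar> \<and> \<bar>r\<bar> < \<beta> + real (Suc i) * h" using that by auto
  then obtain \<rho> where \<rho>: "\<And>i. i \<le> K \<Longrightarrow> \<rho> i \<in> X \<and> \<beta> + real i * h \<le> \<bar>\<rho> i\<bar> \<and> \<bar>\<rho> i\<bar> < \<beta> + real (Suc i) * h"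
    by (metis atMost_iff)
  have "\<rho> i \<noteq> \<rho> j" if "i < j" "j \<le> K" for i j
  proof
    assume "\<rho> i = \<rho> j"
    then have "\<beta> + real j * h < \<beta> + real (Suc i) * h" using \<rho>[of i] \<rho>[of j] that by simp
    then have "real j < real (Suc i)" using assms(3) by simp
    then show False using that(1) by simp
  qed
  then have inj: "inj_on \<rho> {..K}" by (metis atMost_iff inj_onI linorder_neqE_nat)
  have "\<rho> i \<in> {r \<in> X. \<bar>r\<bar> \<ge> \<beta>}" if "i \<le> K" for i
  proof -
    have "real i * h \<ge> 0" using assms(3) by simp
    then show ?thesis using \<rho>[OF that] by simp
  qed
  then have "\<rho> ` {..K} \<subseteq> {r \<in> X. \<bar>r\<bar> \<ge> \<beta>}" by auto
  then have "card (\<rho> ` {..K}) \<le> card {r \<in> X. \<bar>r\<bar> \<ge> \<beta>}" using assms(1) by (intro card_mono) auto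
  then show False using assms(2) inj by (simp add: card_image)
qed

lemma nonneg_right_factor: "0 \<le> x * y \<Longrightarrow> 0 < x \<Longrightarrow> 0 \<le> y" for x y :: real
  by (simp add: zero_le_mult_iff)

lemma nonzero_simple_decomposition:
  fixes f :: "real poly"
  assumes f: "real_rooted f" "f \<noteq> 0"
    and simple: "\<And>r. poly f r = 0 \<Longrightarrow> r \<noteq> 0 \<Longrightarrow> poly (pderiv f) r \<noteq> 0"
  defines "Z \<equiv> {r. poly f r = 0 \<and> r \<noteq> 0}"
  shows "finite Z" "f = smult (lead_coeff f) (monom 1 (order 0 f) * (\<Prod>s\<in>Z. [:-s, 1:]))"
    "degree f = order 0 f + card Z"
proof -
  define m where "m = order 0 f"
  show fin: "finite Z" using poly_roots_finite[OF f(2)] by (simp add: Z_def)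
  obtain K where K: "f = monom 1 m * K" "\<not> [:-0, 1:] dvd K"
    using order_decomp[OF f(2), of 0] by (auto simp: m_def monom_altdef)
  have K0: "poly K 0 \<noteq> 0" using K(2) poly_eq_0_iff_dvd by blast
  have Kn: "K \<noteq> 0" using K0 by auto
  have Kf: "K * monom 1 m = f" using K(1) by (simp add: mult.commute)
  have "real_rooted (K * monom 1 m)" "K * monom 1 m \<noteq> 0" unfolding Kf by (rule f)+
  then have Krr: "real_rooted K" by (rule real_rooted_factor)
  have KZ: "{r. poly K r = 0} = Z"
    using K0 unfolding Z_def by (subst K(1)) (auto simp: poly_monom)
  have "poly (pderiv K) r \<noteq> 0" if r: "poly K r = 0" for r
  proof -
    have r0: "r \<noteq> 0" using r K0 by auto
    have "poly (pderiv f) r = r ^ m * poly (pderiv K) r"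
      by (subst K(1)) (simp add: pderiv_mult poly_monom r)
    then show ?thesis using simple[of r] r r0 KZ by (auto simp: Z_def)
  qed
  then have card: "card Z = degree K" using card_roots_simple[OF Krr Kn] KZ by simp
  define P where "P = (\<Prod>s\<in>Z. [:-s, 1:])"
  have dP: "degree P = card Z" unfolding P_def by (subst degree_prod_eq_sum_degree) auto
  have lP: "lead_coeff P = 1" unfolding P_def by (subst lead_coeff_prod) simp
  have KP: "K = smult (lead_coeff K) P"
  proof (rule ccontr)
    define d where "d = K - smult (lead_coeff K) P"
    assume "K \<noteq> smult (lead_coeff K) P"
    then have d0: "d \<noteq> 0" by (simp add: d_def)
    have "degree d \<le> degree K" unfolding d_def by (intro degree_diff_le order.trans[OF degree_smult_le])
        (simp_all add: dP card)
    moreover have "coeff d (degree K) = 0" using lP dP card by (simp add: d_def)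
    ultimately have "degree d < degree K" using d0 by (metis leading_coeff_0_iff le_neq_implies_less)
    moreover have "Z \<subseteq> {r. poly d r = 0}" using KZ fin by (auto simp: d_def P_def poly_prod)
    then have "card Z \<le> degree d"
      using card_mono[OF poly_roots_finite[OF d0]] card_poly_roots_bound[OF d0] by (meson order.trans)
    ultimately show False using card by simp
  qed
  have "lead_coeff (monom 1 m * K) = lead_coeff K" by (simp add: lead_coeff_mult degree_monom_eq)
  then have lc: "lead_coeff f = lead_coeff K" unfolding K(1)[symmetric] .
  show "f = smult (lead_coeff f) (monom 1 (order 0 f) * (\<Prod>s\<in>Z. [:-s, 1:]))"
    unfolding lc m_def[symmetric] P_def[symmetric] mult_smult_right[symmetric] KP[symmetric] by (rule K(1))
  show "degree f = order 0 f + card Z"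
    unfolding m_def[symmetric] card by (subst K(1)) (simp add: degree_mult_eq Kn degree_monom_eq)
qed

text \<open>Writing f = (x - r) K gives f'(r) = K(r) and f''(r) = 2 K'(r); the bracket is the
  logarithmic derivative of K at r.\<close>

lemma second_derivative_at_root:
  fixes Z :: "real set"
  assumes fin: "finite Z" and r: "r \<in> Z" "r \<noteq> 0"
    and f: "f = smult l (monom 1 m * (\<Prod>s\<in>Z. [:-s, 1:]))"
  shows "poly (pderiv (pderiv f)) r = 2 * (real m / r + (\<Sum>s\<in>Z - {r}. 1 / (r - s))) * poly (pderiv f) r"
proof -
  define P where "P = (\<Prod>s\<in>Z - {r}. [:-s, 1:])"
  define K where "K = smult l (monom 1 m * P)"
  have "(\<Prod>s\<in>Z. [:-s, 1:]) = [:-r, 1:] * P" unfolding P_def using fin r(1) by (rule prod.remove)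
  then have fK: "f = [:-r, 1:] * K" unfolding f K_def by (simp only: mult_smult_right mult.left_commute)
  have d1: "pderiv f = [:-r, 1:] * pderiv K + K"
    unfolding fK pderiv_mult by (simp add: pderiv_pCons del: mult_pCons_left)
  have d2: "pderiv (pderiv f) = [:-r, 1:] * pderiv (pderiv K) + 2 * pderiv K"
    unfolding d1 pderiv_add pderiv_mult by (simp add: pderiv_pCons algebra_simps del: mult_pCons_left
        mult_pCons_right)
  have "poly (pderiv (monom 1 m)) r = poly (monom 1 m) r * (real m / r)"
    using r(2) by (cases m) (simp_all add: pderiv_monom poly_monom)
  moreover have "poly (pderiv P) r = poly P r * (\<Sum>s\<in>Z - {r}. 1 / (r - s))"
    unfolding P_def using fin by (intro pderiv_prod_linear) auto
  ultimately have "poly (pderiv K) r = poly K r * (real m / r + (\<Sum>s\<in>Z - {r}. 1 / (r - s)))"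
    unfolding K_def pderiv_smult pderiv_mult by (simp add: algebra_simps)
  then show ?thesis unfolding d2 unfolding d1 by simp
qed

text \<open>Reflection discards the power of x and turns each x - s into 1 - s x, whose product
  carries the power sums in its lowest coefficients.\<close>

lemma sum_squares_of_roots:
  fixes Z :: "real set"
  assumes fin: "finite Z" and f: "f = smult l (monom 1 m * (\<Prod>s\<in>Z. [:-s, 1:]))"
  shows "l\<^sup>2 * (\<Sum>s\<in>Z. s\<^sup>2) = (coeff (reflect_poly f) 1)\<^sup>2 - 2 * l * coeff (reflect_poly f) 2"
proof -
  define q where "q = (\<Prod>s\<in>Z. [:1, -s:])"
  have X: "reflect_poly [:0, 1::real:] = 1" by (simp add: reflect_poly_def one_pCons)
  have "reflect_poly [:-s, 1:] = [:1, -s:]" for s :: real by (simp add: reflect_poly_def)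
  then have "reflect_poly f = smult l q"
    unfolding f q_def monom_altdef by (simp add: reflect_poly_smult reflect_poly_mult reflect_poly_power
        reflect_poly_prod X)
  moreover have "q = (\<Prod>x\<in>#mset_set Z. [:1, -x:])" by (simp add: q_def prod_unfold_prod_mset)
  then have "(coeff q 1)\<^sup>2 - 2 * coeff q 2 = (\<Sum>s\<in>Z. s\<^sup>2)"
    using coeffs_prod_reversed(3)[of "mset_set Z"] by (simp add: sum_unfold_sum_mset)
  ultimately show ?thesis by (simp add: power_mult_distrib power2_eq_square algebra_simps)
qed

lemma binomial_Suc_le: "n choose Suc k \<le> n * (n choose k)"
proof -
  have "n choose Suc k \<le> Suc k * (n choose Suc k)" by simp
  also have "\<dots> = (n - k) * (n choose k)" by (metis binomial_absorption binomial_absorb_comp)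
  also have "\<dots> \<le> n * (n choose k)" by simp
  finally show ?thesis .
qed

context lag_multiplier
begin

abbreviation jroots :: "nat \<Rightarrow> real set" where
  "jroots n \<equiv> {r. poly (J n) r = 0 \<and> r \<noteq> 0}"

text \<open>In use \<open>m0\<close> is the least index with \<open>\<gamma> m0 \<noteq> 0\<close>,
  which makes n - m0 the degree of \<open>J n\<close>, and \<open>C\<close> is independent of
  n.\<close>

definition roots_controlled :: "nat \<Rightarrow> nat \<Rightarrow> real \<Rightarrow> bool" where
  "roots_controlled m0 n C \<longleftrightarrow>
     finite (jroots n) \<and> order 0 (J n) + card (jroots n) + m0 = n \<and>
     (\<forall>r\<in>jroots n. 2 * real (order 0 (J n)) + (\<Sum>s\<in>jroots n - {r}. 2 * r / (r - s)) \<le> r + (real n + \<alpha>)) \<and>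
     (\<Sum>r\<in>jroots n. r\<^sup>2) \<le> C * (real n)\<^sup>2"

text \<open>At a nonzero root r the Wronskian inequality reads Ht(r) J'(r) \<ge> 0. There J'(r) is a
  factor of Ht(r), and dividing by its square leaves the inequality between roots. The sum of
  squares comes from the top three coefficients, which are fixed numbers times n choose (m0 + i), at
  most n^i times n choose m0.\<close>

lemma J_facts:
  assumes pos: "\<And>n. n \<ge> n0 \<Longrightarrow> lam (Suc n) * lam n > 0"
  obtains N0 m0 C where "\<gamma> m0 \<noteq> 0"
    "\<And>n. n \<ge> N0 \<Longrightarrow> J n \<noteq> 0 \<and> real_rooted (J n) \<and> roots_controlled m0 n C"
proof -
  have "\<exists>k. \<gamma> k \<noteq> 0"
  proof (rule ccontr)
    assume "\<not> ?thesis"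
    then have "a k = 0" for k using poch_pos[OF alpha, of k] by (metis \<gamma>_def less_irrefl mult_eq_0_iff)
    then have "lam n0 = 0" by (simp add: lam)
    then show False using pos[of n0] by simp
  qed
  define m0 where "m0 = (LEAST k. \<gamma> k \<noteq> 0)"
  have m0: "\<gamma> m0 \<noteq> 0" unfolding m0_def using \<open>\<exists>k. \<gamma> k \<noteq> 0\<close> by (rule LeastI_ex)
  have low: "\<gamma> k = 0" if "k < m0" for k using that not_less_Least unfolding m0_def by blast
  define c where "c = tcoeff 0"
  have c: "c k = 0" if "k < m0" for k using low[OF that] by (simp add: c_def tcoeff_0)
  have cm: "c m0 \<noteq> 0" using m0 by (simp add: c_def tcoeff_0)
  define g1 g2 where "g1 = \<bar>c (m0 + 1) / c m0\<bar>" and "g2 = \<bar>c (m0 + 2) / c m0\<bar>"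
  define C where "C = g1\<^sup>2 + 2 * g2"
  \<comment> \<open>\<open>Suc n0\<close> provides the predecessor index of the Wronskian; m0 + 2
    ensures that the three top coefficients exist.\<close>
  define N0 where "N0 = max (Suc n0) (m0 + 2)"
  have cJ: "coeff (J n) i = (if i \<le> n then real (n choose i) * c (n - i) else 0)" for n i
    by (simp add: J_def coeff_appell c_def)
  have facts: "J n \<noteq> 0 \<and> real_rooted (J n) \<and> roots_controlled m0 n C" if n: "n \<ge> N0" for n
  proof -
    obtain n' where n': "n = Suc n'" "n' \<ge> n0" using n by (cases n) (auto simp: N0_def)
    have nm: "n \<ge> m0 + 2" using n by (simp add: N0_def)
    have lc: "coeff (J n) (n - m0) = real (n choose m0) * c m0"
      using nm binomial_symmetric[of m0 n] by (simp add: cJ)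
    have lc0: "coeff (J n) (n - m0) \<noteq> 0" using lc cm nm by simp
    then have J0: "J n \<noteq> 0" by auto
    have deg: "degree (J n) = n - m0"
    proof (rule order_antisym)
      show "degree (J n) \<le> n - m0"
      proof (rule degree_le, intro allI impI)
        fix i assume "n - m0 < i"
        then show "coeff (J n) i = 0" by (auto simp: cJ intro!: c)
      qed
      show "n - m0 \<le> degree (J n)" by (rule le_degree[OF lc0])
    qed
    define L where "L = lam (Suc n') * lam n'"
    have L: "L > 0" unfolding L_def by (rule pos[OF n'(2)])
    then have ne: "lam (Suc n') * lam n' \<noteq> 0" unfolding L_def[symmetric] by simp
    have rr: "real_rooted (J n)" unfolding n'(1) by (rule J_real_rooted[OF ne])
    define Ht where "Ht = smult (\<alpha> + 1) (H n)"
    have Ht: "Ht = [:real n + \<alpha>, 1:] * pderiv (J n) - smult (real n) (J n) - [:0, 1:] * pderiv (pderiv (J n))"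
      unfolding Ht_def by (rule H_eq)
    have ray: "poly Ht z * poly (pderiv (J n)) z - poly (J n) z * poly (pderiv Ht) z \<ge> 0" for z
    proof -
      have "poly (H n) z * poly (pderiv (J n)) z - poly (J n) z * poly (pderiv (H n)) z \<ge> 0"
        using rayleigh[OF ne, of z] L unfolding L_def[symmetric] unfolding n'(1)[symmetric]
            by (rule nonneg_right_factor)
      then have "(\<alpha> + 1) * (poly (H n) z * poly (pderiv (J n)) z - poly (J n) z * poly (pderiv (H n)) z) \<ge> 0"
        using alpha by (intro mult_nonneg_nonneg) auto
      then show ?thesis unfolding Ht_def pderiv_smult poly_smult by (simp add: algebra_simps)
    qed
    have simple: "poly (pderiv (J n)) r \<noteq> 0" if "poly (J n) r = 0" "r \<noteq> 0" for r
      by (rule nonzero_root_simple[OF Ht ray J0 that(2,1)])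
    note dec = nonzero_simple_decomposition[OF rr J0 simple]
    define m where "m = order 0 (J n)"
    define l where "l = lead_coeff (J n)"
    have l: "l = real (n choose m0) * c m0" by (simp add: l_def deg lc)
    have l0: "l \<noteq> 0" using J0 by (simp add: l_def)
    have cards: "m + card (jroots n) + m0 = n" using dec(3) deg nm by (simp add: m_def)
    have Jdec: "J n = smult l (monom 1 m * (\<Prod>s\<in>jroots n. [:-s, 1:]))" unfolding l_def m_def by (rule dec(2))
    have ineq: "2 * real m + (\<Sum>s\<in>jroots n - {r}. 2 * r / (r - s)) \<le> r + (real n + \<alpha>)" if r: "r \<in> jroots n" for r
    proof -
      define d where "d = poly (pderiv (J n)) r"
      have d0: "d \<noteq> 0" using simple r by (simp add: d_def)
      have r0: "r \<noteq> 0" using r by simp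
      define S where "S = (\<Sum>s\<in>jroots n - {r}. 1 / (r - s))"
      have d2: "poly (pderiv (pderiv (J n))) r = 2 * (real m / r + S) * d"
        unfolding d_def S_def by (rule second_derivative_at_root[OF dec(1) r r0 Jdec])
      have "poly Ht r = (real n + \<alpha> + r) * d - r * (2 * (real m / r + S) * d)"
        unfolding Ht poly_diff poly_mult poly_smult d2 d_def using r by (simp add: algebra_simps)
      also have "\<dots> = d * (real n + \<alpha> + r - 2 * real m - 2 * r * S)"
        using r0 by (simp add: algebra_simps)
      finally have "poly Ht r = d * (real n + \<alpha> + r - 2 * real m - 2 * r * S)" .
      moreover have "poly Ht r * d \<ge> 0" using ray[of r] r by (simp add: d_def)
      ultimately have "d * d * (real n + \<alpha> + r - 2 * real m - 2 * r * S) \<ge> 0" by (simp add: mult_ac)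
      moreover have "d * d > 0" using d0 by (simp add: zero_less_mult_iff) linarith
      ultimately have "real n + \<alpha> + r - 2 * real m - 2 * r * S \<ge> 0" by (rule nonneg_right_factor)
      moreover have "(\<Sum>s\<in>jroots n - {r}. 2 * r / (r - s)) = 2 * r * S"
        by (simp add: S_def sum_distrib_left)
      ultimately show ?thesis by simp
    qed
    have bound: "(\<Sum>r\<in>jroots n. r\<^sup>2) \<le> C * (real n)\<^sup>2"
    proof -
      define Q where "Q = (\<Sum>r\<in>jroots n. r\<^sup>2)"
      define x where "x i = real (n choose (m0 + i))" for i
      have x0: "x 0 > 0" using nm by (simp add: x_def)
      have x1: "x 1 \<le> real n * x 0" "x 2 \<le> real n * x 1"
        using binomial_Suc_le[of n m0] binomial_Suc_le[of n "Suc m0"]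
        by (simp_all add: x_def flip: of_nat_mult of_nat_Suc)
      have x2: "x 2 \<le> (real n)\<^sup>2 * x 0"
        using x1 mult_left_mono[OF x1(1), of "real n"] by (simp add: power2_eq_square mult.assoc)
      have rc: "coeff (reflect_poly (J n)) i = x i * c (m0 + i)" if "i \<le> 2" for i
      proof -
        have "n choose (n - (m0 + i)) = n choose (m0 + i)" using binomial_symmetric[of "m0 + i" n] nm that
            by simp
        then show ?thesis using that nm by (simp add: coeff_reflect_poly deg cJ x_def)
      qed
      have "l\<^sup>2 * Q = (x 1 * c (m0 + 1))\<^sup>2 - 2 * l * (x 2 * c (m0 + 2))"
        using sum_squares_of_roots[OF dec(1) Jdec, folded Q_def] rc[of 1] rc[of 2] by simp
      also have "\<dots> = l\<^sup>2 * ((x 1 / x 0)\<^sup>2 * (c (m0 + 1) / c m0)\<^sup>2 - 2 * ((x 2 / x 0) * (c (m0 + 2) / c m0)))"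
        using x0 cm unfolding l by (simp add: x_def power_mult_distrib power_divide power2_eq_square
            field_simps)
      finally have "Q = (x 1 / x 0)\<^sup>2 * (c (m0 + 1) / c m0)\<^sup>2 - 2 * ((x 2 / x 0) * (c (m0 + 2) / c m0))"
        using l0 by simp
      moreover have "(x 1 / x 0)\<^sup>2 * (c (m0 + 1) / c m0)\<^sup>2 \<le> (real n)\<^sup>2 * g1\<^sup>2"
      proof -
        have "x 1 / x 0 \<le> real n" "x 1 / x 0 \<ge> 0" using x0 x1(1) by (simp_all add: divide_le_eq x_def)
        then have "(x 1 / x 0)\<^sup>2 \<le> (real n)\<^sup>2" by (rule power_mono)
        then show ?thesis unfolding g1_def power2_abs by (rule mult_right_mono) simp
      qed
      moreover have "\<bar>(x 2 / x 0) * (c (m0 + 2) / c m0)\<bar> \<le> (real n)\<^sup>2 * g2"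
      proof -
        have "x 2 / x 0 \<le> (real n)\<^sup>2" "x 2 / x 0 \<ge> 0" using x0 x2 by (simp_all add: divide_le_eq x_def)
        then show ?thesis unfolding g2_def abs_mult by (intro mult_right_mono) auto
      qed
      ultimately have "Q \<le> (real n)\<^sup>2 * g1\<^sup>2 + 2 * ((real n)\<^sup>2 * g2)" by linarith
      then show ?thesis by (simp add: Q_def C_def algebra_simps)
    qed
    show ?thesis unfolding roots_controlled_def using J0 rr dec(1) cards ineq bound by (simp add: m_def)
  qed
  show ?thesis using that[OF m0 facts] .
qed

text \<open>At most \<open>C/\<delta>\<^sup>2\<close> roots exceed \<open>\<delta> n\<close>, so by the pigeonhole principle some annulus just above
  \<open>\<delta> n\<close> of width proportional to \<open>n\<close> is free of roots; \<open>cluster_inequality\<close> is applied to the roots inside it.\<close>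

lemma jroots_large:
  assumes ctrl: "\<And>n. n \<ge> N0 \<Longrightarrow> roots_controlled m0 n C"
    and \<delta>: "0 < \<delta>" "\<delta> < 1"
  shows "eventually (\<lambda>n. \<forall>r\<in>jroots n. \<delta> * real n \<le> \<bar>r\<bar>) sequentially"
    and "n \<ge> N0 \<Longrightarrow> n > 0 \<Longrightarrow> real (card {r \<in> jroots n. \<delta> * real n \<le> \<bar>r\<bar>}) \<le> C / \<delta>\<^sup>2"
proof -
  have card: "finite (jroots n) \<and> order 0 (J n) + card (jroots n) + m0 = n"
    and ineq: "r \<in> jroots n \<Longrightarrow>
       2 * real (order 0 (J n)) + (\<Sum>s\<in>jroots n - {r}. 2 * r / (r - s)) \<le> r + (real n + \<alpha>)"
    and sq: "(\<Sum>r\<in>jroots n. r\<^sup>2) \<le> C * (real n)\<^sup>2" if "n \<ge> N0" for n r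
    using ctrl[OF that] unfolding roots_controlled_def by blast+
  have big: "real (card {r \<in> jroots n. \<delta> * real n \<le> \<bar>r\<bar>}) \<le> C / \<delta>\<^sup>2" if n: "n \<ge> N0" "n > 0" for n
  proof -
    define X where "X = {r \<in> jroots n. \<delta> * real n \<le> \<bar>r\<bar>}"
    have "real (card X) * (\<delta> * real n)\<^sup>2 = (\<Sum>r\<in>X. (\<delta> * real n)\<^sup>2)" by simp
    also have "\<dots> \<le> (\<Sum>r\<in>X. r\<^sup>2)"
    proof (rule sum_mono)
      fix r assume "r \<in> X"
      then have "(\<delta> * real n)\<^sup>2 \<le> \<bar>r\<bar>\<^sup>2" using \<delta>(1) by (intro power_mono) (auto simp: X_def)
      then show "(\<delta> * real n)\<^sup>2 \<le> r\<^sup>2" by simp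
    qed
    also have "\<dots> \<le> (\<Sum>r\<in>jroots n. r\<^sup>2)" using card[OF n(1)] by (intro sum_mono2) (auto simp: X_def)
    also have "\<dots> \<le> C * (real n)\<^sup>2" by (rule sq[OF n(1)])
    finally have "(real (card X) * \<delta>\<^sup>2) * (real n)\<^sup>2 \<le> C * (real n)\<^sup>2"
        by (simp add: power_mult_distrib mult.assoc)
    then have "real (card X) * \<delta>\<^sup>2 \<le> C" using n(2) by simp
    then show ?thesis using \<delta>(1) by (simp add: X_def le_divide_eq)
  qed
  then show "n \<ge> N0 \<Longrightarrow> n > 0 \<Longrightarrow> real (card {r \<in> jroots n. \<delta> * real n \<le> \<bar>r\<bar>}) \<le> C / \<delta>\<^sup>2" .
  define K where "K = nat \<lceil>C / \<delta>\<^sup>2\<rceil>"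
  \<comment> \<open>K + 1 shells of width h n reach from \<delta> n exactly to (1 + \<delta>)/2 n,
    still a fixed fraction below n.\<close>
  define h where "h = (1 - \<delta>) / (2 * (real K + 1))"
  have h: "h > 0" using \<delta>(2) by (simp add: h_def)
  \<comment> \<open>Beyond \<open>bnd\<close> the cluster inequality fails: its left side is at
    least 2 n minus a constant, its right side at most (1 + \<delta>)/2 n + n + \<alpha>.\<close>
  define bnd where "bnd = (\<alpha> + 2 * real m0 + 2 * real K + 3 + 2 * real K / h) / ((1 - \<delta>) / 2)"
  have "eventually (\<lambda>n. real n > bnd) sequentially"
    using filterlim_real_sequentially by (simp add: filterlim_at_top_dense)
  moreover have "eventually (\<lambda>n. n \<ge> N0 \<and> n > 0) sequentially"
    using eventually_ge_at_top[of N0] eventually_gt_at_top[of 0] by eventually_elim auto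
  ultimately show "eventually (\<lambda>n. \<forall>r\<in>jroots n. \<delta> * real n \<le> \<bar>r\<bar>) sequentially"
  proof eventually_elim
    case (elim n)
    then have n: "n \<ge> N0" "n > 0" "real n > bnd" by auto
    have cK: "card {r \<in> jroots n. \<bar>r\<bar> \<ge> \<delta> * real n} \<le> K"
      using big[OF n(1,2)] unfolding K_def by linarith
    have fin: "finite (jroots n)" using card[OF n(1)] by simp
    have hn: "h * real n > 0" using h n(2) by simp
    obtain i where i: "i \<le> K" "\<And>r. r \<in> jroots n \<Longrightarrow>
        \<not> (\<delta> * real n + real i * (h * real n) \<le> \<bar>r\<bar> \<and> \<bar>r\<bar> < \<delta> * real n + real (Suc i) * (h * real n))"
      using gap_exists[OF fin cK hn] by blast
    define \<tau> where "\<tau> = \<delta> * real n + real i * (h * real n)"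
    define A where "A = {r \<in> jroots n. \<bar>r\<bar> < \<tau>}"
    define B where "B = {r \<in> jroots n. \<bar>r\<bar> \<ge> \<tau>}"
    have B: "\<bar>s\<bar> \<ge> \<tau> + h * real n" if "s \<in> B" for s
      using i(2)[of s] that by (auto simp: B_def \<tau>_def algebra_simps)
    have \<tau>0: "\<delta> * real n \<le> \<tau>" using hn by (simp add: \<tau>_def)
    have cB: "card B \<le> K"
      using cK card_mono[of "{r \<in> jroots n. \<bar>r\<bar> \<ge> \<delta> * real n}" B] fin \<tau>0 by (fastforce simp: B_def)
    have AB: "jroots n = A \<union> B" "A \<inter> B = {}" by (auto simp: A_def B_def)
    have "A = {}"
    proof (rule ccontr)
      assume A: "A \<noteq> {}"
      have main: "2 * real (order 0 (J n)) + 2 * real (card A) - 3 - 2 * real K * \<tau> / (h * real n)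
          \<le> \<tau> + (real n + \<alpha>)"
        by (rule cluster_inequality[OF fin AB ineq[OF n(1)] _ A B cB hn]) (auto simp: A_def)
      have ih: "real i * h \<le> (1 - \<delta>) / 2"
      proof -
        have "real i * h \<le> real K * h" using i(1) h by (intro mult_right_mono) auto
        also have "\<dots> \<le> (real K + 1) * h" using h by simp
        also have "\<dots> = (1 - \<delta>) / 2"
        proof -
          have "x * ((1 - \<delta>) / (2 * x)) = (1 - \<delta>) / 2" if "x > 0" for x :: real using that by simp
          from this[of "real K + 1"] show ?thesis by (simp only: h_def)
        qed
        finally show ?thesis .
      qed
      have \<tau>n: "\<tau> = (\<delta> + real i * h) * real n" by (simp add: \<tau>_def algebra_simps)
      have \<tau>1: "\<tau> \<le> (1 + \<delta>) / 2 * real n"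
        unfolding \<tau>n using ih by (intro mult_right_mono) (auto simp: field_simps)
      have "2 * real K * \<tau> / (h * real n) = 2 * real K * (\<delta> + real i * h) / h"
        unfolding \<tau>n using n(2) by simp
      also have "\<dots> \<le> 2 * real K * 1 / h"
        using ih \<delta> h by (intro divide_right_mono mult_left_mono) auto
      finally have e1: "2 * real K * \<tau> / (h * real n) \<le> 2 * real K / h" by simp
      have "finite A" "finite B" by (rule finite_subset[OF _ fin], force simp: A_def B_def)+
      from card_Un_disjoint[OF this AB(2)] have "card (jroots n) = card A + card B"
        unfolding AB(1)[symmetric] .
      then have "order 0 (J n) + card A + K + m0 \<ge> n" using card[OF n(1)] cB by linarith
      then have e2: "real (order 0 (J n)) + real (card A) \<ge> real n - real K - real m0" by linarith
      have "2 * (real n - real K - real m0) - 3 - 2 * real K / h \<le> (1 + \<delta>) / 2 * real n + (real n + \<alpha>)"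
      proof -
        have "2 * u - 3 - q2 \<le> q3 + v"
          if "2 * x + 2 * y - 3 - q1 \<le> t + v" "q1 \<le> q2" "u \<le> x + y" "t \<le> q3"
          for x y u v t q1 q2 q3 :: real using that by linarith
        from this[OF main e1 e2 \<tau>1] show ?thesis .
      qed
      then have "(1 - \<delta>) / 2 * real n \<le> \<alpha> + 2 * real m0 + 2 * real K + 3 + 2 * real K / h"
        by (simp add: field_simps)
      then have "real n \<le> bnd" unfolding bnd_def using \<delta>(2) by (simp add: le_divide_eq mult.commute)
      then show False using n(3) by simp
    qed
    then show ?case using \<tau>0 by (auto simp: A_def)
  qed
qed

lemma symbol_zeros:
  assumes pos: "\<And>n. n \<ge> n0 \<Longrightarrow> lam (Suc n) * lam n > 0"
  shows "\<exists>p. (\<forall>k. coeff p k = poch \<alpha> k / fact k * a k) \<and> zeros_in_unit p"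
proof -
  obtain N0 m0 C where m0: "\<gamma> m0 \<noteq> 0"
    and all: "\<And>n. n \<ge> N0 \<Longrightarrow> J n \<noteq> 0 \<and> real_rooted (J n) \<and> roots_controlled m0 n C"
    by (rule J_facts[OF pos], assumption, rule that, assumption, blast)
  have ctrl: "\<And>n. n \<ge> N0 \<Longrightarrow> roots_controlled m0 n C" using all by blast
  have facts: "J n \<noteq> 0 \<and> real_rooted (J n) \<and> finite (jroots n) \<and> order 0 (J n) + card (jroots n) + m0 = n"
    and ineq: "r \<in> jroots n \<Longrightarrow>
       2 * real (order 0 (J n)) + (\<Sum>s\<in>jroots n - {r}. 2 * r / (r - s)) \<le> r + (real n + \<alpha>)" if "n \<ge> N0" for n r
    using all[OF that] unfolding roots_controlled_def by blast+
  have large: "eventually (\<lambda>n. \<forall>r\<in>jroots n. \<delta> * real n \<le> \<bar>r\<bar>) sequentially" if "0 < \<delta>" "\<delta> < 1" for \<delta>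
    by (rule jroots_large(1)[OF ctrl that])
  have half: "0 < (1 / 2 :: real)" "(1 / 2 :: real) < 1" by simp_all
  define K where "K = nat \<lceil>C / (1 / 2)\<^sup>2\<rceil>"
  have ev_card: "eventually (\<lambda>n. card (jroots n) \<le> K) sequentially"
    using large[OF half] eventually_ge_at_top[of N0] eventually_gt_at_top[of 0]
  proof eventually_elim
    case (elim n)
    then have "{r \<in> jroots n. 1 / 2 * real n \<le> \<bar>r\<bar>} = jroots n" by auto
    then have "real (card (jroots n)) \<le> C / (1 / 2)\<^sup>2"
      using jroots_large(2)[OF ctrl half elim(2,3)] by simp
    then show ?case unfolding K_def by linarith
  qed
  define D where "D = m0 + K"
  \<comment> \<open>At most K nonzero roots leave order at least n - m0 - K at 0, so the coefficient
    of z^(n-k), a nonzero multiple of \<open>\<gamma> k\<close>, vanishes for k > m0 + K.\<close>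
  have \<gamma>0: "\<gamma> k = 0" if k: "k > D" for k
  proof (rule ccontr)
    assume nz: "\<gamma> k \<noteq> 0"
    have "eventually (\<lambda>n. card (jroots n) \<le> K \<and> n \<ge> N0 \<and> n \<ge> k) sequentially"
      using ev_card eventually_ge_at_top[of N0] eventually_ge_at_top[of k] by eventually_elim auto
    from eventually_happens'[OF sequentially_bot this] obtain n where n: "card (jroots n)
        \<le> K" "n \<ge> N0" "n \<ge> k" by blast
    have "coeff (J n) (n - k) = real (n choose k) * tcoeff 0 k"
      using n(3) binomial_symmetric[of k n] by (simp add: J_def coeff_appell)
    then have "coeff (J n) (n - k) \<noteq> 0" using nz n(3) by (simp add: tcoeff_0)
    moreover have "monom 1 (order 0 (J n)) dvd J n" using order_1[of 0 "J n"] by (simp add: monom_altdef)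
    then obtain q where "J n = monom 1 (order 0 (J n)) * q" by (elim dvdE)
    then have "coeff (J n) i = 0" if "i < order 0 (J n)" for i using that by (metis coeff_monom_mult not_le)
    ultimately have "order 0 (J n) \<le> n - k" by (meson not_le)
    then have "k \<le> m0 + card (jroots n)" using facts[OF n(2)] n(3) by linarith
    then show False using k n(1) by (simp add: D_def)
  qed
  have ev_pos: "eventually (\<lambda>n. \<forall>r\<in>jroots n. r > 0) sequentially"
  proof -
    have "eventually (\<lambda>n. real n > \<alpha> + 2 * real m0 + 2 * real K) sequentially"
      using filterlim_real_sequentially by (simp add: filterlim_at_top_dense)
    then show ?thesis using ev_card eventually_ge_at_top[of N0]
    proof eventually_elim
      case (elim n)
      show ?case
      proof (rule ccontr)
        assume "\<not> (\<forall>r\<in>jroots n. r > 0)"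
        then obtain r1 where r1: "r1 \<in> jroots n" "r1 \<le> 0" by (meson not_le)
        have fin: "finite (jroots n)" using facts[OF elim(3)] by blast
        define r where "r = Min (jroots n)"
        have r: "r \<in> jroots n" unfolding r_def using fin r1(1) by (intro Min_in) auto
        have rmin: "r \<le> s" if "s \<in> jroots n" for s unfolding r_def using fin that by simp
        have r0: "r < 0" using rmin[OF r1(1)] r1 by auto
        \<comment> \<open>At a negative smallest root all interaction terms are nonnegative, so
          twice the order at 0 would be below n + \<alpha>, although that order is n up to a
          constant.\<close>
        have "(\<Sum>s\<in>jroots n - {r}. 2 * r / (r - s)) \<ge> 0"
        proof (rule sum_nonneg)
          fix s assume "s \<in> jroots n - {r}"
          then have "r - s \<le> 0" using rmin by simp
          then show "0 \<le> 2 * r / (r - s)" using r0 by (intro divide_nonpos_nonpos) auto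
        qed
        then have "2 * real (order 0 (J n)) < real n + \<alpha>" using ineq[OF elim(3) r] r0 by linarith
        moreover have "order 0 (J n) + card (jroots n) + m0 = n" using facts[OF elim(3)] by blast
        then have "real (order 0 (J n)) \<ge> real n - real K - real m0" using elim(2) by linarith
        ultimately show False using elim(1) by linarith
      qed
    qed
  qed
  define p where "p = (\<Sum>k\<le>D. monom (\<gamma> k / fact k) k)"
  have cp: "coeff p k = \<gamma> k / fact k" for k
    using \<gamma>0[of k] by (auto simp: p_def coeff_sum)
  have p0: "p \<noteq> 0" using cp[of m0] m0 by auto
  \<comment> \<open>\<open>P n\<close> is \<open>J n\<close> after the substitution z = -n/y, with
    the power of z removed; its coefficients tend to those of \<open>p\<close>.\<close>
  define P where "P n = (\<Sum>k\<le>D. monom (fact n / (fact (n - k) * real n ^ k) * (\<gamma> k / fact k)) k)" for n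
  have PJ: "poly (cpoly (J n)) (- of_nat n / y) = (- of_nat n / y) ^ n * poly (cpoly (P n)) y"
    if n: "n \<ge> D" "n > 0" and y: "y \<noteq> 0" for n and y :: complex
  proof -
    define w where "w = - of_nat n / y"
    have w0: "w \<noteq> 0" using n y by (simp add: w_def)
    have wy: "w * y = - of_nat n" using y by (simp add: w_def)
    have "poly (cpoly (J n)) w = (\<Sum>k\<le>n. of_real (real (n choose k) * tcoeff 0 k) * w ^ (n - k))"
      by (simp add: J_def appell_def cpoly_sum cpoly_monom poly_sum poly_monom)
    also have "\<dots> = (\<Sum>k\<le>D. of_real (real (n choose k) * tcoeff 0 k) * w ^ (n - k))"
      by (rule sum.mono_neutral_right) (use n \<gamma>0 in \<open>auto simp: tcoeff_0\<close>)
    also have "\<dots> = (\<Sum>k\<le>D. w ^ n * (of_real (fact n / (fact (n - k) * real n ^ k) * (\<gamma> k / fact k)) * y ^ k))"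
    proof (intro sum.cong refl)
      fix k assume "k \<in> {..D}"
      then have k: "k \<le> n" using n by simp
      have ky: "w ^ k * y ^ k = (-1) ^ k * of_nat n ^ k"
        unfolding power_mult_distrib[symmetric] wy by simp
      have "w ^ n * y ^ k = w ^ (n - k) * (w ^ k * y ^ k)" using k
          by (simp add: power_add[symmetric] mult.assoc[symmetric])
      also have "\<dots> = w ^ (n - k) * ((-1) ^ k * of_nat n ^ k)" unfolding ky ..
      finally have wn: "w ^ n * y ^ k = w ^ (n - k) * of_real ((-1) ^ k * real n ^ k)" by simp
      have re: "real (n choose k) * tcoeff 0 k = (fact n / (fact (n
          - k) * real n ^ k) * (\<gamma> k / fact k)) * ((-1) ^ k * real n ^ k)"
        using k n(2) by (simp add: tcoeff_0 binomial_fact field_simps)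
      define X E where "X = fact n / (fact (n - k) * real n ^ k) * (\<gamma> k / fact k)" and "E
          = (-1) ^ k * real n ^ k"
      have "complex_of_real (X * E) * w ^ (n - k) = of_real X * (w ^ (n - k) * of_real E)" by simp
      also have "\<dots> = of_real X * (w ^ n * y ^ k)" by (simp only: wn E_def)
      also have "\<dots> = w ^ n * (of_real X * y ^ k)" by (rule mult.left_commute)
      finally show "of_real (real (n choose k) * tcoeff 0 k) * w ^ (n - k) =
          w ^ n * (of_real (fact n / (fact (n - k) * real n ^ k) * (\<gamma> k / fact k)) * y ^ k)"
        unfolding re X_def E_def .
    qed
    also have "\<dots> = w ^ n * poly (cpoly (P n)) y"
      by (simp add: P_def cpoly_sum cpoly_monom poly_sum poly_monom sum_distrib_left)
    finally show ?thesis by (simp add: w_def)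
  qed
  have roots: "Im y = 0 \<and> -1 \<le> Re y \<and> Re y \<le> 0" if py: "poly (cpoly p) y = 0" for y
  proof (rule ccontr)
    assume out: "\<not> (Im y = 0 \<and> -1 \<le> Re y \<and> Re y \<le> 0)"
    \<comment> \<open>For Re y < -1 this makes -1/\<delta> the midpoint of Re y and -1; otherwise y
      is non-real or positive and any \<delta> serves. Roots r \<ge> \<delta> n give -n/r in
      [-1/\<delta>, 0], a set that excludes y.\<close>
    define \<delta> where "\<delta> = (if Re y < -1 then 2 / (1 - Re y) else 1 / 2)"
    have \<delta>: "0 < \<delta>" "\<delta> < 1" by (auto simp: \<delta>_def)
    define I where "I = complex_of_real ` {-1 / \<delta>..0}"
    have "compact I" unfolding I_def by (intro compact_continuous_image continuous_intros) auto
    then have "open (- I)" by (simp add: compact_imp_closed open_Compl)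
    moreover have "y \<notin> I"
    proof
      assume "y \<in> I"
      then have y: "Im y = 0" "-1 / \<delta> \<le> Re y" "Re y \<le> 0" by (auto simp: I_def)
      then have "Re y < -1" using out by simp
      then have "-1 / \<delta> = (Re y - 1) / 2" by (simp add: \<delta>_def field_simps)
      then show False using y(2) \<open>Re y < -1\<close> by simp
    qed
    ultimately obtain \<epsilon> where \<epsilon>: "\<epsilon> > 0" "ball y \<epsilon> \<subseteq> - I" by (meson ComplI openE)
    have "eventually (\<lambda>n. \<forall>r\<in>jroots n. \<delta> * real n \<le> r) sequentially"
      using large[OF \<delta>] ev_pos by eventually_elim force
    then have "eventually (\<lambda>n. (\<forall>r\<in>jroots n. \<delta> * real n \<le> r) \<and> n \<ge> N0 \<and> n \<ge> D \<and> n > 0) sequentially"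
      using eventually_ge_at_top[of N0] eventually_ge_at_top[of D] eventually_gt_at_top[of 0]
          by eventually_elim auto
    then obtain n1 where n1: "\<And>n. n \<ge> n1 \<Longrightarrow> (\<forall>r\<in>jroots n. \<delta> * real n \<le> r) \<and> n \<ge> N0 \<and> n \<ge> D \<and> n > 0"
      by (auto simp: eventually_sequentially)
    have "poly (cpoly p) y \<noteq> 0"
    proof (rule Hurwitz_poly[of "ball y \<epsilon>" "\<lambda>n. cpoly (P (n + n1))" D])
      show "degree (cpoly (P (n + n1))) \<le> D" for n
        unfolding degree_cpoly P_def by (intro degree_sum_le order.trans[OF degree_monom_le]) auto
      show "(\<lambda>n. coeff (cpoly (P (n + n1))) i) \<longlonglongrightarrow> coeff (cpoly p) i" for i
      proof -
        have "(\<lambda>n. fact n / (fact (n - i) * real n ^ i) * (\<gamma> i / fact i)) \<longlonglongrightarrow> 1 * (\<gamma> i / fact i)"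
          by (intro tendsto_mult tendsto_falling tendsto_const)
        then have "(\<lambda>n. coeff (P n) i) \<longlonglongrightarrow> coeff p i"
          using \<gamma>0[of i] by (cases "i \<le> D") (simp_all add: P_def coeff_sum cp)
        from LIMSEQ_ignore_initial_segment[OF this, of n1] show ?thesis
          by (simp add: coeff_map_poly tendsto_of_real)
      qed
      show "poly (cpoly (P (n + n1))) z \<noteq> 0" if z: "z \<in> ball y \<epsilon>" for n z
      proof
        assume z0: "poly (cpoly (P (n + n1))) z = 0"
        define N where "N = n + n1"
        have N: "\<forall>r\<in>jroots N. \<delta> * real N \<le> r" "N \<ge> N0" "N \<ge> D" "N > 0" using n1[of N] by (auto simp: N_def)
        have zI: "z \<notin> I" using z \<epsilon>(2) by auto
        have "0 \<in> I" unfolding I_def using \<delta> by (intro image_eqI[of _ _ 0]) auto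
        then have zn: "z \<noteq> 0" using zI by auto
        define w where "w = - of_nat N / z"
        have Jw: "poly (cpoly (J N)) w = 0" using PJ[OF N(3,4) zn] z0 by (simp add: w_def N_def)
        have w0: "w \<noteq> 0" using N(4) zn by (simp add: w_def)
        have "Im w = 0" using real_rooted_no_zero Jw facts[OF N(2)] by blast
        then have w: "w = of_real (Re w)" by (simp add: complex_eq_iff)
        then have "Re w \<in> jroots N" using Jw w0 poly_cpoly_of_real[of "J N" "Re w"] by auto
        then have rw: "\<delta> * real N \<le> Re w" using N(1) by blast
        have pos: "Re w > 0" using rw \<delta>(1) N(4) by (smt (verit) mult_pos_pos of_nat_0_less_iff)
        have "z = - of_nat N / w" using w0 zn by (simp add: w_def)
        then have "z = of_real (- real N / Re w)" using w
            by (metis of_real_divide of_real_minus of_real_of_nat_eq)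
        moreover have "- real N / Re w \<in> {-1 / \<delta>..0}"
          using rw pos \<delta>(1) by (simp add: field_simps)
        ultimately have "z \<in> I" unfolding I_def by (rule image_eqI)
        then show False using zI by simp
      qed
    qed (use \<epsilon>(1) p0 in \<open>auto simp: cpoly_eq_0_iff\<close>)
    then show False using py by simp
  qed
  have "real_rooted p"
    unfolding real_rooted_iff using roots by force
  moreover have "-1 \<le> x \<and> x \<le> 0" if "poly p x = 0" for x
    using roots[of "of_real x"] that by (simp add: poly_cpoly_of_real)
  ultimately have "zeros_in_unit p" using p0 by (simp add: zeros_in_unit_def)
  moreover have "coeff p k = poch \<alpha> k / fact k * a k" for k by (simp add: cp \<gamma>_def)
  ultimately show ?thesis by blast
qed

text \<open>By \<open>lam_sign_step\<close> the products of consecutive values eventually share one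
  sign, and \<open>not_alternating\<close> excludes the negative one.\<close>

lemma symbol_zeros_of_nontrivial:
  assumes "\<not> trivial_seq lam"
  shows "\<exists>p. (\<forall>k. coeff p k = poch \<alpha> k / fact k * a k) \<and> zeros_in_unit p"
proof -
  obtain n0 where n0: "\<And>n. n \<ge> n0 \<Longrightarrow> lam n \<noteq> 0" using lam_eventually_nonzero[OF assms] by blast
  define c where "c n = lam (Suc n) * lam n" for n
  have step: "c (Suc n) * c n > 0" if "n \<ge> n0" for n
    unfolding c_def by (rule lam_sign_step) (use n0 that in auto)
  have same: "c (n0 + i) * c n0 > 0" for i
  proof (induction i)
    case 0
    have "c n0 \<noteq> 0" using n0[of n0] n0[of "Suc n0"] by (simp add: c_def)
    then show ?case by (metis add_0_right linorder_neqE_linordered_idom mult_neg_neg mult_pos_pos)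
  next
    case (Suc i)
    then show ?case using step[of "n0 + i"] by (auto simp: zero_less_mult_iff)
  qed
  have "c n0 > 0"
  proof (rule ccontr)
    assume "\<not> c n0 > 0"
    then have "c (n0 + i) < 0" for i using same[of i] by (auto simp: zero_less_mult_iff)
    then have "lam (Suc n) * lam n < 0" if "n \<ge> n0" for n
      using that unfolding c_def by (metis le_add_diff_inverse)
    then show False by (rule not_alternating)
  qed
  then have "c (n0 + i) > 0" for i using same[of i] by (simp add: zero_less_mult_iff)
  then have "lam (Suc n) * lam n > 0" if "n \<ge> n0" for n
    using that unfolding c_def by (metis le_add_diff_inverse)
  then show ?thesis by (rule symbol_zeros)
qed

end

theorem theorem1p1:
  fixes \<alpha> :: real and a :: "nat \<Rightarrow> real" and lam :: "nat \<Rightarrow> real"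
  assumes "\<alpha> > -1"
    and "\<And>n. lam n = (\<Sum>k\<le>n. a k * real (n choose k))"
    and "\<not> trivial_seq lam"
  shows "laguerre_multiplier_seq \<alpha> lam \<longleftrightarrow>
    (\<exists>p :: real poly. (\<forall>k. coeff p k = ((real k + \<alpha>) gchoose k) * a k) \<and>
       real_rooted p \<and> (\<forall>x. poly p x = 0 \<longrightarrow> -1 \<le> x \<and> x \<le> 0))"
proof
  assume "laguerre_multiplier_seq \<alpha> lam"
  then obtain T where "lag_multiplier \<alpha> a lam T"
    using assms(1,2) unfolding laguerre_multiplier_seq_def lag_multiplier_def by blast
  then obtain p where p: "\<And>k. coeff p k = poch \<alpha> k / fact k * a k" "zeros_in_unit p"
    using lag_multiplier.symbol_zeros_of_nontrivial[OF _ assms(3)] by blast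
  then show "\<exists>p :: real poly. (\<forall>k. coeff p k = ((real k + \<alpha>) gchoose k) * a k) \<and>
       real_rooted p \<and> (\<forall>x. poly p x = 0 \<longrightarrow> -1 \<le> x \<and> x \<le> 0)"
    by (intro exI[of _ p]) (simp add: gchoose_poch zeros_in_unit_def)
next
  assume "\<exists>p :: real poly. (\<forall>k. coeff p k = ((real k + \<alpha>) gchoose k) * a k) \<and>
       real_rooted p \<and> (\<forall>x. poly p x = 0 \<longrightarrow> -1 \<le> x \<and> x \<le> 0)"
  then obtain p where p: "\<And>k. coeff p k = poch \<alpha> k / fact k * a k" "real_rooted p"
      "\<And>x. poly p x = 0 \<Longrightarrow> -1 \<le> x \<and> x \<le> 0" by (auto simp: gchoose_poch)
  \<comment> \<open>The zero polynomial counts as real-rooted, but it would vanish at 1, outside the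
    interval.\<close>
  have "p \<noteq> 0" using p(3)[of 1] by auto
  then have "zeros_in_unit p" using p by (simp add: zeros_in_unit_def)
  then show "laguerre_multiplier_seq \<alpha> lam"
    by (rule laguerre_multiplier_sufficient[OF assms(1) p(1) _ assms(2)])
qed

end
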